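(* There exists a generic subset $\mathcal{U}_1$ of $C^\infty(\mathbb{S}^3)$ such that, for all $u\in\mathcal{U}_1$, the function $\mathrm{I}[u]:\mathrm{CL}\to\mathbb{R}$ is of Morse type.
   Context: $\mathbb{S}^3\subset\mathbb{R}^4=\mathbb{R}^2\times\mathbb{R}^2$ is the unit sphere; $T_0=\{(x,y):\|x\|^2=\|y\|^2=1/2\}$ is the standard Clifford torus and $\mathrm{CL}=\{MT_0:M\in O(4)\}$ the 4-dimensional manifold of Clifford tori (diffeomorphic to $O(4)/(O(2)\times O(2))$). For $u\in C^\infty(\mathbb{S}^3)$, $\mathrm{I}[u](T)=\int_Tu\,dA_T$ with $dA_T$ the area form of $T$. A function is of Morse type if all its critical points are non-degenerate. $C^\infty(\mathbb{S}^3)$ carries the smooth topology; generic means containing a countable intersection of open dense subsets. *)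

theory Defs
  imports "HOL-Analysis.Analysis"
begin

definition S3 :: "(real^4) set" where
  "S3 = sphere 0 1"

definition pd :: "4 \<Rightarrow> (real^4 \<Rightarrow> real) \<Rightarrow> (real^4 \<Rightarrow> real)" where
  "pd i f x = deriv (\<lambda>t. f (x + t *\<^sub>R axis i 1)) 0"

definition pds :: "4 list \<Rightarrow> (real^4 \<Rightarrow> real) \<Rightarrow> (real^4 \<Rightarrow> real)" where
  "pds is f = foldr pd is f"

definition smooth_on :: "(real^4) set \<Rightarrow> (real^4 \<Rightarrow> real) \<Rightarrow> bool" where
  "smooth_on U f \<longleftrightarrow>
     (\<forall>is. continuous_on U (pds is f) \<and>
       (\<forall>x\<in>U. \<forall>i. (\<lambda>t. pds is f (x + t *\<^sub>R axis i 1)) differentiable (at 0)))"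

definition radial :: "(real^4 \<Rightarrow> real) \<Rightarrow> (real^4 \<Rightarrow> real)" where
  "radial u x = u (x /\<^sub>R norm x)"

definition CinfS3 :: "(real^4 \<Rightarrow> real) set" where
  "CinfS3 = {u. (\<forall>x. x \<notin> S3 \<longrightarrow> u x = 0) \<and> smooth_on (- {0}) (radial u)}"

definition seminorm_k :: "nat \<Rightarrow> (real^4 \<Rightarrow> real) \<Rightarrow> real" where
  "seminorm_k k u = Sup {\<bar>pds is (radial u) x\<bar> | is x. length is \<le> k \<and> x \<in> S3}"

definition openC :: "(real^4 \<Rightarrow> real) set \<Rightarrow> bool" where
  "openC W \<longleftrightarrow> W \<subseteq> CinfS3 \<and>
     (\<forall>u\<in>W. \<exists>k \<epsilon>. \<epsilon> > 0 \<and> {v \<in> CinfS3. seminorm_k k (v - u) < \<epsilon>} \<subseteq> W)"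

definition denseC :: "(real^4 \<Rightarrow> real) set \<Rightarrow> bool" where
  "denseC D \<longleftrightarrow> (\<forall>u\<in>CinfS3. \<forall>k \<epsilon>. \<epsilon> > 0 \<longrightarrow> (\<exists>v\<in>D. seminorm_k k (v - u) < \<epsilon>))"

definition genericC :: "(real^4 \<Rightarrow> real) set \<Rightarrow> bool" where
  "genericC G \<longleftrightarrow> G \<subseteq> CinfS3 \<and>
     (\<exists>F :: nat \<Rightarrow> (real^4 \<Rightarrow> real) set. (\<forall>n. openC (F n) \<and> denseC (F n)) \<and> (\<Inter>n. F n) \<subseteq> G)"

definition T0par :: "real \<Rightarrow> real \<Rightarrow> real^4" where
  "T0par \<theta> \<phi> = (1 / sqrt 2) *\<^sub>R vector [cos \<theta>, sin \<theta>, cos \<phi>, sin \<phi>]"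

text \<open>I[u](M T0) = integral of u over M T0 w.r.t. area; the area element of the
  parametrisation T0par is 1/2 d\<theta> d\<phi>.\<close>
definition Itor :: "(real^4 \<Rightarrow> real) \<Rightarrow> real^4^4 \<Rightarrow> real" where
  "Itor u M = (1/2) * integral {0..2*pi} (\<lambda>\<theta>. integral {0..2*pi} (\<lambda>\<phi>. u (M *v T0par \<theta> \<phi>)))"

text \<open>Skew matrices complementary to so(2)+so(2): tangent directions to CL at T0.\<close>
definition skewB :: "real^4 \<Rightarrow> real^4^4" where
  "skewB b = (\<chi> i j.
      (if i = 1 \<and> j = 3 then b$1 else if i = 1 \<and> j = 4 then b$2
       else if i = 2 \<and> j = 3 then b$3 else if i = 2 \<and> j = 4 then b$4
       else if i = 3 \<and> j = 1 then - b$1 else if i = 4 \<and> j = 1 then - b$2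
       else if i = 3 \<and> j = 2 then - b$3 else if i = 4 \<and> j = 2 then - b$4
       else 0))"

text \<open>Cayley transform (orthogonal for skew A, local diffeomorphism at 0).\<close>
definition cayley :: "real^4^4 \<Rightarrow> real^4^4" where
  "cayley A = matrix_inv (mat 1 - A) ** (mat 1 + A)"

text \<open>Local chart of CL around M T0: b \<mapsto> M cayley(skewB b) T0; I[u] in this chart.\<close>
definition Ichart :: "(real^4 \<Rightarrow> real) \<Rightarrow> real^4^4 \<Rightarrow> real^4 \<Rightarrow> real" where
  "Ichart u M b = Itor u (M ** cayley (skewB b))"

definition morse_type_I :: "(real^4 \<Rightarrow> real) \<Rightarrow> bool" where
  "morse_type_I u \<longleftrightarrow>
     (\<forall>M. orthogonal_matrix M \<longrightarrow>
        (\<forall>i. pd i (Ichart u M) 0 = 0) \<longrightarrow>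
        det (\<chi> i j. pd i (pd j (Ichart u M)) 0) \<noteq> 0)"

end

theory Submission
  imports Defs
begin

text \<open>
  For fixed \<open>M\<close> the directions \<open>M ** skewB b\<close> represent the tangent space of the space of Clifford
  tori at \<open>M T0\<close>, and block-diagonal skew directions do not move the torus. Since the commutator of
  two matrices \<open>skewB b\<close> is block diagonal, the chart Hessian at a critical point is, up to a factor 4,
  the derivative of the left-invariant gradient. Nondegeneracy of all critical points over a compact
  chart ball is an open condition on \<open>u\<close>. For density, add \<open>\<Sum>j. l j * q j\<close> with four quartic test
  functions \<open>q j\<close> whose gradients form a basis at every point of a small ball: at each \<open>b\<close> exactly one
  parameter \<open>L b\<close> makes \<open>b\<close> critical, and it is a degenerate critical point only if the derivative
  of \<open>L\<close> is singular there, so by Sard's theorem almost every \<open>l\<close> is good. Countably many chart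
  balls, moved by the rotations stabilising the torus, cover the orthogonal group.
\<close>

subsection \<open>Matrices and the Cayley chart\<close>

text \<open>Tori are represented by matrices, so every \<open>M\<close> carries two redundant
  directions, those of the stabiliser so(2)+so(2). They cannot simply be dropped: away from the
  centre of a chart the velocity of the Cayley curve, written as \<open>M ** cayB b ** Z\<close>,
  has a skew \<open>Z\<close> that may contain a block-diagonal part. That part is harmless at a
  critical point, because the commutator of a block-diagonal and a tangent direction is again
  tangent. For the same reason criticality and nondegeneracy are stated at each matrix without a
  chart, and shown to be invariant under the stabiliser rotations. There are exactly as many
  parameters as dimensions of CL, and the gradient is affine in them, so the equation for a critical
  point can be solved for the parameters. The bad set then is an image under a map between spaces of
  equal dimension, where Sard's theorem asks for differentiability only.\<close>

lemma bounded_bilinear_matrix_mult: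
  "bounded_bilinear ((**) :: real^'n^'m \<Rightarrow> real^'p^'n \<Rightarrow> real^'p^'m)"
  unfolding bilinear_conv_bounded_bilinear[symmetric] bilinear_def linear_iff
  by (simp add: vec_eq_iff matrix_matrix_mult_def sum.distrib algebra_simps sum_distrib_left)

lemma bounded_bilinear_matrix_vector_mult:
  "bounded_bilinear ((*v) :: real^'n^'m \<Rightarrow> real^'n \<Rightarrow> real^'m)"
  unfolding bilinear_conv_bounded_bilinear[symmetric] bilinear_def linear_iff
  by (simp add: vec_eq_iff matrix_vector_mult_def sum.distrib algebra_simps sum_distrib_left)

lemmas matrix_mult_bilinear = bounded_bilinear.add_left[OF bounded_bilinear_matrix_mult]
  bounded_bilinear.add_right[OF bounded_bilinear_matrix_mult]
  bounded_bilinear.diff_left[OF bounded_bilinear_matrix_mult]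
  bounded_bilinear.diff_right[OF bounded_bilinear_matrix_mult]
  bounded_bilinear.minus_left[OF bounded_bilinear_matrix_mult]
  bounded_bilinear.minus_right[OF bounded_bilinear_matrix_mult]
  bounded_bilinear.scaleR_left[OF bounded_bilinear_matrix_mult]
  bounded_bilinear.scaleR_right[OF bounded_bilinear_matrix_mult]

lemmas matrix_vector_mult_bilinear = bounded_bilinear.add_left[OF bounded_bilinear_matrix_vector_mult]
  bounded_bilinear.add_right[OF bounded_bilinear_matrix_vector_mult]
  bounded_bilinear.diff_left[OF bounded_bilinear_matrix_vector_mult]
  bounded_bilinear.diff_right[OF bounded_bilinear_matrix_vector_mult]
  bounded_bilinear.minus_left[OF bounded_bilinear_matrix_vector_mult]
  bounded_bilinear.minus_right[OF bounded_bilinear_matrix_vector_mult]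
  bounded_bilinear.scaleR_left[OF bounded_bilinear_matrix_vector_mult]
  bounded_bilinear.scaleR_right[OF bounded_bilinear_matrix_vector_mult]

lemmas continuous_on_matrix_mult [continuous_intros] =
  bounded_bilinear.continuous_on[OF bounded_bilinear_matrix_mult]
lemmas continuous_on_matrix_vector_mult [continuous_intros] =
  bounded_bilinear.continuous_on[OF bounded_bilinear_matrix_vector_mult]

lemma transpose_linear:
  fixes A B :: "real^'n^'m"
  shows "transpose (A + B) = transpose A + transpose B"
    "transpose (A - B) = transpose A - transpose B"
    "transpose (- A) = - transpose A"
  by (simp_all add: transpose_def vec_eq_iff)

lemma continuous_on_transpose [continuous_intros]:
  fixes f :: "'a::topological_space \<Rightarrow> real^'n^'m"
  shows "continuous_on S f \<Longrightarrow> continuous_on S (\<lambda>x. transpose (f x))"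
  unfolding transpose_def by (intro continuous_intros)

lemma continuous_on_det [continuous_intros]:
  fixes f :: "'a::topological_space \<Rightarrow> real^'n^'n"
  shows "continuous_on S f \<Longrightarrow> continuous_on S (\<lambda>x. det (f x))"
  unfolding det_def by (intro continuous_intros)

section \<open>Inverse matrices and the resolvent of a skew matrix\<close>

lemma matrix_inv_invertible:
  fixes A :: "real^'n^'n"
  assumes "invertible A"
  shows "A ** matrix_inv A = mat 1" "matrix_inv A ** A = mat 1"
  using someI_ex[of "\<lambda>B. A ** B = mat 1 \<and> B ** A = mat 1"] assms
  unfolding invertible_def matrix_inv_def by auto

text \<open>Cramer's rule for each column of the inverse writes the entries as quotients of
  determinants; continuity of inversion reduces to continuity of \<open>det\<close>.\<close>

lemma matrix_inv_cramer:
  fixes A :: "real^'n^'n"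
  assumes "invertible A"
  shows "matrix_inv A = (\<chi> k m. det (\<chi> i j. if j = k then axis m 1 $ i else A$i$j) / det A)"
proof -
  have "matrix_inv A $ k $ m = det (\<chi> i j. if j = k then axis m 1 $ i else A$i$j) / det A" for k m
  proof -
    have "A *v (matrix_inv A *v axis m 1) = axis m 1"
      by (simp add: matrix_vector_mul_assoc matrix_inv_invertible[OF assms])
    then have "matrix_inv A *v axis m 1 =
        (\<chi> k. det (\<chi> i j. if j = k then axis m 1 $ i else A$i$j) / det A)"
      using cramer[of A "matrix_inv A *v axis m 1" "axis m 1"] assms by (simp add: invertible_det_nz)
    then have "(matrix_inv A *v axis m 1) $ k =
        det (\<chi> i j. if j = k then axis m 1 $ i else A$i$j) / det A" by simp
    then show ?thesis by (simp add: matrix_vector_mult_basis column_def)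
  qed
  then show ?thesis by (simp add: vec_eq_iff)
qed

lemma continuous_on_matrix_inv [continuous_intros]:
  fixes f :: "'a::topological_space \<Rightarrow> real^'n^'n"
  assumes "continuous_on S f" "\<And>x. x \<in> S \<Longrightarrow> invertible (f x)"
  shows "continuous_on S (\<lambda>x. matrix_inv (f x))"
proof -
  have "continuous_on S (\<lambda>x. (\<chi> k m. det (\<chi> i j. if j = k then axis m 1 $ i else f x$i$j) / det (f x)) :: real^'n^'n)"
  proof (intro continuous_intros)
    show "continuous_on S (\<lambda>x. if j = k then axis m 1 $ i else f x $ i $ j)" for i j k m :: 'n
      using assms(1) by (cases "j = k") (auto intro: continuous_intros)
  qed (use assms in \<open>auto simp: invertible_det_nz\<close>)
  then show ?thesis
    by (rule continuous_on_eq) (simp add: matrix_inv_cramer assms)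
qed

lemma skew_dot:
  fixes A :: "real^'n^'n"
  assumes "transpose A = - A"
  shows "x \<bullet> (A *v x) = 0"
proof -
  have "x \<bullet> (A *v x) = (transpose A *v x) \<bullet> x"
    by (simp add: dot_lmul_matrix)
  also have "\<dots> = - (x \<bullet> (A *v x))" unfolding assms by (simp add: matrix_vector_mult_bilinear inner_commute)
  finally show ?thesis by simp
qed

text \<open>A vector fixed by a skew matrix is orthogonal to itself. Hence the Cayley transform has
  no singularity on skew matrices, and the chart is defined on all of R^4.\<close>

lemma invertible_one_minus_skew:
  fixes A :: "real^'n^'n"
  assumes "transpose A = - A"
  shows "invertible (mat 1 - A)"
proof -
  have "x = 0" if "(mat 1 - A) *v x = 0" for x
  proof -
    have "x = A *v x" using that by (simp add: matrix_vector_mult_bilinear)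
    then have "x \<bullet> x = x \<bullet> (A *v x)" by simp
    then show ?thesis using skew_dot[OF assms] by simp
  qed
  then show ?thesis
    by (metis invertible_left_inverse matrix_left_invertible_ker)
qed

lemma invertible_one_plus_skew:
  fixes A :: "real^'n^'n"
  assumes "transpose A = - A"
  shows "invertible (mat 1 + A)"
  using invertible_one_minus_skew[of "-A"] assms by (simp add: transpose_linear)

lemma invertible_orthogonal:
  fixes M :: "real^'n^'n" shows "orthogonal_matrix M \<Longrightarrow> invertible M"
  unfolding orthogonal_matrix_def invertible_def by blast

lemma linear_skewB: "linear skewB"
  by (simp add: linear_iff vec_eq_iff skewB_def)

lemma transpose_skewB [simp]: "transpose (skewB b) = - skewB b"
  unfolding transpose_def vec_eq_iff forall_4 skewB_def by simp

lemma bounded_linear_skewB: "bounded_linear skewB"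
  by (simp add: linear_skewB linear_conv_bounded_linear[symmetric])

lemmas continuous_on_skewB [continuous_intros] =
  bounded_linear.continuous_on[OF bounded_linear_skewB]

text \<open>The resolvent at 1. The chart \<open>cayB\<close> is affine in it, so derivatives of the
  chart come from the resolvent identity \<open>resB_diff\<close>.\<close>

definition resB :: "real^4 \<Rightarrow> real^4^4" where "resB b = matrix_inv (mat 1 - skewB b)"
definition cayB :: "real^4 \<Rightarrow> real^4^4" where "cayB b = cayley (skewB b)"

lemma resB_inv: "(mat 1 - skewB b) ** resB b = mat 1" "resB b ** (mat 1 - skewB b) = mat 1"
  unfolding resB_def by (simp_all add: matrix_inv_invertible invertible_one_minus_skew)

lemma cayB_alt: "cayB b = 2 *\<^sub>R resB b - mat 1"
proof -
  have "resB b ** (mat 1 + skewB b) = 2 *\<^sub>R resB b - resB b ** (mat 1 - skewB b)"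
    by (simp add: matrix_mult_bilinear scaleR_2)
  then show ?thesis unfolding cayB_def cayley_def resB_inv by (simp add: resB_def)
qed

lemma continuous_on_resB [continuous_intros]:
  "continuous_on S f \<Longrightarrow> continuous_on S (\<lambda>x. resB (f x))"
  unfolding resB_def by (intro continuous_intros) (simp_all add: invertible_one_minus_skew)

lemma continuous_on_cayB [continuous_intros]:
  "continuous_on S f \<Longrightarrow> continuous_on S (\<lambda>x. cayB (f x))"
  unfolding cayB_alt by (intro continuous_intros)

lemma skewB_0 [simp]: "skewB 0 = 0" using linear_skewB linear_0 by blast
lemma resB_0 [simp]: "resB 0 = mat 1"
  using resB_inv(1)[of 0] by simp
lemma cayB_0 [simp]: "cayB 0 = mat 1" by (simp add: cayB_alt scaleR_2)

lemma resB_diff: "resB c - resB b = resB c ** skewB (c - b) ** resB b"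
proof -
  have "resB c ** skewB (c - b) ** resB b = resB c ** ((mat 1 - skewB b) - (mat 1 - skewB c)) ** resB b"
    by (simp add: linear_diff[OF linear_skewB])
  also have "\<dots> = resB c ** ((mat 1 - skewB b) ** resB b) - (resB c ** (mat 1 - skewB c)) ** resB b"
    by (simp only: matrix_mult_bilinear matrix_mul_assoc)
  finally show ?thesis by (simp add: resB_inv)
qed

text \<open>By the resolvent identity the difference quotient between \<open>s\<close> and
  \<open>t\<close> is exactly the product of the resolvent at \<open>s\<close>,
  \<open>skewB c\<close> and the resolvent at \<open>t\<close>, so continuity of the resolvent
  suffices for the limit.\<close>

lemma has_vector_derivative_resB:
  "((\<lambda>t. resB (b + t *\<^sub>R c)) has_vector_derivative
    resB (b + t *\<^sub>R c) ** skewB c ** resB (b + t *\<^sub>R c)) (at t within T)"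
proof -
  let ?R = "\<lambda>t. resB (b + t *\<^sub>R c)"
  have "((\<lambda>s. ?R s ** skewB c ** ?R t) \<longlongrightarrow> ?R t ** skewB c ** ?R t) (at t)"
  proof -
    have "continuous_on UNIV (\<lambda>s. ?R s ** skewB c ** ?R t)" by (intro continuous_intros)
    then show ?thesis unfolding continuous_on_def by auto
  qed
  then have "((\<lambda>s. (?R s - ?R t) /\<^sub>R (s - t)) \<longlongrightarrow> ?R t ** skewB c ** ?R t) (at t)"
  proof (rule Lim_transform_eventually)
    show "\<forall>\<^sub>F s in at t. ?R s ** skewB c ** ?R t = (?R s - ?R t) /\<^sub>R (s - t)"
      unfolding eventually_at_filter
    proof (rule always_eventually, intro allI impI)
      fix s assume "s \<noteq> t"
      have "?R s - ?R t = ?R s ** skewB ((s - t) *\<^sub>R c) ** ?R t"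
        unfolding resB_diff by (simp add: algebra_simps)
      also have "\<dots> = (s - t) *\<^sub>R (?R s ** skewB c ** ?R t)"
        unfolding linear_scale[OF linear_skewB] matrix_mult_bilinear ..
      finally show "?R s ** skewB c ** ?R t = (?R s - ?R t) /\<^sub>R (s - t)" using \<open>s \<noteq> t\<close> by simp
    qed
  qed
  then have "((\<lambda>s. norm ((?R s - ?R t) /\<^sub>R (s - t) - ?R t ** skewB c ** ?R t)) \<longlongrightarrow> 0) (at t)"
    by (simp add: tendsto_norm_zero_iff LIM_zero_iff)
  then have "((\<lambda>s. norm (?R s - ?R t - (s - t) *\<^sub>R (?R t ** skewB c ** ?R t)) / norm (s - t)) \<longlongrightarrow> 0) (at t)"
  proof (rule Lim_transform_eventually)
    show "\<forall>\<^sub>F s in at t. norm ((?R s - ?R t) /\<^sub>R (s - t) - ?R t ** skewB c ** ?R t) =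
        norm (?R s - ?R t - (s - t) *\<^sub>R (?R t ** skewB c ** ?R t)) / norm (s - t)"
      unfolding eventually_at_filter
    proof (rule always_eventually, intro allI impI)
      fix s assume "s \<noteq> t"
      then have "(?R s - ?R t) /\<^sub>R (s - t) - ?R t ** skewB c ** ?R t =
          (?R s - ?R t - (s - t) *\<^sub>R (?R t ** skewB c ** ?R t)) /\<^sub>R (s - t)"
        by (simp add: scaleR_diff_right)
      then show "norm ((?R s - ?R t) /\<^sub>R (s - t) - ?R t ** skewB c ** ?R t) =
          norm (?R s - ?R t - (s - t) *\<^sub>R (?R t ** skewB c ** ?R t)) / norm (s - t)"
        by (simp add: divide_inverse_commute)
    qed
  qed
  then have "(?R has_vector_derivative ?R t ** skewB c ** ?R t) (at t)"
    unfolding has_vector_derivative_def has_derivative_iff_norm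
    by (simp add: bounded_linear_scaleR_left)
  then show ?thesis by (rule has_vector_derivative_at_within)
qed

lemma has_vector_derivative_cayB:
  "((\<lambda>t. cayB (b + t *\<^sub>R c)) has_vector_derivative
    2 *\<^sub>R (resB (b + t *\<^sub>R c) ** skewB c ** resB (b + t *\<^sub>R c))) (at t within T)"
  unfolding cayB_alt
  by (auto intro!: derivative_eq_intros has_vector_derivative_resB)

lemma transpose_resB: "transpose (resB b) ** (mat 1 + skewB b) = mat 1"
   "(mat 1 + skewB b) ** transpose (resB b) = mat 1"
  using arg_cong[OF resB_inv(1)[of b], of transpose] arg_cong[OF resB_inv(2)[of b], of transpose]
  by (simp_all add: matrix_transpose_mul transpose_linear)

text \<open>Lets \<open>cayB b\<close> be pulled out of the chart velocity
  \<open>resB b ** E ** resB b\<close>. What remains is the congruence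
  \<open>transpose (resB b) ** E ** resB b\<close>, which is skew when \<open>E\<close> is.\<close>

lemma cayB_res: "cayB b ** transpose (resB b) = resB b"
proof -
  have "cayB b = resB b ** (mat 1 + skewB b)"
    unfolding cayB_def cayley_def resB_def ..
  then show ?thesis by (metis matrix_mul_assoc matrix_mul_rid transpose_resB(2))
qed

text \<open>With A = \<open>skewB b\<close> the transpose of (1 - A)^-1 (1 + A) is (1 - A) (1 +
  A)^-1, and these factors commute because 1 - A and 1 + A do.\<close>

lemma orthogonal_cayB: "orthogonal_matrix (cayB b)"
proof -
  have 1: "cayB b = resB b ** (mat 1 + skewB b)"
    unfolding cayB_def cayley_def resB_def ..
  have "transpose (cayB b) = (mat 1 - skewB b) ** transpose (resB b)"
    unfolding 1 by (simp add: matrix_transpose_mul transpose_linear)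
  moreover have "(mat 1 - skewB b) ** transpose (resB b) = transpose (resB b) ** (mat 1 - skewB b)"
  proof -
    have "(mat 1 - skewB b) ** transpose (resB b) = transpose (resB b) ** ((mat 1 + skewB b) ** (mat 1 - skewB b)) ** transpose (resB b)"
      by (metis matrix_mul_assoc matrix_mul_lid transpose_resB(1))
    also have "\<dots> = transpose (resB b) ** ((mat 1 - skewB b) ** (mat 1 + skewB b)) ** transpose (resB b)"
      by (simp add: matrix_mult_bilinear)
    also have "\<dots> = transpose (resB b) ** (mat 1 - skewB b)"
      by (metis matrix_mul_assoc matrix_mul_rid transpose_resB(2))
    finally show ?thesis .
  qed
  ultimately have "transpose (cayB b) = transpose (resB b) ** (mat 1 - skewB b)" by simp
  then have "cayB b ** transpose (cayB b) = mat 1"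
    by (simp add: matrix_mul_assoc cayB_res resB_inv)
  then show ?thesis by (meson matrix_left_right_inverse orthogonal_matrix_def)
qed

lemma orthogonal_mult_cayB: "orthogonal_matrix M \<Longrightarrow> orthogonal_matrix (M ** cayB b)"
  by (simp add: orthogonal_cayB orthogonal_matrix_mul)

subsection \<open>Integration over the standard torus\<close>

lemma T0par_components [simp]:
  "T0par \<theta> \<phi> $ 1 = cos \<theta> / sqrt 2" "T0par \<theta> \<phi> $ 2 = sin \<theta> / sqrt 2"
  "T0par \<theta> \<phi> $ 3 = cos \<phi> / sqrt 2" "T0par \<theta> \<phi> $ 4 = sin \<phi> / sqrt 2"
  by (simp_all add: T0par_def vector_def)

lemma T0par_in_S3 [simp]: "T0par \<theta> \<phi> \<in> S3"
proof -
  have "T0par \<theta> \<phi> \<bullet> T0par \<theta> \<phi> = (cos \<theta> ^ 2 + sin \<theta> ^ 2) / 2 + (cos \<phi> ^ 2 + sin \<phi> ^ 2) / 2"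
    by (simp add: inner_vec_def sum_4 power2_eq_square add_divide_distrib del: sin_cos_squared_add sin_cos_squared_add2 sin_cos_squared_add3)
  also have "\<dots> = 1" by simp
  finally show ?thesis by (simp add: S3_def norm_eq_sqrt_inner)
qed

lemma compact_S3 [simp]: "compact S3" unfolding S3_def by simp

lemma S3_nonzero: "p \<in> S3 \<Longrightarrow> p \<noteq> 0" unfolding S3_def by auto

lemma T0par_alt: "T0par \<theta> \<phi> = (1 / sqrt 2) *\<^sub>R
   (cos \<theta> *\<^sub>R axis 1 1 + sin \<theta> *\<^sub>R axis 2 1 + cos \<phi> *\<^sub>R axis 3 1 + sin \<phi> *\<^sub>R axis 4 1)"
  unfolding vec_eq_iff forall_4 by (simp add: axis_def)

lemma continuous_on_T0par [continuous_intros]: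
  fixes f g :: "'a::t2_space \<Rightarrow> real"
  shows "continuous_on S f \<Longrightarrow> continuous_on S g \<Longrightarrow> continuous_on S (\<lambda>x. T0par (f x) (g x))"
  unfolding T0par_alt by (auto intro!: continuous_intros)

definition tor :: "(real^4 \<Rightarrow> real) \<Rightarrow> real" where
  "tor F = (1/2) * integral {0..2*pi} (\<lambda>\<theta>. integral {0..2*pi} (\<lambda>\<phi>. F (T0par \<theta> \<phi>)))"

abbreviation "angle_box \<equiv> cbox (0::real, 0::real) (2*pi, 2*pi)"

lemma continuous_on_angle_box:
  assumes "continuous_on S3 F"
  shows "continuous_on T (\<lambda>z. F (T0par (fst z) (snd z)))"
  by (rule continuous_on_compose2[OF assms]) (auto intro!: continuous_intros)

text \<open>One integral over a planar box in place of the iterated one gives access to linearity,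
  norm bounds and differentiation under the integral sign.\<close>

lemma tor_angle_box:
  assumes "continuous_on S3 F"
  shows "tor F = (1/2) * integral angle_box (\<lambda>z. F (T0par (fst z) (snd z)))"
  unfolding tor_def using integral_prod_continuous[OF continuous_on_angle_box[OF assms]] by simp

lemma integrable_angle_box:
  fixes F :: "real^4 \<Rightarrow> real"
  assumes "continuous_on S3 F"
  shows "(\<lambda>z. F (T0par (fst z) (snd z))) integrable_on angle_box"
  by (rule integrable_continuous) (rule continuous_on_angle_box[OF assms])

lemma tor_cong: "(\<And>p. p \<in> S3 \<Longrightarrow> F p = G p) \<Longrightarrow> tor F = tor G"
  unfolding tor_def by simp

lemma tor_add:
  assumes "continuous_on S3 F" "continuous_on S3 G"
  shows "tor (\<lambda>p. F p + G p) = tor F + tor G"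
  using assms integral_add[OF assms[THEN integrable_angle_box]]
  by (simp add: tor_angle_box continuous_on_add distrib_left)

lemma tor_cmult:
  assumes "continuous_on S3 F"
  shows "tor (\<lambda>p. c * F p) = c * tor F"
  using assms by (simp add: tor_angle_box continuous_on_mult)

text \<open>\<open>2 * pi^2\<close> is the area of a Clifford torus, half the area of the angle
  box.\<close>

lemma tor_bound:
  assumes "continuous_on S3 F" "\<And>p. p \<in> S3 \<Longrightarrow> \<bar>F p\<bar> \<le> B"
  shows "\<bar>tor F\<bar> \<le> 2 * pi^2 * B"
proof -
  have B: "B \<ge> 0" using assms(2)[OF T0par_in_S3[of 0 0]] by linarith
  have "norm (integral angle_box (\<lambda>z. F (T0par (fst z) (snd z)))) \<le> B * measure lborel angle_box"
    using has_integral_bound[OF B integrable_integral[OF integrable_angle_box[OF assms(1)]]] assms(2) by simp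
  also have "measure lborel angle_box = (2*pi) * (2*pi)" by (simp add: content_Pair)
  finally show ?thesis unfolding tor_angle_box[OF assms(1)] by (simp add: abs_mult power2_eq_square mult_ac)
qed

lemma continuous_on_slice:
  assumes "continuous_on (U \<times> S3) (\<lambda>(x, p). F x p)" "x \<in> U"
  shows "continuous_on S3 (F x)"
  by (rule continuous_on_compose2[OF assms(1), of _ "\<lambda>p. (x, p)", simplified])
     (use assms(2) in \<open>auto intro!: continuous_intros\<close>)

lemma continuous_on_param_angle_box:
  fixes F :: "'a::t2_space \<Rightarrow> real^4 \<Rightarrow> real"
  assumes "continuous_on (U \<times> S3) (\<lambda>(x, p). F x p)"
  shows "continuous_on (U \<times> T) (\<lambda>(x, z). F x (T0par (fst z) (snd z)))"
proof -
  have "continuous_on (U \<times> T) (\<lambda>y. (\<lambda>(x, p). F x p) (fst y, T0par (fst (snd y)) (snd (snd y))))"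
    by (rule continuous_on_compose2[OF assms]) (auto intro!: continuous_intros)
  then show ?thesis by (simp add: case_prod_beta)
qed

lemma continuous_on_tor:
  fixes F :: "'a::t2_space \<Rightarrow> real^4 \<Rightarrow> real"
  assumes "continuous_on (U \<times> S3) (\<lambda>(x, p). F x p)"
  shows "continuous_on U (\<lambda>x. tor (F x))"
proof -
  have "continuous_on U (\<lambda>x. (1/2) * integral angle_box (\<lambda>z. F x (T0par (fst z) (snd z))))"
    by (intro continuous_intros integral_continuous_on_param continuous_on_param_angle_box assms)
  then show ?thesis
    by (rule continuous_on_eq) (simp add: tor_angle_box continuous_on_slice[OF assms])
qed

lemma has_real_derivative_tor:
  fixes F :: "real \<Rightarrow> real^4 \<Rightarrow> real"
  assumes F: "\<And>t. t \<in> U \<Longrightarrow> continuous_on S3 (F t)"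
    and F': "continuous_on (U \<times> S3) (\<lambda>(t, p). F' t p)"
    and deriv: "\<And>t p. t \<in> U \<Longrightarrow> p \<in> S3 \<Longrightarrow> ((\<lambda>t. F t p) has_real_derivative F' t p) (at t within U)"
    and U: "convex U" "t \<in> U"
  shows "((\<lambda>t. tor (F t)) has_real_derivative tor (F' t)) (at t within U)"
proof -
  have "((\<lambda>t. integral angle_box (\<lambda>z. F t (T0par (fst z) (snd z)))) has_real_derivative
      integral angle_box (\<lambda>z. F' t (T0par (fst z) (snd z)))) (at t within U)"
    by (rule leibniz_rule_field_derivative)
      (use assms in \<open>auto intro!: integrable_angle_box continuous_on_param_angle_box\<close>)
  then have "((\<lambda>t. (1/2) * integral angle_box (\<lambda>z. F t (T0par (fst z) (snd z)))) has_real_derivative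
      tor (F' t)) (at t within U)"
    unfolding tor_angle_box[OF continuous_on_slice[OF F' U(2)]] by (rule DERIV_cmult)
  then show ?thesis
    by (rule has_field_derivative_transform_within[OF _ zero_less_one U(2)]) (simp add: tor_angle_box F)
qed

text \<open>For an antiderivative \<open>g\<close> the increment \<open>g (x + l) - g x\<close> has
  derivative zero by periodicity, so the integral over a full period does not depend on where it
  starts.\<close>

lemma integral_periodic_shift:
  fixes f :: "real \<Rightarrow> real"
  assumes cont: "continuous_on UNIV f" and per: "\<And>x. f (x + l) = f x" and l: "l \<ge> 0"
  shows "integral {0..l} (\<lambda>x. f (x + c)) = integral {0..l} f"
proof -
  \<comment> \<open>Large enough to contain \<open>{a..a+l}\<close> whenever
    \<open>\<bar>a\<bar> \<le> \<bar>c\<bar>\<close>; the extra 1 keeps these points in the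
    interior, where \<open>g\<close> is differentiable on both sides.\<close>
  define N where "N = \<bar>c\<bar> + l + 1"
  obtain g where g: "\<And>x. x \<in> {-N..N} \<Longrightarrow> (g has_vector_derivative f x) (at x within {-N..N})"
    using antiderivative_continuous[OF continuous_on_subset[OF cont, of "{-N..N}"]] by auto
  have g': "(g has_real_derivative f x) (at x)" if "x \<in> {-N<..<N}" for x
    using g[of x] that at_within_Icc_at[of "-N" x N]
    by (simp add: has_real_derivative_iff_has_vector_derivative)
  have int: "integral {a..a+l} f = g (a + l) - g a" if "\<bar>a\<bar> \<le> \<bar>c\<bar>" for a
  proof (rule integral_unique, rule fundamental_theorem_of_calculus)
    show "(g has_vector_derivative f x) (at x within {a..a+l})" if x: "x \<in> {a..a+l}" for x
      by (rule has_vector_derivative_within_subset[OF g]) (use x l \<open>\<bar>a\<bar> \<le> \<bar>c\<bar>\<close> in \<open>auto simp: N_def\<close>)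
  qed (use l in auto)
  have "\<exists>k. \<forall>x\<in>{-\<bar>c\<bar>..\<bar>c\<bar>}. g (x + l) - g x = k"
  proof (rule has_field_derivative_zero_constant)
    fix x assume x: "x \<in> {-\<bar>c\<bar>..\<bar>c\<bar>}"
    have "((\<lambda>x. g (x + l) - g x) has_real_derivative f (x + l) * 1 - f x) (at x)"
      by (rule DERIV_diff, rule DERIV_chain2[of g], rule g')
        (use x l in \<open>auto intro!: g' derivative_eq_intros simp: N_def\<close>)
    then show "((\<lambda>x. g (x + l) - g x) has_real_derivative 0) (at x within {-\<bar>c\<bar>..\<bar>c\<bar>})"
      using per by (simp add: has_field_derivative_at_within)
  qed simp
  then obtain k where k: "g (x + l) - g x = k" if "\<bar>x\<bar> \<le> \<bar>c\<bar>" for x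
    by (metis abs_le_iff atLeastAtMost_iff minus_le_iff)
  have "g (c + l) - g c = g (0 + l) - g 0" using k[of c] k[of 0] by simp
  then have "integral {c..c+l} f = integral {0..l} f" using int[of c] int[of 0] by simp
  moreover have "integral {0..l} (f \<circ> (\<lambda>x. x + c)) = integral {0+c..l+c} f"
    by (rule integral_shift) (rule continuous_on_subset[OF cont], simp)
  ultimately show ?thesis by (simp add: o_def add.commute)
qed

text \<open>The identity component of the stabiliser of the standard torus; it acts on the torus by
  translating the two angles.\<close>

definition rot :: "real \<Rightarrow> real \<Rightarrow> real^4^4" where
  "rot a c = (\<chi> i j.
     if i = 1 \<and> j = 1 then cos a else if i = 1 \<and> j = 2 then - sin a
     else if i = 2 \<and> j = 1 then sin a else if i = 2 \<and> j = 2 then cos a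
     else if i = 3 \<and> j = 3 then cos c else if i = 3 \<and> j = 4 then - sin c
     else if i = 4 \<and> j = 3 then sin c else if i = 4 \<and> j = 4 then cos c else 0)"

lemma rot_T0par: "rot a c *v T0par \<theta> \<phi> = T0par (\<theta> + a) (\<phi> + c)"
  unfolding vec_eq_iff forall_4
  by (simp add: matrix_vector_mult_def sum_4 rot_def cos_add sin_add field_simps)

lemma tor_rot:
  assumes "continuous_on S3 F"
  shows "tor (\<lambda>p. F (rot a c *v p)) = tor F"
proof -
  have per: "T0par (\<theta> + 2*pi) \<phi> = T0par \<theta> \<phi>" "T0par \<theta> (\<phi> + 2*pi) = T0par \<theta> \<phi>" for \<theta> \<phi>
    by (simp_all add: T0par_alt)
  have "integral {0..2*pi} (\<lambda>\<phi>. F (T0par \<theta> (\<phi> + c))) = integral {0..2*pi} (\<lambda>\<phi>. F (T0par \<theta> \<phi>))" for \<theta>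
    by (rule integral_periodic_shift)
       (auto simp: per intro!: continuous_intros continuous_on_compose2[OF assms])
  moreover have "integral {0..2*pi} (\<lambda>\<theta>. integral {0..2*pi} (\<lambda>\<phi>. F (T0par (\<theta> + a) \<phi>))) =
      integral {0..2*pi} (\<lambda>\<theta>. integral {0..2*pi} (\<lambda>\<phi>. F (T0par \<theta> \<phi>)))"
  proof (rule integral_periodic_shift)
    have "continuous_on UNIV (\<lambda>\<theta>. integral (cbox 0 (2*pi)) (\<lambda>\<phi>. F (T0par \<theta> \<phi>)))"
      by (rule integral_continuous_on_param)
         (auto simp: case_prod_beta intro!: continuous_intros continuous_on_compose2[OF assms])
    then show "continuous_on UNIV (\<lambda>\<theta>. integral {0..2*pi} (\<lambda>\<phi>. F (T0par \<theta> \<phi>)))" by simp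
  qed (simp_all add: per)
  ultimately show ?thesis unfolding tor_def rot_T0par by simp
qed

lemma orthogonal_rot: "orthogonal_matrix (rot a c)"
proof -
  have "transpose (rot a c) ** rot a c = mat 1"
    unfolding vec_eq_iff forall_4
    by (simp add: matrix_matrix_mult_def transpose_def sum_4 rot_def mat_def
        power2_eq_square[symmetric])
  then show ?thesis by (simp add: orthogonal_matrix)
qed

subsection \<open>Smooth functions given by partial derivatives\<close>

abbreviation "ax i \<equiv> (axis i 1 :: real^4)"

lemma pd_eqI:
  "((\<lambda>t. f (x + t *\<^sub>R ax i)) has_real_derivative D) (at 0) \<Longrightarrow> pd i f x = D"
  unfolding pd_def by (rule DERIV_imp_deriv)

lemma eventually_line:
  fixes x v :: "'a::real_normed_vector"
  assumes "open U" "x \<in> U"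
  shows "eventually (\<lambda>t::real. x + t *\<^sub>R v \<in> U) (nhds 0)"
proof -
  have "continuous_on UNIV (\<lambda>t::real. x + t *\<^sub>R v)" by (intro continuous_intros)
  then have "open ((\<lambda>t::real. x + t *\<^sub>R v) -` U)" using assms(1) by (simp add: open_vimage)
  then show ?thesis
    unfolding eventually_nhds using assms(2) by (intro exI[of _ "(\<lambda>t::real. x + t *\<^sub>R v) -` U"]) auto
qed

lemma line_derivative_cong:
  fixes x v :: "'a::real_normed_vector"
  assumes "open U" "x \<in> U" "\<And>y. y \<in> U \<Longrightarrow> f y = g y"
  shows "((\<lambda>t. f (x + t *\<^sub>R v)) has_real_derivative D) (at 0) \<longleftrightarrow>
    ((\<lambda>t. g (x + t *\<^sub>R v)) has_real_derivative D) (at 0)"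
  using eventually_line[OF assms(1,2), of v]
  by (intro DERIV_cong_ev refl) (auto elim!: eventually_mono intro: assms(3))

lemma pd_cong:
  assumes "open U" "x \<in> U" "\<And>y. y \<in> U \<Longrightarrow> f y = g y"
  shows "pd i f x = pd i g x"
proof -
  have "((\<lambda>t. f (x + t *\<^sub>R ax i)) has_real_derivative D) (at 0) \<longleftrightarrow>
    ((\<lambda>t. g (x + t *\<^sub>R ax i)) has_real_derivative D) (at 0)" for D
    by (rule line_derivative_cong[OF assms])
  then show ?thesis by (simp add: pd_def deriv_def)
qed

lemma pds_Nil [simp]: "pds [] f = f" and pds_Cons [simp]: "pds (i # is) f = pd i (pds is f)"
  and pds_snoc: "pds (is @ [i]) f = pds is (pd i f)"
  by (simp_all add: pds_def)

lemma smooth_on_pd: "smooth_on U f \<Longrightarrow> smooth_on U (pd i f)"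
  unfolding smooth_on_def by (metis pds_snoc)

lemma smooth_on_pds: "smooth_on U f \<Longrightarrow> smooth_on U (pds is f)"
  by (induction "is") (auto intro: smooth_on_pd)

lemma smooth_on_continuous: "smooth_on U f \<Longrightarrow> continuous_on U f"
  unfolding smooth_on_def by (metis pds_Nil)

lemma smooth_on_line_derivative:
  assumes "smooth_on U f" "x \<in> U"
  shows "((\<lambda>t. f (x + t *\<^sub>R ax i)) has_real_derivative pd i f x) (at 0)"
proof -
  have "(\<lambda>t. f (x + t *\<^sub>R ax i)) differentiable (at 0)"
    using assms unfolding smooth_on_def by (metis pds_Nil)
  then show ?thesis
    unfolding pd_def using DERIV_deriv_iff_real_differentiable by blast
qed

lemma line_derivative_shift:
  fixes x v :: "'a::real_normed_vector"
  assumes "((\<lambda>t. f (x + s *\<^sub>R v + t *\<^sub>R v)) has_real_derivative D) (at 0)"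
  shows "((\<lambda>t. f (x + t *\<^sub>R v)) has_real_derivative D) (at s)"
proof -
  have "((\<lambda>t. f (x + (t + s) *\<^sub>R v)) has_real_derivative D) (at 0)"
    using assms by (simp add: scaleR_add_left add_ac)
  then show ?thesis using DERIV_shift[of "\<lambda>t. f (x + t *\<^sub>R v)" D 0 s] by simp
qed

lemma smooth_on_line_derivative_at:
  assumes "smooth_on U f" "x + s *\<^sub>R ax i \<in> U"
  shows "((\<lambda>t. f (x + t *\<^sub>R ax i)) has_real_derivative pd i f (x + s *\<^sub>R ax i)) (at s)"
  by (rule line_derivative_shift) (rule smooth_on_line_derivative[OF assms])

text \<open>Coordinates are released one at a time, and each new one contributes through the mean
  value theorem and the continuity of its partial derivative. The family \<open>D\<close> is left
  general because the lemma is also applied to the gradient of the torus integral, whose partial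
  derivatives are known in terms of \<open>hess\<close>.\<close>

lemma has_derivative_of_partials:
  fixes f :: "real^4 \<Rightarrow> real"
  assumes U: "open U" "x \<in> U"
    and der: "\<And>y i. y \<in> U \<Longrightarrow> ((\<lambda>t. f (y + t *\<^sub>R ax i)) has_real_derivative D i y) (at 0)"
    and cont: "\<And>i. continuous_on U (D i)"
  shows "(f has_derivative (\<lambda>h. \<Sum>i\<in>UNIV. D i x * h $ i)) (at x)"
proof -
  define pr :: "4 set \<Rightarrow> real^4 \<Rightarrow> real^4" where "pr I h = (\<chi> i. if i \<in> I then h $ i else 0)" for I h
  have pr0 [simp]: "pr I 0 = 0" for I by (simp add: pr_def vec_eq_iff)
  have pr_norm: "norm (pr I h) \<le> norm h" for I h
    by (rule norm_le_componentwise_cart) (simp add: pr_def)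
  have "((\<lambda>h. f (x + pr I h)) has_derivative (\<lambda>h. \<Sum>i\<in>I. D i x * h $ i)) (at 0)" for I
    using finite[of I]
  proof (induction I rule: finite_induct)
    case empty
    have "pr {} h = 0" for h by (simp add: pr_def vec_eq_iff)
    then show ?case by simp
  next
    case (insert j I)
    have ins: "pr (insert j I) h = pr I h + (h $ j) *\<^sub>R ax j" for h
      using insert.hyps by (auto simp: pr_def vec_eq_iff axis_def)
    \<comment> \<open>Only coordinate \<open>j\<close> moves in this difference, so it is the
      increment of a function of one variable along a segment.\<close>
    have "((\<lambda>h. f (x + pr I h + (h $ j) *\<^sub>R ax j) - f (x + pr I h)) has_derivative (\<lambda>h. D j x * h $ j)) (at 0)"
      unfolding has_derivative_at_alt
    proof (intro conjI allI impI)
      show "bounded_linear (\<lambda>h. D j x * h $ j)"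
        by (intro bounded_linear_const_mult bounded_linear_vec_nth)
      fix e :: real assume e: "e > 0"
      obtain d1 where d1: "d1 > 0" "\<And>y. dist y x < d1 \<Longrightarrow> y \<in> U" using U open_dist by metis
      obtain d2 where d2: "d2 > 0" "\<And>y. y \<in> U \<Longrightarrow> dist y x < d2 \<Longrightarrow> dist (D j y) (D j x) < e"
        using cont[of j] U(2) e unfolding continuous_on_iff by metis
      show "\<exists>d>0. \<forall>h. norm (h - 0) < d \<longrightarrow>
           norm (f (x + pr I h + h $ j *\<^sub>R ax j) - f (x + pr I h)
             - (f (x + pr I 0 + (0::real^4) $ j *\<^sub>R ax j) - f (x + pr I 0)) - D j x * (h - 0) $ j) \<le> e * norm (h - 0)"
      \<comment> \<open>Halved because points of the segment may lie as far as
        \<open>2 * norm h\<close> from \<open>x\<close>.\<close>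
      proof (intro exI[of _ "min d1 d2 / 2"] conjI allI impI)
        show "0 < min d1 d2 / 2" using d1 d2 by simp
        fix h :: "real^4" assume h: "norm (h - 0) < min d1 d2 / 2"
        have near: "dist (x + pr I h + r *\<^sub>R ((h $ j) *\<^sub>R ax j)) x < min d1 d2" if "0 \<le> r" "r \<le> 1" for r
        proof -
          have "norm (pr I h + r *\<^sub>R ((h $ j) *\<^sub>R ax j)) \<le> norm (pr I h) + \<bar>r\<bar> * \<bar>h $ j\<bar>"
            by (rule order_trans[OF norm_triangle_ineq]) (simp add: norm_axis_1 abs_mult)
          also have "\<dots> \<le> norm h + 1 * norm h"
            by (intro add_mono mult_mono pr_norm component_le_norm_cart) (use that in auto)
          finally show ?thesis using h by (simp add: dist_norm add.assoc)
        qed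
        define \<phi> where "\<phi> r = f (x + pr I h + r *\<^sub>R ((h $ j) *\<^sub>R ax j))" for r
        have \<phi>': "(\<phi> has_real_derivative D j (x + pr I h + r *\<^sub>R ((h $ j) *\<^sub>R ax j)) * h $ j) (at r)"
          if "0 \<le> r" "r \<le> 1" for r
        proof -
          have "((\<lambda>t. f (x + pr I h + t *\<^sub>R ax j)) has_real_derivative D j (x + pr I h + (r * h $ j) *\<^sub>R ax j)) (at (r * h $ j))"
            by (rule line_derivative_shift, rule der, rule d1) (use near[OF that] in simp)
          then have "((\<lambda>r. f (x + pr I h + (r * h $ j) *\<^sub>R ax j)) has_real_derivative D j (x + pr I h + (r * h $ j) *\<^sub>R ax j) * (h $ j)) (at r)"
            by (rule DERIV_chain2) (auto intro!: derivative_eq_intros)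
          then show ?thesis unfolding \<phi>_def by simp
        qed
        obtain z where z: "0 < z" "z < 1" "\<phi> 1 - \<phi> 0 = (1 - 0) * (D j (x + pr I h + z *\<^sub>R ((h $ j) *\<^sub>R ax j)) * h $ j)"
          using MVT2[of 0 1 \<phi> "\<lambda>r. D j (x + pr I h + r *\<^sub>R ((h $ j) *\<^sub>R ax j)) * h $ j"] \<phi>' by auto
        have "dist (D j (x + pr I h + z *\<^sub>R ((h $ j) *\<^sub>R ax j))) (D j x) < e"
          using near[of z] z d1(2) d2(2) by simp
        then have "\<bar>(D j (x + pr I h + z *\<^sub>R ((h $ j) *\<^sub>R ax j)) - D j x) * h $ j\<bar> \<le> e * norm h"
          unfolding abs_mult by (intro mult_mono component_le_norm_cart) (auto simp: dist_real_def)
        moreover have "\<phi> 1 - \<phi> 0 - D j x * h $ j = (D j (x + pr I h + z *\<^sub>R ((h $ j) *\<^sub>R ax j)) - D j x) * h $ j"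
          unfolding z by (simp add: algebra_simps)
        ultimately show "norm (f (x + pr I h + h $ j *\<^sub>R ax j) - f (x + pr I h)
             - (f (x + pr I 0 + (0::real^4) $ j *\<^sub>R ax j) - f (x + pr I 0)) - D j x * (h - 0) $ j) \<le> e * norm (h - 0)"
          by (simp add: \<phi>_def)
      qed
    qed
    from has_derivative_add[OF insert.IH this] show ?case
      using insert.hyps by (simp add: ins add.assoc add.commute)
  qed
  from this[of UNIV] have "((\<lambda>h. f (x + h)) has_derivative (\<lambda>h. \<Sum>i\<in>UNIV. D i x * h $ i)) (at 0)"
    by (simp add: pr_def)
  then have "((\<lambda>h. f (x + h)) has_derivative (\<lambda>h. \<Sum>i\<in>UNIV. D i x * h $ i)) (at (x - x))" by simp
  moreover have "((\<lambda>y. y - x) has_derivative (\<lambda>h. h)) (at x)"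
    by (auto intro!: derivative_eq_intros)
  ultimately show ?thesis
    using has_derivative_compose[of "\<lambda>y. y - x" "\<lambda>h. h" x UNIV "\<lambda>h. f (x + h)"] by simp
qed

lemma smooth_on_has_derivative:
  assumes "open U" "smooth_on U f" "x \<in> U"
  shows "(f has_derivative (\<lambda>h. \<Sum>i\<in>UNIV. pd i f x * h $ i)) (at x)"
  using assms(1,3)
proof (rule has_derivative_of_partials)
  show "((\<lambda>t. f (y + t *\<^sub>R ax i)) has_real_derivative pd i f y) (at 0)" if "y \<in> U" for y i
    using smooth_on_line_derivative[OF assms(2) that] .
  show "continuous_on U (pd i f)" for i
    by (rule smooth_on_continuous[OF smooth_on_pd[OF assms(2)]])
qed

text \<open>The mean value theorem in direction \<open>i\<close> and then in direction
  \<open>j\<close> turns the quotient into a value of \<open>pd j (pd i f)\<close> at a nearby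
  point, and continuity finishes.\<close>

lemma second_difference:
  assumes U: "open U" "x \<in> U" and f: "smooth_on U f" and e: "e > 0"
  shows "\<exists>d>0. \<forall>t. 0 < t \<longrightarrow> t < d \<longrightarrow>
    \<bar>(f (x + t *\<^sub>R ax i + t *\<^sub>R ax j) - f (x + t *\<^sub>R ax i) - f (x + t *\<^sub>R ax j) + f x) / t^2 - pd j (pd i f) x\<bar> < e"
proof -
  obtain d1 where d1: "d1 > 0" "\<And>y. dist y x < d1 \<Longrightarrow> y \<in> U" using U open_dist by metis
  have "continuous_on U (pd j (pd i f))" by (intro smooth_on_continuous smooth_on_pd f)
  then obtain d2 where d2: "d2 > 0" "\<And>y. y \<in> U \<Longrightarrow> dist y x < d2 \<Longrightarrow> dist (pd j (pd i f) y) (pd j (pd i f) x) < e"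
    using U(2) e unfolding continuous_on_iff by metis
  show ?thesis
  proof (intro exI[of _ "min d1 d2 / 2"] conjI allI impI)
    show "0 < min d1 d2 / 2" using d1 d2 by simp
    fix t assume t: "0 < t" "t < min d1 d2 / 2"
    have near: "dist (x + a *\<^sub>R ax i + b *\<^sub>R ax j) x < min d1 d2" if "0 \<le> a" "a \<le> t" "0 \<le> b" "b \<le> t" for a b
    proof -
      have "norm (a *\<^sub>R ax i + b *\<^sub>R ax j) \<le> a + b"
        by (rule order_trans[OF norm_triangle_ineq]) (use that in \<open>simp add: norm_axis_1\<close>)
      then show ?thesis using that t by (simp add: dist_norm add.assoc)
    qed
    define \<phi> where "\<phi> a = f (x + a *\<^sub>R ax i + t *\<^sub>R ax j) - f (x + a *\<^sub>R ax i)" for a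
    have "(\<phi> has_real_derivative pd i f (x + t *\<^sub>R ax j + a *\<^sub>R ax i) - pd i f (x + a *\<^sub>R ax i)) (at a)" if "0 \<le> a" "a \<le> t" for a
    proof -
      have 1: "x + t *\<^sub>R ax j + a *\<^sub>R ax i \<in> U" "x + a *\<^sub>R ax i \<in> U"
        using near[of a t] near[of a 0] that t by (auto intro!: d1(2) simp: add_ac)
      show ?thesis
        using DERIV_diff[OF smooth_on_line_derivative_at[OF f 1(1)] smooth_on_line_derivative_at[OF f 1(2)]]
        unfolding \<phi>_def by (simp add: add_ac)
    qed
    then obtain a where a: "0 < a" "a < t" "\<phi> t - \<phi> 0 = (t - 0) * (pd i f (x + t *\<^sub>R ax j + a *\<^sub>R ax i) - pd i f (x + a *\<^sub>R ax i))"
      using MVT2[of 0 t \<phi> "\<lambda>a. pd i f (x + t *\<^sub>R ax j + a *\<^sub>R ax i) - pd i f (x + a *\<^sub>R ax i)"] t by auto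
    define \<psi> where "\<psi> b = pd i f (x + a *\<^sub>R ax i + b *\<^sub>R ax j)" for b
    have "(\<psi> has_real_derivative pd j (pd i f) (x + a *\<^sub>R ax i + b *\<^sub>R ax j)) (at b)" if "0 \<le> b" "b \<le> t" for b
      unfolding \<psi>_def
      by (rule smooth_on_line_derivative_at[OF smooth_on_pd[OF f]]) (use near[of a b] a that in \<open>auto intro!: d1(2)\<close>)
    then obtain b where b: "0 < b" "b < t" "\<psi> t - \<psi> 0 = (t - 0) * pd j (pd i f) (x + a *\<^sub>R ax i + b *\<^sub>R ax j)"
      using MVT2[of 0 t \<psi> "\<lambda>b. pd j (pd i f) (x + a *\<^sub>R ax i + b *\<^sub>R ax j)"] t by auto
    have "f (x + t *\<^sub>R ax i + t *\<^sub>R ax j) - f (x + t *\<^sub>R ax i) - f (x + t *\<^sub>R ax j) + f x = \<phi> t - \<phi> 0"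
      by (simp add: \<phi>_def)
    also have "\<dots> = t * (\<psi> t - \<psi> 0)" unfolding a(3) by (simp add: \<psi>_def add_ac)
    also have "\<dots> = t^2 * pd j (pd i f) (x + a *\<^sub>R ax i + b *\<^sub>R ax j)" unfolding b(3) by (simp add: power2_eq_square)
    finally have eq: "(f (x + t *\<^sub>R ax i + t *\<^sub>R ax j) - f (x + t *\<^sub>R ax i) - f (x + t *\<^sub>R ax j) + f x) / t^2 = pd j (pd i f) (x + a *\<^sub>R ax i + b *\<^sub>R ax j)"
      using t by simp
    have "dist (pd j (pd i f) (x + a *\<^sub>R ax i + b *\<^sub>R ax j)) (pd j (pd i f) x) < e"
      using near[of a b] a b by (intro d2 d1) auto
    then show "\<bar>(f (x + t *\<^sub>R ax i + t *\<^sub>R ax j) - f (x + t *\<^sub>R ax i) - f (x + t *\<^sub>R ax j) + f x) / t^2 - pd j (pd i f) x\<bar> < e"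
      unfolding eq by (simp add: dist_real_def)
  qed
qed

text \<open>The second difference is symmetric in \<open>i\<close> and \<open>j\<close>, while
  \<open>second_difference\<close> assigns it a limit for either order of differentiation.\<close>

lemma pd_commute:
  assumes U: "open U" "x \<in> U" and f: "smooth_on U f"
  shows "pd i (pd j f) x = pd j (pd i f) x"
proof (rule ccontr)
  assume ne: "\<not> ?thesis"
  define e where "e = \<bar>pd i (pd j f) x - pd j (pd i f) x\<bar> / 2"
  have e: "e > 0" using ne by (simp add: e_def)
  from second_difference[OF U f e, of i j] second_difference[OF U f e, of j i]
  obtain d1 d2 where d: "d1 > 0" "d2 > 0"
    "\<And>t. 0 < t \<Longrightarrow> t < d1 \<Longrightarrow> \<bar>(f (x + t *\<^sub>R ax i + t *\<^sub>R ax j) - f (x + t *\<^sub>R ax i) - f (x + t *\<^sub>R ax j) + f x) / t^2 - pd j (pd i f) x\<bar> < e"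
    "\<And>t. 0 < t \<Longrightarrow> t < d2 \<Longrightarrow> \<bar>(f (x + t *\<^sub>R ax j + t *\<^sub>R ax i) - f (x + t *\<^sub>R ax j) - f (x + t *\<^sub>R ax i) + f x) / t^2 - pd i (pd j f) x\<bar> < e"
    by auto
  define t where "t = min d1 d2 / 2"
  have t: "0 < t" "t < d1" "t < d2" using d by (auto simp: t_def)
  define q where "q = (f (x + t *\<^sub>R ax i + t *\<^sub>R ax j) - f (x + t *\<^sub>R ax i) - f (x + t *\<^sub>R ax j) + f x) / t^2"
  have "x + t *\<^sub>R ax j + t *\<^sub>R ax i = x + t *\<^sub>R ax i + t *\<^sub>R ax j" by simp
  then have "(f (x + t *\<^sub>R ax j + t *\<^sub>R ax i) - f (x + t *\<^sub>R ax j) - f (x + t *\<^sub>R ax i) + f x) / t^2 = q"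
    unfolding q_def by (simp add: algebra_simps)
  then have "\<bar>q - pd j (pd i f) x\<bar> < e" "\<bar>q - pd i (pd j f) x\<bar> < e"
    using d(3)[OF t(1,2)] d(4)[OF t(1,3)] by (simp_all only: q_def)
  moreover have "\<bar>A - B\<bar> \<le> \<bar>q - B\<bar> + \<bar>q - A\<bar>" for A B :: real by arith
  ultimately show False unfolding e_def by (smt (verit) field_sum_of_halves)
qed

lemma pds_lincomb:
  assumes U: "open U" "smooth_on U f" "smooth_on U g" "x \<in> U"
  shows "pds is (\<lambda>x. a * f x + b * g x) x = a * pds is f x + b * pds is g x"
  using U(4)
proof (induction "is" arbitrary: x)
  case (Cons i "is")
  have "((\<lambda>t. a * pds is f (x + t *\<^sub>R ax i) + b * pds is g (x + t *\<^sub>R ax i)) has_real_derivative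
     a * pd i (pds is f) x + b * pd i (pds is g) x) (at 0)"
    by (intro DERIV_add DERIV_cmult smooth_on_line_derivative[OF smooth_on_pds[OF U(2)] Cons.prems]
        smooth_on_line_derivative[OF smooth_on_pds[OF U(3)] Cons.prems])
  then have "((\<lambda>t. pds is (\<lambda>x. a * f x + b * g x) (x + t *\<^sub>R ax i)) has_real_derivative
     a * pd i (pds is f) x + b * pd i (pds is g) x) (at 0)"
    using line_derivative_cong[of U x "pds is (\<lambda>x. a * f x + b * g x)" "\<lambda>x. a * pds is f x + b * pds is g x",
        OF U(1) Cons.prems Cons.IH] by blast
  then show ?case by (simp add: pd_eqI)
qed simp

lemma smooth_on_lincomb:
  assumes U: "open U" "smooth_on U f" "smooth_on U g"
  shows "smooth_on U (\<lambda>x. a * f x + b * g x)"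
  unfolding smooth_on_def
proof (intro allI conjI ballI)
  fix "is"
  have "continuous_on U (\<lambda>x. a * pds is f x + b * pds is g x)"
    by (intro continuous_intros smooth_on_continuous smooth_on_pds U)
  then show "continuous_on U (pds is (\<lambda>x. a * f x + b * g x))"
    by (rule continuous_on_eq) (simp add: pds_lincomb[OF U])
  fix x i assume x: "x \<in> U"
  have "((\<lambda>t. a * pds is f (x + t *\<^sub>R ax i) + b * pds is g (x + t *\<^sub>R ax i)) has_real_derivative
     a * pd i (pds is f) x + b * pd i (pds is g) x) (at 0)"
    by (intro DERIV_add DERIV_cmult smooth_on_line_derivative[OF smooth_on_pds[OF U(2)] x]
        smooth_on_line_derivative[OF smooth_on_pds[OF U(3)] x])
  then have "((\<lambda>t. pds is (\<lambda>x. a * f x + b * g x) (x + t *\<^sub>R ax i)) has_real_derivative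
     a * pd i (pds is f) x + b * pd i (pds is g) x) (at 0)"
    using line_derivative_cong[of U x "pds is (\<lambda>x. a * f x + b * g x)" "\<lambda>x. a * pds is f x + b * pds is g x",
        OF U(1) x pds_lincomb[OF U]] by blast
  then show "(\<lambda>t. pds is (\<lambda>x. a * f x + b * g x) (x + t *\<^sub>R ax i)) differentiable (at 0)"
    using real_differentiable_def by blast
qed

text \<open>\<open>smooth_on\<close> speaks of all iterated partial derivatives at once, so
  smoothness of concrete functions is obtained from a class closed under them. The only denominator,
  \<open>x \<bullet> x\<close>, vanishes just at the excluded point 0.\<close>

inductive_set rational_fns :: "(real^4 \<Rightarrow> real) set" where
  rational_const: "(\<lambda>x. c) \<in> rational_fns"
| rational_linear: "(\<lambda>x. v \<bullet> x) \<in> rational_fns"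
| rational_inverse: "(\<lambda>x. inverse (x \<bullet> x)) \<in> rational_fns"
| rational_add: "f \<in> rational_fns \<Longrightarrow> g \<in> rational_fns \<Longrightarrow> (\<lambda>x. f x + g x) \<in> rational_fns"
| rational_mult: "f \<in> rational_fns \<Longrightarrow> g \<in> rational_fns \<Longrightarrow> (\<lambda>x. f x * g x) \<in> rational_fns"

lemma rational_fns_continuous: "f \<in> rational_fns \<Longrightarrow> continuous_on (-{0}) f"
  by (induction rule: rational_fns.induct) (auto intro!: continuous_intros)

lemma rational_fns_derivative:
  "f \<in> rational_fns \<Longrightarrow> \<exists>g\<in>rational_fns. \<forall>x\<in>-{0}. ((\<lambda>t. f (x + t *\<^sub>R ax i)) has_real_derivative g x) (at 0)"
proof (induction rule: rational_fns.induct)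
  case (rational_const c)
  then show ?case by (intro bexI[of _ "\<lambda>x. 0"]) (auto intro: rational_fns.intros)
next
  case (rational_linear v)
  show ?case
  proof (rule bexI[of _ "\<lambda>x. v \<bullet> ax i"])
    show "\<forall>x\<in>-{0}. ((\<lambda>t. v \<bullet> (x + t *\<^sub>R ax i)) has_real_derivative v \<bullet> ax i) (at 0)"
      unfolding inner_add_right inner_scaleR_right by (auto intro!: derivative_eq_intros)
  qed (rule rational_fns.intros)
next
  case rational_inverse
  let ?g = "\<lambda>x. ((-2) * (ax i \<bullet> x)) * (inverse (x \<bullet> x) * inverse (x \<bullet> x))"
  show ?case
  proof (rule bexI[of _ ?g], rule ballI)
    fix x :: "real^4" assume "x \<in> -{0}"
    then have x: "x \<bullet> x \<noteq> 0" by simp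
    have eq: "(x + t *\<^sub>R ax i) \<bullet> (x + t *\<^sub>R ax i) = x \<bullet> x + t * (2 * (ax i \<bullet> x)) + t^2 * (ax i \<bullet> ax i)" for t
      by (simp add: inner_add_left inner_add_right inner_commute power2_eq_square algebra_simps)
    have "((\<lambda>t. inverse (x \<bullet> x + t * (2 * (ax i \<bullet> x)) + t^2 * (ax i \<bullet> ax i))) has_real_derivative ?g x) (at 0)"
      by (rule derivative_eq_intros refl | (use x in \<open>simp; fail\<close>))+
    then show "((\<lambda>t. inverse ((x + t *\<^sub>R ax i) \<bullet> (x + t *\<^sub>R ax i))) has_real_derivative ?g x) (at 0)"
      unfolding eq .
  qed (intro rational_fns.intros)
next
  case (rational_add f g)
  then obtain f' g' where "f' \<in> rational_fns" "g' \<in> rational_fns"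
    "\<And>x. x \<in> -{0} \<Longrightarrow> ((\<lambda>t. f (x + t *\<^sub>R ax i)) has_real_derivative f' x) (at 0)"
    "\<And>x. x \<in> -{0} \<Longrightarrow> ((\<lambda>t. g (x + t *\<^sub>R ax i)) has_real_derivative g' x) (at 0)" by blast
  then show ?case
    by (intro bexI[of _ "\<lambda>x. f' x + g' x"] ballI DERIV_add rational_fns.intros)
next
  case (rational_mult f g)
  then obtain f' g' where *: "f' \<in> rational_fns" "g' \<in> rational_fns"
    "\<And>x. x \<in> -{0} \<Longrightarrow> ((\<lambda>t. f (x + t *\<^sub>R ax i)) has_real_derivative f' x) (at 0)"
    "\<And>x. x \<in> -{0} \<Longrightarrow> ((\<lambda>t. g (x + t *\<^sub>R ax i)) has_real_derivative g' x) (at 0)" by blast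
  show ?case
  proof (intro bexI[of _ "\<lambda>x. f' x * g x + g' x * f x"] ballI)
    fix x :: "real^4" assume "x \<in> -{0}"
    from DERIV_mult[OF *(3,4)[OF this]]
    show "((\<lambda>t. f (x + t *\<^sub>R ax i) * g (x + t *\<^sub>R ax i)) has_real_derivative f' x * g x + g' x * f x) (at 0)" by simp
  qed (use * rational_mult in \<open>auto intro: rational_fns.intros\<close>)
qed

lemma rational_fns_pds:
  assumes "f \<in> rational_fns"
  shows "\<exists>g\<in>rational_fns. \<forall>x\<in>-{0}. pds is f x = g x"
proof (induction "is")
  case Nil
  then show ?case using assms by auto
next
  case (Cons i "is")
  then obtain g where g: "g \<in> rational_fns" "\<And>x. x \<in> -{0} \<Longrightarrow> pds is f x = g x" by blast
  obtain h where h: "h \<in> rational_fns" "\<And>x. x \<in> -{0} \<Longrightarrow> ((\<lambda>t. g (x + t *\<^sub>R ax i)) has_real_derivative h x) (at 0)"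
    using rational_fns_derivative[OF g(1)] by blast
  have "pds (i # is) f x = h x" if "x \<in> -{0}" for x
    using pd_cong[OF _ that, of "pds is f" g i] g(2) pd_eqI[OF h(2)[OF that]] by (simp add: open_Compl)
  then show ?case using h(1) by blast
qed

lemma rational_fns_smooth:
  assumes "f \<in> rational_fns"
  shows "smooth_on (-{0}) f"
  unfolding smooth_on_def
proof (intro allI conjI ballI)
  fix "is"
  obtain g where g: "g \<in> rational_fns" "\<And>x. x \<in> -{0} \<Longrightarrow> pds is f x = g x"
    using rational_fns_pds[OF assms] by blast
  show "continuous_on (-{0}) (pds is f)"
    by (rule continuous_on_eq[OF rational_fns_continuous[OF g(1)]]) (simp add: g)
  fix x :: "real^4" and i assume x: "x \<in> -{0}"
  obtain h where "((\<lambda>t. g (x + t *\<^sub>R ax i)) has_real_derivative h x) (at 0)"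
    using rational_fns_derivative[OF g(1)] x by blast
  then have "((\<lambda>t. pds is f (x + t *\<^sub>R ax i)) has_real_derivative h x) (at 0)"
    using line_derivative_cong[of "-{0}" x "pds is f" g, OF _ x g(2)] by (simp add: open_Compl)
  then show "(\<lambda>t. pds is f (x + t *\<^sub>R ax i)) differentiable (at 0)"
    using real_differentiable_def by blast
qed

subsection \<open>First and second variations of the torus integral\<close>

abbreviation "smooth w \<equiv> smooth_on (-{0}) w"

lemma open_punctured [simp]: "open (-{0::real^4})" by (simp add: open_Compl)

definition dw :: "(real^4 \<Rightarrow> real) \<Rightarrow> real^4 \<Rightarrow> real^4 \<Rightarrow> real" where
  "dw w x h = (\<Sum>i\<in>UNIV. pd i w x * h $ i)"

definition ddw :: "(real^4 \<Rightarrow> real) \<Rightarrow> real^4 \<Rightarrow> real^4 \<Rightarrow> real^4 \<Rightarrow> real" where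
  "ddw w x h k = (\<Sum>i\<in>UNIV. dw (pd i w) x h * k $ i)"

text \<open>The torus integral and its variations as functions of the matrix. They are studied at
  invertible matrices and in arbitrary matrix directions, since a straight line such as
  \<open>M ** (mat 1 + t *\<^sub>R Z)\<close> leaves the orthogonal group.\<close>

definition I0 :: "(real^4 \<Rightarrow> real) \<Rightarrow> real^4^4 \<Rightarrow> real" where
  "I0 w M = tor (\<lambda>p. w (M *v p))"

definition I1 :: "(real^4 \<Rightarrow> real) \<Rightarrow> real^4^4 \<Rightarrow> real^4^4 \<Rightarrow> real" where
  "I1 w M N = tor (\<lambda>p. dw w (M *v p) (N *v p))"

definition I2 :: "(real^4 \<Rightarrow> real) \<Rightarrow> real^4^4 \<Rightarrow> real^4^4 \<Rightarrow> real^4^4 \<Rightarrow> real" where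
  "I2 w M N L = tor (\<lambda>p. ddw w (M *v p) (N *v p) (L *v p))"

lemma smooth_has_derivative:
  "smooth w \<Longrightarrow> x \<noteq> 0 \<Longrightarrow> (w has_derivative dw w x) (at x)"
  using smooth_on_has_derivative[of "-{0}" w x] by (simp add: dw_def[abs_def])

lemma invertible_mult_nonzero:
  fixes M :: "real^4^4"
  assumes "invertible M" "p \<in> S3"
  shows "M *v p \<noteq> 0"
  using assms by (metis S3_nonzero invertible_left_inverse matrix_left_invertible_ker)

lemma continuous_on_smooth_compose:
  assumes "smooth w" "continuous_on U f" "\<And>x. x \<in> U \<Longrightarrow> f x \<noteq> 0"
  shows "continuous_on U (\<lambda>x. w (f x))"
  by (rule continuous_on_compose2[OF smooth_on_continuous[OF assms(1)] assms(2)]) (use assms(3) in auto)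

lemma continuous_on_dw:
  assumes "smooth w" "continuous_on U f" "\<And>x. x \<in> U \<Longrightarrow> f x \<noteq> 0" "continuous_on U g"
  shows "continuous_on U (\<lambda>x. dw w (f x) (g x))"
  unfolding dw_def using assms
  by (intro continuous_intros continuous_on_smooth_compose smooth_on_pd)

lemma continuous_on_ddw:
  assumes "smooth w" "continuous_on U f" "\<And>x. x \<in> U \<Longrightarrow> f x \<noteq> 0" "continuous_on U g" "continuous_on U h"
  shows "continuous_on U (\<lambda>x. ddw w (f x) (g x) (h x))"
  unfolding ddw_def using assms
  by (intro continuous_intros continuous_on_dw smooth_on_pd)

lemma continuous_on_apply_snd:
  fixes Mf :: "'a::t2_space \<Rightarrow> real^4^4"
  assumes "continuous_on U Mf"
  shows "continuous_on (U \<times> S3) (\<lambda>z. Mf (fst z) *v snd z)"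
  by (intro continuous_intros continuous_on_compose2[OF assms]) auto

lemma continuous_on_I0_integrand:
  fixes Mf :: "'a::t2_space \<Rightarrow> real^4^4"
  assumes "smooth w" "continuous_on U Mf" "\<And>x. x \<in> U \<Longrightarrow> invertible (Mf x)"
  shows "continuous_on (U \<times> S3) (\<lambda>(x, p). w (Mf x *v p))"
  unfolding case_prod_beta
  by (intro continuous_on_smooth_compose continuous_on_apply_snd assms)
     (use assms invertible_mult_nonzero in auto)

lemma continuous_on_I1_integrand:
  fixes Mf :: "'a::t2_space \<Rightarrow> real^4^4"
  assumes "smooth w" "continuous_on U Mf" "\<And>x. x \<in> U \<Longrightarrow> invertible (Mf x)" "continuous_on U Nf"
  shows "continuous_on (U \<times> S3) (\<lambda>(x, p). dw w (Mf x *v p) (Nf x *v p))"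
  unfolding case_prod_beta
  by (intro continuous_on_dw continuous_on_apply_snd assms)
     (use assms invertible_mult_nonzero in auto)

lemma continuous_on_I2_integrand:
  fixes Mf :: "'a::t2_space \<Rightarrow> real^4^4"
  assumes "smooth w" "continuous_on U Mf" "\<And>x. x \<in> U \<Longrightarrow> invertible (Mf x)"
    "continuous_on U Nf" "continuous_on U Lf"
  shows "continuous_on (U \<times> S3) (\<lambda>(x, p). ddw w (Mf x *v p) (Nf x *v p) (Lf x *v p))"
  unfolding case_prod_beta
  by (intro continuous_on_ddw continuous_on_apply_snd assms)
     (use assms invertible_mult_nonzero in auto)

lemma continuous_on_I0_integrand': "smooth w \<Longrightarrow> invertible M \<Longrightarrow> continuous_on S3 (\<lambda>p. w (M *v p))"
  using continuous_on_slice[OF continuous_on_I0_integrand[of w "UNIV::real set" "\<lambda>_. M"]] by simp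
lemma continuous_on_I1_integrand': "smooth w \<Longrightarrow> invertible M \<Longrightarrow> continuous_on S3 (\<lambda>p. dw w (M *v p) (N *v p))"
  using continuous_on_slice[OF continuous_on_I1_integrand[of w "UNIV::real set" "\<lambda>_. M" "\<lambda>_. N"]] by simp
lemma continuous_on_I2_integrand': "smooth w \<Longrightarrow> invertible M \<Longrightarrow> continuous_on S3 (\<lambda>p. ddw w (M *v p) (N *v p) (L *v p))"
  using continuous_on_slice[OF continuous_on_I2_integrand[of w "UNIV::real set" "\<lambda>_. M" "\<lambda>_. N" "\<lambda>_. L"]] by simp

lemma continuous_on_I1:
  fixes Mf :: "'a::t2_space \<Rightarrow> real^4^4"
  assumes "smooth w" "continuous_on U Mf" "\<And>x. x \<in> U \<Longrightarrow> invertible (Mf x)" "continuous_on U Nf"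
  shows "continuous_on U (\<lambda>x. I1 w (Mf x) (Nf x))"
  unfolding I1_def by (intro continuous_on_tor continuous_on_I1_integrand assms)

lemma continuous_on_I2:
  fixes Mf :: "'a::t2_space \<Rightarrow> real^4^4"
  assumes "smooth w" "continuous_on U Mf" "\<And>x. x \<in> U \<Longrightarrow> invertible (Mf x)"
    "continuous_on U Nf" "continuous_on U Lf"
  shows "continuous_on U (\<lambda>x. I2 w (Mf x) (Nf x) (Lf x))"
  unfolding I2_def by (intro continuous_on_tor continuous_on_I2_integrand assms)

lemma matrix_curve_apply:
  fixes M :: "real \<Rightarrow> real^4^4"
  assumes "(M has_vector_derivative M') (at t)"
  shows "((\<lambda>t. M t *v p) has_vector_derivative M' *v p) (at t)"
  by (rule bounded_linear.has_vector_derivative[OF _ assms])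
     (rule bounded_bilinear.bounded_linear_left[OF bounded_bilinear_matrix_vector_mult])

lemma smooth_chain:
  assumes w: "smooth w" and x: "x t \<noteq> 0" and dx: "(x has_vector_derivative x') (at t)"
  shows "((\<lambda>t. w (x t)) has_real_derivative dw w (x t) x') (at t)"
proof -
  have "((\<lambda>t. w (x t)) has_derivative (\<lambda>s. dw w (x t) (s *\<^sub>R x'))) (at t)"
    by (rule has_derivative_compose[OF dx[unfolded has_vector_derivative_def] smooth_has_derivative[of w "x t"]])
       (use w x in auto)
  moreover have "dw w (x t) (s *\<^sub>R x') = dw w (x t) x' * s" for s
    by (simp add: dw_def sum_distrib_left mult_ac)
  ultimately show ?thesis by (simp add: has_field_derivative_def)
qed

context
  fixes w :: "real^4 \<Rightarrow> real" and M M' :: "real \<Rightarrow> real^4^4"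
  assumes w: "smooth w"
    and dM: "\<And>t. (M has_vector_derivative M' t) (at t)"
    and cM': "continuous_on UNIV M'"
    and iM: "\<And>t. invertible (M t)"
begin

private lemma cM: "continuous_on UNIV M"
  by (intro continuous_at_imp_continuous_on ballI has_vector_derivative_continuous[OF dM])

lemma I0_derivative: "((\<lambda>t. I0 w (M t)) has_real_derivative I1 w (M t) (M' t)) (at t)"
  unfolding I0_def I1_def
proof (rule has_real_derivative_tor[where U = UNIV])
  show "((\<lambda>t. w (M t *v p)) has_real_derivative dw w (M t *v p) (M' t *v p)) (at t)" if "p \<in> S3" for t p
    by (rule smooth_chain[OF w]) (use that iM invertible_mult_nonzero matrix_curve_apply[OF dM] in auto)
qed (use w cM' iM cM in \<open>auto intro: continuous_on_I0_integrand' continuous_on_I1_integrand\<close>)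

text \<open>The product rule under the integral: one summand for the moving base point, one for the
  moving direction.\<close>

lemma I1_derivative:
  assumes dN: "\<And>t. (N has_vector_derivative N' t) (at t)"
    and cN': "continuous_on UNIV N'"
  shows "((\<lambda>t. I1 w (M t) (N t)) has_real_derivative I2 w (M t) (M' t) (N t) + I1 w (M t) (N' t)) (at t)"
proof -
  have cN: "continuous_on UNIV N"
    by (intro continuous_at_imp_continuous_on ballI has_vector_derivative_continuous[OF dN])
  have "((\<lambda>t. tor (\<lambda>p. dw w (M t *v p) (N t *v p))) has_real_derivative
    tor (\<lambda>p. ddw w (M t *v p) (M' t *v p) (N t *v p) + dw w (M t *v p) (N' t *v p))) (at t)"
  proof (rule has_real_derivative_tor[where U = UNIV])
    show "continuous_on (UNIV \<times> S3) (\<lambda>(t, p). ddw w (M t *v p) (M' t *v p) (N t *v p) + dw w (M t *v p) (N' t *v p))"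
      using continuous_on_add[OF continuous_on_I2_integrand[OF w cM _ cM' cN] continuous_on_I1_integrand[OF w cM _ cN']] iM
      by (simp add: case_prod_beta)
    show "((\<lambda>t. dw w (M t *v p) (N t *v p)) has_real_derivative
        ddw w (M t *v p) (M' t *v p) (N t *v p) + dw w (M t *v p) (N' t *v p)) (at t)" if p: "p \<in> S3" for t p
    proof -
      have 1: "((\<lambda>t. pd i w (M t *v p)) has_real_derivative dw (pd i w) (M t *v p) (M' t *v p)) (at t)" for i
        by (rule smooth_chain[OF smooth_on_pd[OF w]])
           (use p iM invertible_mult_nonzero matrix_curve_apply[OF dM] in auto)
      have 2: "((\<lambda>t. (N t *v p) $ i) has_real_derivative (N' t *v p) $ i) (at t)" for i
        using bounded_linear.has_vector_derivative[OF bounded_linear_vec_nth[of i] matrix_curve_apply[OF dN[of t]]]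
        by (simp add: has_real_derivative_iff_has_vector_derivative)
      have "((\<lambda>t. \<Sum>i\<in>UNIV. pd i w (M t *v p) * (N t *v p) $ i) has_real_derivative
        (\<Sum>i\<in>UNIV. dw (pd i w) (M t *v p) (M' t *v p) * (N t *v p) $ i + (N' t *v p) $ i * pd i w (M t *v p))) (at t)"
        by (intro DERIV_sum DERIV_mult 1 2)
      then show ?thesis
        by (simp add: dw_def[of w] ddw_def sum.distrib mult.commute[of "(N' t *v p) $ _"])
    qed
  qed (use w cM' iM cM in \<open>auto intro: continuous_on_I1_integrand'\<close>)
  then show ?thesis
    unfolding I1_def I2_def by (subst (asm) tor_add) (use w iM in \<open>auto intro: continuous_on_I1_integrand' continuous_on_I2_integrand'\<close>)
qed

end

lemma dw_lincomb: "dw w x (a *\<^sub>R h + b *\<^sub>R k) = a * dw w x h + b * dw w x k"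
  by (simp add: dw_def distrib_left sum.distrib sum_distrib_left mult_ac)

lemma ddw_lincomb_left: "ddw w x (a *\<^sub>R h + b *\<^sub>R k) l = a * ddw w x h l + b * ddw w x k l"
  by (simp add: ddw_def dw_lincomb distrib_left distrib_right sum.distrib sum_distrib_left mult_ac)

lemma ddw_commute:
  assumes "smooth w" "x \<noteq> 0"
  shows "ddw w x h k = ddw w x k h"
proof -
  have "ddw w x h k = (\<Sum>i\<in>UNIV. \<Sum>j\<in>UNIV. pd j (pd i w) x * h $ j * k $ i)"
    by (simp add: ddw_def dw_def sum_distrib_right)
  also have "\<dots> = (\<Sum>j\<in>UNIV. \<Sum>i\<in>UNIV. pd j (pd i w) x * h $ j * k $ i)" by (rule sum.swap)
  also have "\<dots> = (\<Sum>j\<in>UNIV. \<Sum>i\<in>UNIV. pd i (pd j w) x * k $ i * h $ j)"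
    using pd_commute[of "-{0}" x w] assms by (simp add: mult_ac)
  also have "\<dots> = ddw w x k h" by (simp add: ddw_def dw_def sum_distrib_right)
  finally show ?thesis .
qed

lemma I1_lincomb:
  assumes "smooth w" "invertible M"
  shows "I1 w M (a *\<^sub>R N + b *\<^sub>R L) = a * I1 w M N + b * I1 w M L"
  using assms unfolding I1_def
  by (simp add: matrix_vector_mult_bilinear dw_lincomb tor_add tor_cmult continuous_on_I1_integrand' continuous_on_mult)

lemma I2_lincomb_left:
  assumes "smooth w" "invertible M"
  shows "I2 w M (a *\<^sub>R N + b *\<^sub>R L) K = a * I2 w M N K + b * I2 w M L K"
  using assms unfolding I2_def
  by (simp add: matrix_vector_mult_bilinear ddw_lincomb_left tor_add tor_cmult continuous_on_I2_integrand' continuous_on_mult)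

lemma I2_commute:
  assumes "smooth w" "invertible M"
  shows "I2 w M N K = I2 w M K N"
  unfolding I2_def by (rule tor_cong) (rule ddw_commute[OF assms(1) invertible_mult_nonzero[OF assms(2)]])

lemma I2_lincomb_right:
  assumes "smooth w" "invertible M"
  shows "I2 w M K (a *\<^sub>R N + b *\<^sub>R L) = a * I2 w M K N + b * I2 w M K L"
  using assms I2_lincomb_left I2_commute by metis

lemma I1_lincomb_fun:
  assumes "smooth w" "smooth v" "invertible M"
  shows "I1 (\<lambda>x. a * w x + b * v x) M N = a * I1 w M N + b * I1 v M N"
proof -
  have "dw (\<lambda>x. a * w x + b * v x) x h = a * dw w x h + b * dw v x h" if "x \<noteq> 0" for x h
    using pds_lincomb[of "-{0}" w v x "[_]" a b] that assms(1,2)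
    by (simp add: dw_def distrib_right distrib_left sum.distrib sum_distrib_left mult_ac)
  then have "I1 (\<lambda>x. a * w x + b * v x) M N = tor (\<lambda>p. a * dw w (M *v p) (N *v p) + b * dw v (M *v p) (N *v p))"
    unfolding I1_def using assms(3) by (intro tor_cong) (simp add: invertible_mult_nonzero)
  then show ?thesis using assms unfolding I1_def
    by (simp add: tor_add tor_cmult continuous_on_I1_integrand' continuous_on_mult)
qed

lemma I2_lincomb_fun:
  assumes "smooth w" "smooth v" "invertible M"
  shows "I2 (\<lambda>x. a * w x + b * v x) M N L = a * I2 w M N L + b * I2 v M N L"
proof -
  have "ddw (\<lambda>x. a * w x + b * v x) x h k = a * ddw w x h k + b * ddw v x h k" if "x \<noteq> 0" for x h k
    using pds_lincomb[of "-{0}" w v x "[_, _]" a b] that assms(1,2)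
    by (simp add: ddw_def dw_def distrib_right distrib_left sum.distrib sum_distrib_left sum_distrib_right mult_ac)
  then have "I2 (\<lambda>x. a * w x + b * v x) M N L = tor (\<lambda>p. a * ddw w (M *v p) (N *v p) (L *v p) + b * ddw v (M *v p) (N *v p) (L *v p))"
    unfolding I2_def using assms(3) by (intro tor_cong) (simp add: invertible_mult_nonzero)
  then show ?thesis using assms unfolding I2_def
    by (simp add: tor_add tor_cmult continuous_on_I2_integrand' continuous_on_mult)
qed

text \<open>The factor 4 counts the partial derivatives; in \<open>ddw_bound\<close> it enters twice
  and gives 16.\<close>

lemma dw_bound:
  assumes "\<And>i. \<bar>pd i w x\<bar> \<le> B"
  shows "\<bar>dw w x h\<bar> \<le> 4 * (B * norm h)"
proof -
  have "\<bar>dw w x h\<bar> \<le> (\<Sum>i\<in>(UNIV::4 set). B * norm h)"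
    unfolding dw_def
    by (rule order_trans[OF sum_abs], rule sum_mono)
       (use assms in \<open>auto simp: abs_mult intro!: mult_mono component_le_norm_cart intro: order_trans[OF abs_ge_zero]\<close>)
  then show ?thesis by simp
qed

lemma ddw_bound:
  assumes "\<And>i j. \<bar>pd j (pd i w) x\<bar> \<le> B"
  shows "\<bar>ddw w x h k\<bar> \<le> 16 * (B * norm h * norm k)"
proof -
  have B: "B \<ge> 0" using assms order_trans[OF abs_ge_zero] by blast
  have "\<bar>ddw w x h k\<bar> \<le> (\<Sum>i\<in>(UNIV::4 set). 4 * (B * norm h) * norm k)"
    unfolding ddw_def
    by (rule order_trans[OF sum_abs], rule sum_mono, unfold abs_mult, rule mult_mono)
       (use assms dw_bound B in \<open>auto intro!: component_le_norm_cart\<close>)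
  then show ?thesis by (simp add: mult_ac)
qed

lemma orthogonal_maps_S3: "orthogonal_matrix M \<Longrightarrow> p \<in> S3 \<Longrightarrow> M *v p \<in> S3"
  unfolding S3_def using orthogonal_transformation_norm[of "(*v) M"]
  by (simp add: orthogonal_transformation_matrix)

lemma I1_bound:
  assumes w: "smooth w" and M: "orthogonal_matrix M"
    and B: "\<And>i x. x \<in> S3 \<Longrightarrow> \<bar>pd i w x\<bar> \<le> B" and N: "\<And>p. p \<in> S3 \<Longrightarrow> norm (N *v p) \<le> K"
  shows "\<bar>I1 w M N\<bar> \<le> 2 * pi^2 * (4 * (B * K))"
  unfolding I1_def
proof (rule tor_bound)
  fix p assume p: "p \<in> S3"
  have "B \<ge> 0" using B[OF p] order_trans[OF abs_ge_zero] by blast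
  have "\<bar>dw w (M *v p) (N *v p)\<bar> \<le> 4 * (B * norm (N *v p))"
    by (rule dw_bound) (rule B[OF orthogonal_maps_S3[OF M p]])
  also have "\<dots> \<le> 4 * (B * K)" using N[OF p] \<open>B \<ge> 0\<close> by (simp add: mult_left_mono)
  finally show "\<bar>dw w (M *v p) (N *v p)\<bar> \<le> 4 * (B * K)" .
qed (rule continuous_on_I1_integrand'[OF w invertible_orthogonal[OF M]])

lemma I2_bound:
  assumes w: "smooth w" and M: "orthogonal_matrix M"
    and B: "\<And>i j x. x \<in> S3 \<Longrightarrow> \<bar>pd j (pd i w) x\<bar> \<le> B"
    and N: "\<And>p. p \<in> S3 \<Longrightarrow> norm (N *v p) \<le> K" and L: "\<And>p. p \<in> S3 \<Longrightarrow> norm (L *v p) \<le> K"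
  shows "\<bar>I2 w M N L\<bar> \<le> 2 * pi^2 * (16 * (B * K * K))"
  unfolding I2_def
proof (rule tor_bound)
  fix p assume p: "p \<in> S3"
  have "B \<ge> 0" using B[OF p] order_trans[OF abs_ge_zero] by blast
  moreover have "K \<ge> 0" using N[OF p] norm_ge_zero order_trans by blast
  moreover have "\<bar>ddw w (M *v p) (N *v p) (L *v p)\<bar> \<le> 16 * (B * norm (N *v p) * norm (L *v p))"
    by (rule ddw_bound) (rule B[OF orthogonal_maps_S3[OF M p]])
  moreover have "B * norm (N *v p) * norm (L *v p) \<le> B * K * K"
    using N[OF p] L[OF p] calculation by (intro mult_mono) auto
  ultimately show "\<bar>ddw w (M *v p) (N *v p) (L *v p)\<bar> \<le> 16 * (B * K * K)" by linarith
qed (rule continuous_on_I2_integrand'[OF w invertible_orthogonal[OF M]])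

lemma I1_rot:
  assumes "smooth w" "invertible M"
  shows "I1 w (M ** rot a c) (N ** rot a c) = I1 w M N"
  unfolding I1_def using tor_rot[OF continuous_on_I1_integrand'[OF assms]] by (simp add: matrix_vector_mul_assoc)

lemma I2_rot:
  assumes "smooth w" "invertible M"
  shows "I2 w (M ** rot a c) (N ** rot a c) (L ** rot a c) = I2 w M N L"
  unfolding I2_def using tor_rot[OF continuous_on_I2_integrand'[OF assms]] by (simp add: matrix_vector_mul_assoc)

section \<open>Block-diagonal skew directions, the Lie algebra of the rotations\<close>

definition blk :: "real \<Rightarrow> real \<Rightarrow> real^4^4" where
  "blk a c = (\<chi> i j. if i = 1 \<and> j = 2 then - a else if i = 2 \<and> j = 1 then a
     else if i = 3 \<and> j = 4 then - c else if i = 4 \<and> j = 3 then c else 0)"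

lemma rot_alt: "rot a c = cos a *\<^sub>R (\<chi> i j. if i = j \<and> (i = 1 \<or> i = 2) then 1 else 0) + sin a *\<^sub>R blk 1 0
    + cos c *\<^sub>R (\<chi> i j. if i = j \<and> (i = 3 \<or> i = 4) then 1 else 0) + sin c *\<^sub>R blk 0 1"
  unfolding vec_eq_iff forall_4 rot_def blk_def by simp

lemma blk_alt: "blk a c = a *\<^sub>R blk 1 0 + c *\<^sub>R blk 0 1"
  unfolding vec_eq_iff forall_4 blk_def by simp

lemma rot_0 [simp]: "rot 0 0 = mat 1"
  unfolding vec_eq_iff forall_4 rot_def mat_def by simp

lemma has_vector_derivative_matrix_mult_left:
  fixes M :: "real^4^4"
  assumes "(X has_vector_derivative X') (at t within T)"
  shows "((\<lambda>t. M ** X t) has_vector_derivative M ** X') (at t within T)"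
  by (rule bounded_linear.has_vector_derivative[OF _ assms])
     (rule bounded_bilinear.bounded_linear_right[OF bounded_bilinear_matrix_mult])

lemma has_vector_derivative_matrix_mult_right:
  fixes M :: "real^4^4"
  assumes "(X has_vector_derivative X') (at t within T)"
  shows "((\<lambda>t. X t ** M) has_vector_derivative X' ** M) (at t within T)"
  by (rule bounded_linear.has_vector_derivative[OF _ assms])
     (rule bounded_bilinear.bounded_linear_left[OF bounded_bilinear_matrix_mult])

text \<open>\<open>I0 w\<close> is constant along the curve \<open>M ** rot (t * a) (t * c)\<close>,
  whose velocity at 0 is \<open>M ** blk a c\<close>.\<close>

lemma I1_blk:
  assumes w: "smooth w" and M: "invertible M"
  shows "I1 w M (M ** blk a c) = 0"
proof -
  \<comment> \<open>\<open>P\<close> and \<open>Q\<close> project onto the two coordinate planes. In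
    \<open>rot_alt\<close> they carry the cosines, so they drop out of the velocity at 0.\<close>
  define P where "P = ((\<chi> i j. if i = j \<and> (i = 1 \<or> i = 2) then 1 else 0) :: real^4^4)"
  define Q where "Q = ((\<chi> i j. if i = j \<and> (i = 3 \<or> i = 4) then 1 else 0) :: real^4^4)"
  define R' where "R' t = (- (a * sin (t * a))) *\<^sub>R P + (a * cos (t * a)) *\<^sub>R blk 1 0
     + (- (c * sin (t * c))) *\<^sub>R Q + (c * cos (t * c)) *\<^sub>R blk 0 1" for t
  have "((\<lambda>t. rot (t * a) (t * c)) has_vector_derivative R' t) (at t)" for t
    unfolding rot_alt P_def[symmetric] Q_def[symmetric] R'_def
    by (rule derivative_eq_intros refl | simp)+ (simp add: mult_ac)
  from has_vector_derivative_matrix_mult_left[OF this]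
  have "((\<lambda>t. I0 w (M ** rot (t * a) (t * c))) has_real_derivative
      I1 w (M ** rot (0 * a) (0 * c)) (M ** R' 0)) (at 0)"
    by (rule I0_derivative[OF w])
       (auto simp: R'_def intro!: continuous_intros invertible_mult[OF M invertible_orthogonal[OF orthogonal_rot]])
  moreover have "M ** R' 0 = M ** blk a c" unfolding R'_def by (simp add: blk_alt[of a c])
  moreover have "I0 w (M ** rot s r) = I0 w M" for s r
    unfolding I0_def using tor_rot[OF continuous_on_I0_integrand'[OF w M]] by (simp add: matrix_vector_mul_assoc)
  ultimately have "((\<lambda>t::real. I0 w M) has_real_derivative I1 w M (M ** blk a c)) (at 0)" by simp
  then show ?thesis using DERIV_unique DERIV_const by blast
qed

subsection \<open>Critical points and the space of smooth functions\<close>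

text \<open>For a curve with \<open>M' = M ** Z\<close> this is the derivative of \<open>I1 w M (M ** X)\<close>.\<close>
definition hess :: "(real^4 \<Rightarrow> real) \<Rightarrow> real^4^4 \<Rightarrow> real^4^4 \<Rightarrow> real^4^4 \<Rightarrow> real" where
  "hess w M Z X = I2 w M (M ** Z) (M ** X) + I1 w M (M ** Z ** X)"

lemma I1_linear: "smooth w \<Longrightarrow> invertible M \<Longrightarrow> linear (I1 w M)"
  using I1_lincomb[of w M 1 _ 1] I1_lincomb[of w M _ _ 0 0] by (simp add: linear_iff)

lemma I2_linear_left: "smooth w \<Longrightarrow> invertible M \<Longrightarrow> linear (\<lambda>N. I2 w M N K)"
  using I2_lincomb_left[of w M 1 _ 1] I2_lincomb_left[of w M _ _ 0 0] by (simp add: linear_iff)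

lemma I2_linear_right: "smooth w \<Longrightarrow> invertible M \<Longrightarrow> linear (I2 w M K)"
  using I2_lincomb_right[of w M K 1 _ 1] I2_lincomb_right[of w M K _ _ 0 0] by (simp add: linear_iff)

lemma hess_linear_left:
  assumes "smooth w" "invertible M"
  shows "linear (\<lambda>Z. hess w M Z X)"
  using linear_add[OF I2_linear_left[OF assms]] linear_scale[OF I2_linear_left[OF assms]]
    linear_add[OF I1_linear[OF assms]] linear_scale[OF I1_linear[OF assms]]
  by (simp add: linear_iff hess_def matrix_mult_bilinear distrib_left)

lemma hess_linear_right:
  assumes "smooth w" "invertible M"
  shows "linear (hess w M Z)"
  using linear_add[OF I2_linear_right[OF assms]] linear_scale[OF I2_linear_right[OF assms]]
    linear_add[OF I1_linear[OF assms]] linear_scale[OF I1_linear[OF assms]]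
  by (simp add: linear_iff hess_def matrix_mult_bilinear distrib_left)

lemma linear_expand_axis:
  fixes f :: "real^4 \<Rightarrow> real"
  assumes "linear f"
  shows "f b = (\<Sum>i\<in>UNIV. b $ i * f (ax i))"
proof -
  have "f b = f (\<Sum>i\<in>UNIV. b $ i *\<^sub>R ax i)"
    by (simp add: basis_expansion scalar_mult_eq_scaleR[symmetric])
  also have "\<dots> = (\<Sum>i\<in>UNIV. b $ i * f (ax i))"
    by (simp add: linear_sum[OF assms] linear_scale[OF assms])
  finally show ?thesis .
qed

text \<open>The second variation \<open>I2\<close> is symmetric; exchanging the arguments only
  reverses the product inside \<open>I1\<close>, which leaves the commutator.\<close>

lemma hess_swap:
  assumes w: "smooth w" and M: "invertible M"
  shows "hess w M Z X = hess w M X Z + I1 w M (M ** (Z ** X - X ** Z))"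
  unfolding hess_def I2_commute[OF w M, of "M ** Z"]
  by (simp add: matrix_mult_bilinear linear_diff[OF I1_linear[OF w M]] matrix_mul_assoc)

text \<open>\<open>I1_blk\<close> holds at every invertible matrix, so it can be differentiated
  along \<open>M ** (mat 1 + t *\<^sub>R Z)\<close>; these matrices are invertible because
  \<open>Z\<close> is skew.\<close>

lemma hess_blk:
  assumes w: "smooth w" and M: "invertible M" and Z: "transpose Z = - Z"
  shows "hess w M Z (blk a c) = 0"
proof -
  have inv: "invertible (M ** (mat 1 + t *\<^sub>R Z))" for t
    by (intro invertible_mult M invertible_one_plus_skew) (simp add: transpose_scalar Z)
  have d: "((\<lambda>t. mat 1 + t *\<^sub>R Z) has_vector_derivative Z) (at t)" for t
    by (auto intro!: derivative_eq_intros)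
  have "((\<lambda>t. I1 w (M ** (mat 1 + t *\<^sub>R Z)) (M ** (mat 1 + t *\<^sub>R Z) ** blk a c)) has_real_derivative
      I2 w (M ** (mat 1 + 0 *\<^sub>R Z)) (M ** Z) (M ** (mat 1 + 0 *\<^sub>R Z) ** blk a c)
       + I1 w (M ** (mat 1 + 0 *\<^sub>R Z)) (M ** Z ** blk a c)) (at 0)"
    by (rule I1_derivative[OF w])
       (intro has_vector_derivative_matrix_mult_left has_vector_derivative_matrix_mult_right d inv continuous_intros)+
  then have "((\<lambda>t::real. 0::real) has_real_derivative hess w M Z (blk a c)) (at 0)"
    unfolding I1_blk[OF w inv] hess_def by simp
  then show ?thesis using DERIV_unique DERIV_const by blast
qed

text \<open>With the two lemmas that follow, these are the relations of the Cartan decomposition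
  so(4) = k + p belonging to O(4)/(O(2) x O(2)), where k consists of the \<open>blk a d\<close> and
  p of the \<open>skewB b\<close>: [p,p] lies in k and [k,p] lies in p. The witnesses are read off
  from the entries.\<close>

lemma commutator_skewB: "\<exists>a d. skewB b ** skewB c - skewB c ** skewB b = blk a d"
proof (intro exI)
  let ?X = "skewB b ** skewB c - skewB c ** skewB b"
  show "?X = blk (?X $ 2 $ 1) (?X $ 4 $ 3)"
    unfolding vec_eq_iff forall_4
    by (simp add: matrix_matrix_mult_def sum_4 skewB_def blk_def)
qed

lemma commutator_blk_skewB: "\<exists>c. blk a d ** skewB b - skewB b ** blk a d = skewB c"
proof (intro exI)
  let ?X = "blk a d ** skewB b - skewB b ** blk a d"
  show "?X = skewB (vector [?X $ 1 $ 3, ?X $ 1 $ 4, ?X $ 2 $ 3, ?X $ 2 $ 4])"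
    unfolding vec_eq_iff forall_4
    by (simp add: matrix_matrix_mult_def sum_4 skewB_def blk_def vector_def)
qed

lemma skew_decompose:
  assumes "transpose Z = - Z"
  shows "\<exists>b a d. Z = skewB b + blk a d"
proof (intro exI)
  have Z: "Z $ i $ j = - Z $ j $ i" for i j
  proof -
    have "transpose Z $ j $ i = (- Z) $ j $ i" unfolding assms ..
    then show ?thesis by (simp add: transpose_def)
  qed
  have Z0: "Z $ i $ i = 0" for i using Z[of i i] by simp
  show "Z = skewB (vector [Z $ 1 $ 3, Z $ 1 $ 4, Z $ 2 $ 3, Z $ 2 $ 4]) + blk (Z $ 2 $ 1) (Z $ 4 $ 3)"
    unfolding vec_eq_iff forall_4
    using Z[of 1 2] Z[of 3 1] Z[of 4 1] Z[of 3 2] Z[of 4 2] Z[of 3 4]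
    by (simp add: skewB_def blk_def vector_def Z0)
qed

text \<open>The asymmetry found in \<open>hess_swap\<close> is a first variation in a block-diagonal
  direction and vanishes, whether or not \<open>M\<close> is critical.\<close>

lemma hess_skewB_commute:
  assumes "smooth w" "invertible M"
  shows "hess w M (skewB b) (skewB c) = hess w M (skewB c) (skewB b)"
  using hess_swap[OF assms, of "skewB b" "skewB c"] commutator_skewB[of b c] I1_blk[OF assms] by auto

text \<open>\<open>crit\<close> and \<open>nondeg\<close> use the frame \<open>M ** skewB b\<close>
  at \<open>M\<close> itself, so they can be compared at different matrices representing one torus.
  A kernel vector, unlike a determinant, can also be normalised and passed to a limit.\<close>

definition crit :: "(real^4 \<Rightarrow> real) \<Rightarrow> real^4^4 \<Rightarrow> bool" where
  "crit w M \<longleftrightarrow> (\<forall>b. I1 w M (M ** skewB b) = 0)"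

definition nondeg :: "(real^4 \<Rightarrow> real) \<Rightarrow> real^4^4 \<Rightarrow> bool" where
  "nondeg w M \<longleftrightarrow> (\<forall>b. b \<noteq> 0 \<longrightarrow> (\<exists>c. hess w M (skewB b) (skewB c) \<noteq> 0))"

text \<open>Exchanging the arguments leads to \<open>hess_blk\<close> plus a first variation along a
  commutator. The commutator is a tangent direction, so here criticality is essential.\<close>

lemma hess_blk_left:
  assumes "smooth w" "invertible M" "crit w M"
  shows "hess w M (blk a d) (skewB b) = 0"
  using hess_swap[OF assms(1,2), of "blk a d" "skewB b"] commutator_blk_skewB[of a d b]
    hess_blk[OF assms(1,2), of "skewB b" a d] assms(3)
  by (auto simp: crit_def)

section \<open>Derivatives in the Cayley chart and the Morse criterion\<close>

lemma radial_S3: "x \<in> S3 \<Longrightarrow> radial u x = u x"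
  by (simp add: radial_def S3_def)

lemma CinfS3_smooth: "u \<in> CinfS3 \<Longrightarrow> smooth (radial u)"
  by (simp add: CinfS3_def)

lemma Ichart_I0:
  assumes M: "orthogonal_matrix M"
  shows "Ichart u M b = I0 (radial u) (M ** cayB b)"
proof -
  have "Ichart u M b = tor (\<lambda>p. u (M ** cayB b *v p))"
    by (simp add: Ichart_def Itor_def tor_def cayB_def)
  also have "\<dots> = I0 (radial u) (M ** cayB b)"
    unfolding I0_def
    by (rule tor_cong) (simp add: radial_S3 orthogonal_maps_S3 orthogonal_mult_cayB[OF M])
  finally show ?thesis .
qed

lemma pd_Ichart:
  assumes u: "u \<in> CinfS3" and M: "orthogonal_matrix M"
  shows "pd i (Ichart u M) b =
    I1 (radial u) (M ** cayB b) (M ** (2 *\<^sub>R (resB b ** skewB (ax i) ** resB b)))"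
proof (rule pd_eqI)
  have "((\<lambda>t. I0 (radial u) (M ** cayB (b + t *\<^sub>R ax i))) has_real_derivative
    I1 (radial u) (M ** cayB (b + 0 *\<^sub>R ax i)) (M ** (2 *\<^sub>R (resB (b + 0 *\<^sub>R ax i) ** skewB (ax i) ** resB (b + 0 *\<^sub>R ax i))))) (at 0)"
    by (rule I0_derivative[OF CinfS3_smooth[OF u]])
       (intro has_vector_derivative_matrix_mult_left has_vector_derivative_cayB continuous_intros
         invertible_orthogonal[OF orthogonal_mult_cayB[OF M]])+
  then show "((\<lambda>t. Ichart u M (b + t *\<^sub>R ax i)) has_real_derivative
    I1 (radial u) (M ** cayB b) (M ** (2 *\<^sub>R (resB b ** skewB (ax i) ** resB b)))) (at 0)"
    by (simp add: Ichart_I0[OF M])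
qed

text \<open>The Cayley transform has derivative 2 at 0, which multiplies \<open>I2\<close> by 4, and
  its second-order term contributes twice the symmetrised product of the directions to
  \<open>I1\<close>. Together this is twice \<open>hess\<close> in either order, and the two orders
  agree even off critical points.\<close>

lemma pd_pd_Ichart:
  assumes u: "u \<in> CinfS3" and M: "orthogonal_matrix M"
  shows "pd i (pd j (Ichart u M)) 0 = 4 * hess (radial u) M (skewB (ax i)) (skewB (ax j))"
proof (rule pd_eqI)
  let ?w = "radial u"
  define R where "R t = resB (0 + t *\<^sub>R ax i)" for t
  define E where "E k = skewB (ax k)" for k
  have w: "smooth ?w" and iM: "invertible M" using u M by (simp_all add: CinfS3_smooth invertible_orthogonal)
  have dR: "(R has_vector_derivative R t ** E i ** R t) (at t)" for t
    unfolding R_def[abs_def] E_def by (rule has_vector_derivative_resB)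
  have cR: "continuous_on UNIV R"
    unfolding R_def[abs_def] by (intro continuous_intros)
  have dN: "((\<lambda>t. M ** (2 *\<^sub>R (R t ** E j ** R t))) has_vector_derivative
      M ** (2 *\<^sub>R (R t ** E j ** (R t ** E i ** R t) + R t ** E i ** R t ** E j ** R t))) (at t)" for t
    by (intro has_vector_derivative_matrix_mult_left bounded_linear.has_vector_derivative[OF bounded_linear_scaleR_right]
       bounded_bilinear.has_vector_derivative[OF bounded_bilinear_matrix_mult] has_vector_derivative_matrix_mult_right dR)
  have R0 [simp]: "R 0 = mat 1" by (simp add: R_def)
  have "((\<lambda>t. I1 ?w (M ** cayB (0 + t *\<^sub>R ax i)) (M ** (2 *\<^sub>R (R t ** E j ** R t)))) has_real_derivative
     I2 ?w (M ** cayB (0 + 0 *\<^sub>R ax i)) (M ** (2 *\<^sub>R (R 0 ** E i ** R 0))) (M ** (2 *\<^sub>R (R 0 ** E j ** R 0)))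
     + I1 ?w (M ** cayB (0 + 0 *\<^sub>R ax i)) (M ** (2 *\<^sub>R (R 0 ** E j ** (R 0 ** E i ** R 0) + R 0 ** E i ** R 0 ** E j ** R 0)))) (at 0)"
  proof (rule I1_derivative[OF w _ _ _ dN])
    show "((\<lambda>t. M ** cayB (0 + t *\<^sub>R ax i)) has_vector_derivative M ** (2 *\<^sub>R (R t ** E i ** R t))) (at t)" for t
      unfolding R_def E_def by (intro has_vector_derivative_matrix_mult_left has_vector_derivative_cayB)
  qed (intro continuous_intros cR invertible_orthogonal[OF orthogonal_mult_cayB[OF M]])+
  moreover have "I2 ?w M (M ** (2 *\<^sub>R E i)) (M ** (2 *\<^sub>R E j)) + I1 ?w M (M ** (2 *\<^sub>R (E j ** E i + E i ** E j)))
    = 2 * hess ?w M (E i) (E j) + 2 * hess ?w M (E j) (E i)"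
    using linear_scale[OF I2_linear_left[OF w iM]] linear_scale[OF I2_linear_right[OF w iM]]
      linear_add[OF I1_linear[OF w iM]] linear_scale[OF I1_linear[OF w iM]]
      I2_commute[OF w iM, of "M ** E j" "M ** E i"]
    by (simp add: hess_def matrix_mult_bilinear matrix_mul_assoc)
  ultimately have "((\<lambda>t. I1 ?w (M ** cayB (0 + t *\<^sub>R ax i)) (M ** (2 *\<^sub>R (R t ** E j ** R t)))) has_real_derivative
     4 * hess ?w M (E i) (E j)) (at 0)"
    using hess_skewB_commute[OF w iM, of "ax i" "ax j"] by (simp add: E_def)
  then show "((\<lambda>t. pd j (Ichart u M) (0 + t *\<^sub>R ax i)) has_real_derivative
     4 * hess ?w M (skewB (ax i)) (skewB (ax j))) (at 0)"
    unfolding pd_Ichart[OF u M] R_def E_def .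
qed

lemma linear_hess_skewB:
  assumes "smooth w" "invertible M"
  shows "linear (\<lambda>b. hess w M (skewB b) X)" "linear (\<lambda>b. hess w M X (skewB b))"
    "linear (\<lambda>b. I1 w M (M ** skewB b))"
  using linear_compose[OF linear_skewB hess_linear_left[OF assms]]
    linear_compose[OF linear_skewB hess_linear_right[OF assms]]
    linear_compose[OF linear_compose[OF linear_skewB, of "(**) M"] I1_linear[OF assms]]
  by (simp_all add: o_def linear_iff matrix_mult_bilinear)

lemma morse_type_I_criterion:
  assumes u: "u \<in> CinfS3"
    and morse: "\<And>M. orthogonal_matrix M \<Longrightarrow> crit (radial u) M \<Longrightarrow> nondeg (radial u) M"
  shows "morse_type_I u"
  unfolding morse_type_I_def
proof (intro allI impI notI)
  fix M :: "real^4^4"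
  assume M: "orthogonal_matrix M" and cr: "\<forall>i. pd i (Ichart u M) 0 = 0"
    and d: "det (\<chi> i j. pd i (pd j (Ichart u M)) 0) = 0"
  let ?w = "radial u"
  have w: "smooth ?w" and iM: "invertible M" using u M by (simp_all add: CinfS3_smooth invertible_orthogonal)
  note lin = linear_hess_skewB[OF w iM]
  have "I1 ?w M (M ** skewB (ax i)) = 0" for i
    using cr linear_scale[OF I1_linear[OF w iM]] by (simp add: pd_Ichart[OF u M] matrix_mult_bilinear)
  then have "I1 ?w M (M ** skewB b) = 0" for b
    using linear_expand_axis[OF lin(3), of b] by simp
  then have "crit ?w M" unfolding crit_def by blast
  then have nd: "nondeg ?w M" by (rule morse[OF M])
  define H where "H = (\<chi> i j. pd i (pd j (Ichart u M)) 0)"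
  \<comment> \<open>The transpose supplies a kernel vector for the row index of \<open>H\<close>,
    that is, for the first argument of \<open>hess\<close>, as \<open>nondeg\<close>
    expects.\<close>
  have "\<not> invertible (transpose H)" using d by (simp add: H_def invertible_det_nz)
  then obtain b where b: "b \<noteq> 0" "transpose H *v b = 0"
    by (metis invertible_left_inverse matrix_left_invertible_ker)
  obtain c where c: "hess ?w M (skewB b) (skewB c) \<noteq> 0" using nd b(1) by (auto simp: nondeg_def)
  have "(\<Sum>i\<in>UNIV. b $ i * hess ?w M (skewB (ax i)) (skewB (ax j))) = 0" for j
  proof -
    have "0 = (transpose H *v b) $ j" using b by simp
    also have "\<dots> = 4 * (\<Sum>i\<in>UNIV. b $ i * hess ?w M (skewB (ax i)) (skewB (ax j)))"
      by (simp add: matrix_vector_mult_def transpose_def H_def pd_pd_Ichart[OF u M] sum_distrib_left mult_ac del: transpose_matrix_vector)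
    finally show ?thesis by simp
  qed
  then have "hess ?w M (skewB b) (skewB (ax j)) = 0" for j
    using linear_expand_axis[OF lin(1)[of "skewB (ax j)"], of b] by simp
  then have "hess ?w M (skewB b) (skewB c) = 0"
    using linear_expand_axis[OF lin(2)[of "skewB b"], of c] by simp
  with c show False by simp
qed

section \<open>Linear structure and seminorms of the function space\<close>

lemma radial_lincomb: "radial (\<lambda>x. a * u x + b * v x) = (\<lambda>x. a * radial u x + b * radial v x)"
  by (simp add: radial_def fun_eq_iff)

lemma CinfS3_lincomb:
  assumes "u \<in> CinfS3" "v \<in> CinfS3"
  shows "(\<lambda>x. a * u x + b * v x) \<in> CinfS3"
  using assms smooth_on_lincomb[of "-{0}" "radial u" "radial v" a b]
  by (simp add: CinfS3_def radial_lincomb)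

lemma CinfS3_diff: "u \<in> CinfS3 \<Longrightarrow> v \<in> CinfS3 \<Longrightarrow> u - v \<in> CinfS3"
  using CinfS3_lincomb[of u v 1 "-1"] by (simp add: fun_diff_def)

lemma S3_punctured: "S3 \<subseteq> -{0}" using S3_nonzero by auto

text \<open>\<open>Sup\<close> over the reals is informative only for bounded sets. Here finitely
  many index lists occur, and each gives a continuous function on the compact sphere.\<close>

lemma bdd_seminorm:
  assumes "u \<in> CinfS3"
  shows "bdd_above {\<bar>pds is (radial u) x\<bar> | is x. length is \<le> k \<and> x \<in> S3}"
proof -
  have "finite {is :: 4 list. length is \<le> k}"
    using finite_lists_length_le[of "UNIV :: 4 set" k] by simp
  moreover have "bdd_above ((\<lambda>x. \<bar>pds is (radial u) x\<bar>) ` S3)" for "is" :: "4 list"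
    by (intro bounded_imp_bdd_above compact_imp_bounded compact_continuous_image continuous_intros compact_S3
      continuous_on_subset[OF smooth_on_continuous[OF smooth_on_pds[OF CinfS3_smooth[OF assms]]] S3_punctured])
  ultimately have "bdd_above (\<Union>is\<in>{is :: 4 list. length is \<le> k}. (\<lambda>x. \<bar>pds is (radial u) x\<bar>) ` S3)"
    by simp
  then show ?thesis by (rule bdd_above_mono) auto
qed

lemma seminorm_upper:
  assumes "u \<in> CinfS3" "length is \<le> k" "x \<in> S3"
  shows "\<bar>pds is (radial u) x\<bar> \<le> seminorm_k k u"
  unfolding seminorm_k_def by (rule cSup_upper[OF _ bdd_seminorm[OF assms(1)]]) (use assms in auto)

lemma seminorm_le:
  assumes "\<And>is x. length is \<le> k \<Longrightarrow> x \<in> S3 \<Longrightarrow> \<bar>pds is (radial u) x\<bar> \<le> B"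
  shows "seminorm_k k u \<le> B"
  unfolding seminorm_k_def
proof (rule cSup_least)
  have "\<bar>pds [] (radial u) (T0par 0 0)\<bar> \<in> {\<bar>pds is (radial u) x\<bar> | is x. length is \<le> k \<and> x \<in> S3}"
    by (intro CollectI exI[of _ "[]"] exI[of _ "T0par 0 0"]) simp
  then show "{\<bar>pds is (radial u) x\<bar> | is x. length is \<le> k \<and> x \<in> S3} \<noteq> {}" by blast
qed (use assms in auto)

lemma seminorm_lincomb_le:
  assumes "u \<in> CinfS3" "v \<in> CinfS3"
  shows "seminorm_k k (\<lambda>x. a * u x + b * v x) \<le> \<bar>a\<bar> * seminorm_k k u + \<bar>b\<bar> * seminorm_k k v"
proof (rule seminorm_le)
  fix "is" :: "4 list" and x assume *: "length is \<le> k" "x \<in> S3"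
  have "pds is (radial (\<lambda>x. a * u x + b * v x)) x = a * pds is (radial u) x + b * pds is (radial v) x"
    unfolding radial_lincomb
    by (rule pds_lincomb[OF open_punctured]) (use assms * S3_punctured in \<open>auto intro: CinfS3_smooth\<close>)
  also have "\<bar>\<dots>\<bar> \<le> \<bar>a\<bar> * \<bar>pds is (radial u) x\<bar> + \<bar>b\<bar> * \<bar>pds is (radial v) x\<bar>"
    using abs_triangle_ineq by (metis abs_mult)
  also have "\<dots> \<le> \<bar>a\<bar> * seminorm_k k u + \<bar>b\<bar> * seminorm_k k v"
    by (intro add_mono mult_left_mono seminorm_upper assms *) auto
  finally show "\<bar>pds is (radial (\<lambda>x. a * u x + b * v x)) x\<bar> \<le> \<bar>a\<bar> * seminorm_k k u + \<bar>b\<bar> * seminorm_k k v" .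
qed

subsection \<open>Openness\<close>

text \<open>The closed ball provides the compactness behind openness; density will use radii for
  which the test functions keep independent gradients on the whole ball.\<close>

definition locally_morse :: "real^4^4 \<Rightarrow> real \<Rightarrow> (real^4 \<Rightarrow> real) set" where
  "locally_morse M r = {u \<in> CinfS3. \<forall>b\<in>cball 0 r.
     crit (radial u) (M ** cayB b) \<longrightarrow> nondeg (radial u) (M ** cayB b)}"

lemma continuous_on_hess:
  fixes Mf :: "'a::t2_space \<Rightarrow> real^4^4"
  assumes "smooth w" "continuous_on U Mf" "\<And>x. x \<in> U \<Longrightarrow> invertible (Mf x)"
    "continuous_on U Zf" "continuous_on U Xf"
  shows "continuous_on U (\<lambda>x. hess w (Mf x) (Zf x) (Xf x))"
  unfolding hess_def using assms
  by (intro continuous_on_add continuous_on_I1 continuous_on_I2 continuous_on_matrix_mult)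

text \<open>Orthogonal matrices map \<open>S3\<close> to itself, where the seminorm controls the
  derivatives, so \<open>C\<close> depends on \<open>R\<close> alone. Order 2 is what
  \<open>hess\<close> involves.\<close>

lemma derivative_bounds:
  "\<exists>C. \<forall>v M x c. v \<in> CinfS3 \<longrightarrow> orthogonal_matrix M \<longrightarrow> norm x \<le> R \<longrightarrow> norm c \<le> R \<longrightarrow>
     \<bar>I1 (radial v) M (M ** skewB c)\<bar> \<le> C * seminorm_k 2 v \<and>
     \<bar>hess (radial v) M (skewB x) (skewB c)\<bar> \<le> C * seminorm_k 2 v"
proof -
  obtain K1 where K1: "K1 > 0" "\<And>(A::real^4^4) (y::real^4). norm (A *v y) \<le> norm A * norm y * K1"
    using bounded_bilinear.pos_bounded[OF bounded_bilinear_matrix_vector_mult] by blast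
  obtain K2 where K2: "K2 > 0" "\<And>c. norm (skewB c) \<le> norm c * K2"
    using bounded_linear.pos_bounded[OF bounded_linear_skewB] by blast
  define K where "K = \<bar>R\<bar> * K2 * K1"
  have K: "norm (skewB c *v y) \<le> K * norm y" if "norm c \<le> R" for c y
  proof -
    have "norm (skewB c *v y) \<le> norm (skewB c) * norm y * K1" by (rule K1)
    also have "\<dots> \<le> (\<bar>R\<bar> * K2) * norm y * K1"
      using that K1(1) K2 by (intro mult_right_mono order_trans[OF K2(2)]) auto
    finally show ?thesis by (simp add: K_def mult_ac)
  qed
  have K0: "K \<ge> 0" using K1 K2 by (simp add: K_def)
  \<comment> \<open>The sum of the constants for \<open>I1\<close> and for the two parts of
    \<open>hess\<close>, so that a single \<open>C\<close> dominates both estimates.\<close>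
  define C where "C = 2 * pi^2 * (4 * K) + (2 * pi^2 * (16 * (K * K)) + 2 * pi^2 * (4 * (K * K)))"
  show ?thesis
  proof (intro exI[of _ C] allI impI)
    fix v and M :: "real^4^4" and x c :: "real^4" assume v: "v \<in> CinfS3" and M: "orthogonal_matrix M" and x: "norm x \<le> R" and c: "norm c \<le> R"
    let ?w = "radial v" and ?s = "seminorm_k 2 v"
    have w: "smooth ?w" by (rule CinfS3_smooth[OF v])
    have s1: "\<bar>pd i ?w y\<bar> \<le> ?s" and s2: "\<bar>pd j (pd i ?w) y\<bar> \<le> ?s" if "y \<in> S3" for i j y
      using seminorm_upper[OF v, of "[i]" 2 y] seminorm_upper[OF v, of "[j, i]" 2 y] that by simp_all
    have s0: "?s \<ge> 0" using s1[OF T0par_in_S3] order_trans[OF abs_ge_zero] by blast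
    have iso: "norm (M *v y) = norm y" for y
      using orthogonal_transformation_norm[of "(*v) M"] M by (simp add: orthogonal_transformation_matrix)
    have n1: "norm ((M ** skewB d) *v p) \<le> K" if "p \<in> S3" "norm d \<le> R" for p d
      using K[OF that(2), of p] that(1) by (simp add: matrix_vector_mul_assoc[symmetric] iso S3_def)
    have n2: "norm ((M ** skewB x ** skewB c) *v p) \<le> K * K" if "p \<in> S3" for p
    proof -
      have "norm ((M ** skewB x ** skewB c) *v p) \<le> K * norm (skewB c *v p)"
        using K[OF x] by (simp add: matrix_vector_mul_assoc[symmetric] iso)
      also have "\<dots> \<le> K * K" using K[OF c, of p] that K0 by (intro mult_left_mono) (auto simp: S3_def)
      finally show ?thesis .
    qed
    have b1: "\<bar>I1 ?w M (M ** skewB c)\<bar> \<le> 2 * pi^2 * (4 * (?s * K))"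
      by (rule I1_bound[OF w M]) (use s1 n1 c in auto)
    have b2: "\<bar>I1 ?w M (M ** skewB x ** skewB c)\<bar> \<le> 2 * pi^2 * (4 * (?s * (K * K)))"
      by (rule I1_bound[OF w M]) (use s1 n2 in auto)
    have b3: "\<bar>I2 ?w M (M ** skewB x) (M ** skewB c)\<bar> \<le> 2 * pi^2 * (16 * (?s * K * K))"
      by (rule I2_bound[OF w M]) (use s2 n1 x c in auto)
    have b4: "\<bar>hess ?w M (skewB x) (skewB c)\<bar> \<le> 2 * pi^2 * (16 * (?s * K * K)) + 2 * pi^2 * (4 * (?s * (K * K)))"
      using b2 b3 unfolding hess_def by linarith
    have C: "C * ?s = 2 * pi^2 * (4 * (?s * K)) + (2 * pi^2 * (16 * (?s * K * K)) + 2 * pi^2 * (4 * (?s * (K * K))))"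
      by (simp add: C_def algebra_simps)
    have p1: "0 \<le> 2 * pi^2 * (4 * (?s * K))" using s0 K0 by simp
    have p2: "0 \<le> 2 * pi^2 * (16 * (?s * K * K)) + 2 * pi^2 * (4 * (?s * (K * K)))" using s0 K0 by simp
    show "\<bar>I1 ?w M (M ** skewB c)\<bar> \<le> C * ?s \<and> \<bar>hess ?w M (skewB x) (skewB c)\<bar> \<le> C * ?s"
      unfolding C using b1 b4 p1 p2 by linarith
  qed
qed

lemma seminorm_nonneg: "u \<in> CinfS3 \<Longrightarrow> 0 \<le> seminorm_k k u"
  by (rule order_trans[OF abs_ge_zero seminorm_upper[of u "[]" k "T0par 0 0"]]) simp_all

lemma radial_diff: "radial (v - u) = (\<lambda>x. 1 * radial v x + (-1) * radial u x)"
  by (simp add: radial_def fun_eq_iff)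

lemma tendsto_of_bound:
  fixes f g :: "nat \<Rightarrow> real"
  assumes "f \<longlonglongrightarrow> l" "\<And>n. \<bar>g n - f n\<bar> \<le> C * e n" "e \<longlonglongrightarrow> 0"
  shows "g \<longlonglongrightarrow> l"
proof -
  have "(\<lambda>n. C * e n) \<longlonglongrightarrow> 0" using tendsto_mult_left[OF assms(3), of C] by simp
  then have "(\<lambda>n. g n - f n) \<longlonglongrightarrow> 0"
    by (rule Lim_null_comparison[rotated]) (use assms(2) in auto)
  from tendsto_add[OF this assms(1)] show ?thesis by simp
qed

text \<open>If no neighbourhood works, functions converging to \<open>u\<close> have degenerate
  critical points in the ball with unit kernel vectors. By compactness a subsequence of points and
  vectors converges, and the limit is a degenerate critical point of \<open>u\<close>.\<close>

lemma open_locally_morse: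
  assumes M: "orthogonal_matrix M"
  shows "openC (locally_morse M r)"
  unfolding openC_def
proof (intro conjI ballI)
  show "locally_morse M r \<subseteq> CinfS3" by (auto simp: locally_morse_def)
  fix u assume uW: "u \<in> locally_morse M r"
  then have u: "u \<in> CinfS3" by (simp add: locally_morse_def)
  let ?w = "radial u" and ?N = "\<lambda>b. M ** cayB b"
  have w: "smooth ?w" by (rule CinfS3_smooth[OF u])
  have oN: "orthogonal_matrix (?N b)" and iN: "invertible (?N b)" for b
    using orthogonal_mult_cayB[OF M] invertible_orthogonal by blast+
  show "\<exists>k \<epsilon>. \<epsilon> > 0 \<and> {v \<in> CinfS3. seminorm_k k (v - u) < \<epsilon>} \<subseteq> locally_morse M r"
  proof (rule ccontr)
    assume not: "\<not> ?thesis"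
    have "\<exists>v b x. v \<in> CinfS3 \<and> seminorm_k 2 (v - u) < inverse (Suc n) \<and> b \<in> cball 0 r \<and>
        norm x = 1 \<and> crit (radial v) (?N b) \<and> (\<forall>c. hess (radial v) (?N b) (skewB x) (skewB c) = 0)" for n
    proof -
      have "inverse (real (Suc n)) > 0" by simp
      with not obtain v where v: "v \<in> CinfS3" "seminorm_k 2 (v - u) < inverse (real (Suc n))" "v \<notin> locally_morse M r"
        by blast
      then obtain b where b: "b \<in> cball 0 r" "crit (radial v) (?N b)" "\<not> nondeg (radial v) (?N b)"
        by (auto simp: locally_morse_def)
      then obtain x where x: "x \<noteq> 0" "\<And>c. hess (radial v) (?N b) (skewB x) (skewB c) = 0"
        by (auto simp: nondeg_def)
      have "hess (radial v) (?N b) (skewB (x /\<^sub>R norm x)) (skewB c) = 0" for c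
        using linear_scale[OF linear_hess_skewB(1)[OF CinfS3_smooth[OF v(1)] iN]] x by simp
      then show ?thesis using v b x(1) by (intro exI[of _ v] exI[of _ b] exI[of _ "x /\<^sub>R norm x"]) auto
    qed
    then obtain v b x where v: "\<And>n. v n \<in> CinfS3" "\<And>n. seminorm_k 2 (v n - u) < inverse (Suc n)"
      and b: "\<And>n. b n \<in> cball 0 r" and x: "\<And>n. norm (x n) = 1"
      and cr: "\<And>n. crit (radial (v n)) (?N (b n))"
      and deg: "\<And>n c. hess (radial (v n)) (?N (b n)) (skewB (x n)) (skewB c) = 0"
      by metis
    have cpt: "compact (cball (0::real^4) r \<times> sphere (0::real^4) 1)" by (intro compact_Times) auto
    then obtain l h where l: "l \<in> cball (0::real^4) r \<times> sphere (0::real^4) 1" and h: "strict_mono (h :: nat \<Rightarrow> nat)"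
      and lim: "((\<lambda>n. (b n, x n)) \<circ> h) \<longlonglongrightarrow> l"
    proof -
      have "(b n, x n) \<in> cball 0 r \<times> sphere 0 1" for n using b x by simp
      then have "\<exists>l\<in>cball 0 r \<times> sphere 0 1. \<exists>h. strict_mono (h :: nat \<Rightarrow> nat) \<and> ((\<lambda>n. (b n, x n)) \<circ> h) \<longlonglongrightarrow> l"
        by (rule cpt[unfolded compact_def, rule_format])
      then show ?thesis using that by blast
    qed
    obtain b0 x0 where l_def: "l = (b0, x0)" by (cases l)
    have x0: "norm x0 = 1" and b0: "b0 \<in> cball 0 r" using l by (auto simp: l_def)
    \<comment> \<open>Bounds the second-order seminorm of \<open>v (h n) - u\<close>, and hence, up
      to a constant, the error of replacing \<open>v (h n)\<close> by \<open>u\<close> in both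
      variations.\<close>
    define e where "e n = inverse (real (Suc (h n)))" for n
    have e: "e \<longlonglongrightarrow> 0"
      using LIMSEQ_subseq_LIMSEQ[OF LIMSEQ_inverse_real_of_nat h] by (simp add: e_def[abs_def] o_def)
    have diff1: "\<exists>C. \<forall>n. \<bar>I1 (radial (v (h n))) (?N (b (h n))) (?N (b (h n)) ** skewB c)
          - I1 ?w (?N (b (h n))) (?N (b (h n)) ** skewB c)\<bar> \<le> C * e n
        \<and> \<bar>hess (radial (v (h n))) (?N (b (h n))) (skewB (x (h n))) (skewB c)
          - hess ?w (?N (b (h n))) (skewB (x (h n))) (skewB c)\<bar> \<le> C * e n" for c
    proof -
      \<comment> \<open>The radius \<open>max 1 (norm c)\<close> admits both the unit kernel vectors
        and the fixed test vector \<open>c\<close>.\<close>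
      obtain C where C: "\<And>v M x d. v \<in> CinfS3 \<Longrightarrow> orthogonal_matrix M \<Longrightarrow> norm x \<le> max 1 (norm c) \<Longrightarrow>
          norm d \<le> max 1 (norm c) \<Longrightarrow> \<bar>I1 (radial v) M (M ** skewB d)\<bar> \<le> C * seminorm_k 2 v \<and>
          \<bar>hess (radial v) M (skewB x) (skewB d)\<bar> \<le> C * seminorm_k 2 v"
        using derivative_bounds[of "max 1 (norm c)"] by blast
      show ?thesis
      proof (intro exI[of _ "\<bar>C\<bar>"] allI)
        fix n
        let ?v = "v (h n)" and ?M = "?N (b (h n))"
        have sv: "smooth (radial ?v)" by (rule CinfS3_smooth[OF v(1)])
        have "C * seminorm_k 2 (?v - u) \<le> \<bar>C\<bar> * \<bar>seminorm_k 2 (?v - u)\<bar>" by (metis abs_ge_self abs_mult)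
        also have "\<bar>seminorm_k 2 (?v - u)\<bar> = seminorm_k 2 (?v - u)"
          by (rule abs_of_nonneg[OF seminorm_nonneg[OF CinfS3_diff[OF v(1) u]]])
        also have "\<bar>C\<bar> * seminorm_k 2 (?v - u) \<le> \<bar>C\<bar> * e n"
          by (rule mult_left_mono) (use v(2)[of "h n"] in \<open>auto simp: e_def\<close>)
        finally have le: "C * seminorm_k 2 (?v - u) \<le> \<bar>C\<bar> * e n" .
        have "\<bar>I1 (radial (?v - u)) ?M (?M ** skewB c)\<bar> \<le> C * seminorm_k 2 (?v - u)"
          "\<bar>hess (radial (?v - u)) ?M (skewB (x (h n))) (skewB c)\<bar> \<le> C * seminorm_k 2 (?v - u)"
          using C[OF CinfS3_diff[OF v(1) u] oN, of "x (h n)" c] x by auto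
        then show "\<bar>I1 (radial ?v) ?M (?M ** skewB c) - I1 ?w ?M (?M ** skewB c)\<bar> \<le> \<bar>C\<bar> * e n
          \<and> \<bar>hess (radial ?v) ?M (skewB (x (h n))) (skewB c) - hess ?w ?M (skewB (x (h n))) (skewB c)\<bar> \<le> \<bar>C\<bar> * e n"
          using le unfolding radial_diff hess_def I1_lincomb_fun[OF sv w iN] I2_lincomb_fun[OF sv w iN]
          by (simp add: algebra_simps)
      qed
    qed
    have lim1: "(\<lambda>n. I1 ?w (?N (b (h n))) (?N (b (h n)) ** skewB c)) \<longlonglongrightarrow> I1 ?w (?N b0) (?N b0 ** skewB c)" for c
    proof -
      have "continuous_on UNIV (\<lambda>z::(real^4) \<times> (real^4). I1 ?w (?N (fst z)) (?N (fst z) ** skewB c))"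
        by (rule continuous_on_I1[OF w]) (auto intro!: continuous_intros iN)
      from continuous_on_tendsto_compose[OF this lim] show ?thesis by (simp add: l_def)
    qed
    have lim2: "(\<lambda>n. hess ?w (?N (b (h n))) (skewB (x (h n))) (skewB c)) \<longlonglongrightarrow> hess ?w (?N b0) (skewB x0) (skewB c)" for c
    proof -
      have "continuous_on UNIV (\<lambda>z::(real^4) \<times> (real^4). hess ?w (?N (fst z)) (skewB (snd z)) (skewB c))"
        by (rule continuous_on_hess[OF w]) (auto intro!: continuous_intros iN)
      from continuous_on_tendsto_compose[OF this lim] show ?thesis by (simp add: l_def)
    qed
    have "crit ?w (?N b0)"
      unfolding crit_def
    proof
      fix c
      obtain C where C: "\<And>n. \<bar>I1 (radial (v (h n))) (?N (b (h n))) (?N (b (h n)) ** skewB c)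
          - I1 ?w (?N (b (h n))) (?N (b (h n)) ** skewB c)\<bar> \<le> C * e n" using diff1[of c] by blast
      from tendsto_of_bound[OF lim1 C e] cr show "I1 ?w (?N b0) (?N b0 ** skewB c) = 0"
        by (simp add: crit_def LIMSEQ_const_iff)
    qed
    moreover have "hess ?w (?N b0) (skewB x0) (skewB c) = 0" for c
    proof -
      obtain C where C: "\<And>n. \<bar>hess (radial (v (h n))) (?N (b (h n))) (skewB (x (h n))) (skewB c)
          - hess ?w (?N (b (h n))) (skewB (x (h n))) (skewB c)\<bar> \<le> C * e n" using diff1[of c] by blast
      from tendsto_of_bound[OF lim2 C e] show ?thesis by (simp add: deg LIMSEQ_const_iff)
    qed
    moreover have "x0 \<noteq> 0" using x0 by auto
    ultimately show False using uW b0 unfolding locally_morse_def nondeg_def by blast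
  qed
qed

subsection \<open>Quartic test functions\<close>

lemma integral_0_2pi:
  fixes g :: "real \<Rightarrow> real"
  assumes "\<And>t. (G has_real_derivative g t) (at t)"
  shows "integral {0..2*pi} g = G (2*pi) - G 0"
  by (rule integral_unique, rule fundamental_theorem_of_calculus)
     (auto simp: has_real_derivative_iff_has_vector_derivative[symmetric] intro: assms has_field_derivative_at_within)

text \<open>The moments of order 2 and 4 that the quartics produce, each from an explicit
  antiderivative.\<close>

lemma cos_sin_integrals:
  "integral {0..2*pi} (\<lambda>t. cos t ^ 2) = pi"
  "integral {0..2*pi} (\<lambda>t. sin t ^ 2) = pi"
  "integral {0..2*pi} (\<lambda>t. cos t * sin t) = 0"
  "integral {0..2*pi} (\<lambda>t. cos t ^ 4) = 3 * pi / 4"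
  "integral {0..2*pi} (\<lambda>t. sin t ^ 4) = 3 * pi / 4"
  "integral {0..2*pi} (\<lambda>t. cos t ^ 3 * sin t) = 0"
  "integral {0..2*pi} (\<lambda>t. cos t * sin t ^ 3) = 0"
proof -
  have s2: "sin t ^ 2 = 1 - cos t ^ 2" for t :: real by (rule sin_squared_eq)
  have s4: "sin t ^ 4 = (1 - cos t ^ 2)^2" for t :: real
    using s2[of t] by (metis power4_eq_xxxx power2_eq_square mult.assoc)
  have "((\<lambda>t. (t + sin t * cos t) / 2) has_real_derivative cos t ^ 2) (at t)" for t
    by (rule derivative_eq_intros refl | simp)+ (simp add: s2 power2_eq_square[symmetric] field_simps)
  from integral_0_2pi[OF this] show "integral {0..2*pi} (\<lambda>t. cos t ^ 2) = pi" by simp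
  have "((\<lambda>t. (t - sin t * cos t) / 2) has_real_derivative sin t ^ 2) (at t)" for t
    by (rule derivative_eq_intros refl | simp)+ (simp add: s2 power2_eq_square[symmetric] field_simps)
  from integral_0_2pi[OF this] show "integral {0..2*pi} (\<lambda>t. sin t ^ 2) = pi" by simp
  have "((\<lambda>t. sin t ^ 2 / 2) has_real_derivative cos t * sin t) (at t)" for t
    by (rule derivative_eq_intros refl | simp)+
  from integral_0_2pi[OF this] show "integral {0..2*pi} (\<lambda>t. cos t * sin t) = 0" by simp
  have "((\<lambda>t. 3 * t / 8 + 3 * (sin t * cos t) / 8 + cos t ^ 3 * sin t / 4) has_real_derivative cos t ^ 4) (at t)" for t
    by (rule derivative_eq_intros refl | simp)+ (use s2[of t] in \<open>simp add: field_simps; algebra\<close>)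
  from integral_0_2pi[OF this] show "integral {0..2*pi} (\<lambda>t. cos t ^ 4) = 3 * pi / 4" by simp
  have "((\<lambda>t. 3 * t / 8 - 3 * (sin t * cos t) / 8 - sin t ^ 3 * cos t / 4) has_real_derivative sin t ^ 4) (at t)" for t
    by (rule derivative_eq_intros refl | simp)+ (use s2[of t] in \<open>simp add: field_simps; algebra\<close>)
  from integral_0_2pi[OF this] show "integral {0..2*pi} (\<lambda>t. sin t ^ 4) = 3 * pi / 4" by simp
  have "((\<lambda>t. - (cos t ^ 4) / 4) has_real_derivative cos t ^ 3 * sin t) (at t)" for t
    by (rule derivative_eq_intros refl | simp)+
  from integral_0_2pi[OF this] show "integral {0..2*pi} (\<lambda>t. cos t ^ 3 * sin t) = 0" by simp
  have "((\<lambda>t. sin t ^ 4 / 4) has_real_derivative cos t * sin t ^ 3) (at t)" for t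
    by (rule derivative_eq_intros refl | simp)+
  from integral_0_2pi[OF this] show "integral {0..2*pi} (\<lambda>t. cos t * sin t ^ 3) = 0" by simp
qed

lemma tor_product:
  assumes "\<And>\<theta> \<phi>. F (T0par \<theta> \<phi>) = c * (f \<theta> * g \<phi>)"
  shows "tor F = c / 2 * (integral {0..2*pi} f * integral {0..2*pi} g)"
  unfolding tor_def assms by (simp add: mult_ac)

text \<open>Degree 4 is the lowest that works. Odd polynomials integrate to zero because the tori
  are symmetric under the antipodal map, and a quadratic form has the same integral over every
  Clifford torus because the second moment matrix of a torus is a multiple of the identity.\<close>

definition quartic :: "4 \<Rightarrow> 4 \<Rightarrow> real^4 \<Rightarrow> real" where
  "quartic k l y = (y $ k) ^ 3 * y $ l"

definition dquartic :: "4 \<Rightarrow> 4 \<Rightarrow> real^4 \<Rightarrow> real^4 \<Rightarrow> real" where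
  "dquartic k l p h = 3 * (p $ k)^2 * p $ l * h $ k + (p $ k)^3 * h $ l"

text \<open>\<open>row_of i\<close> and \<open>col_of i\<close> locate the entry of
  \<open>skewB b\<close> above the diagonal that equals \<open>b $ i\<close>; each tangent direction
  thereby gets its own quartic.\<close>

definition row_of :: "4 \<Rightarrow> 4" where "row_of i = (if i = 1 \<or> i = 2 then 1 else 2)"
definition col_of :: "4 \<Rightarrow> 4" where "col_of i = (if i = 1 \<or> i = 3 then 3 else 4)"

text \<open>Differentiating the cubed coordinate gives \<open>3 * pi^2 / 8\<close>, differentiating
  the other one gives \<open>- 3 * pi^2 / 16\<close>, and all mixed moments vanish. What survives is
  a nonzero multiple of the matching coordinate of \<open>c\<close>.\<close>

lemma tor_dquartic: "tor (\<lambda>p. dquartic (row_of i) (col_of i) p (skewB c *v p)) = 3 * pi^2 / 16 * c $ i"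
proof -
  have sq: "sqrt 2 * sqrt 2 = (2::real)" "(sqrt 2)^2 = (2::real)" "(sqrt 2)^4 = (4::real)" "(sqrt 2)^3 = 2 * sqrt (2::real)"
    by (simp_all add: power4_eq_xxxx power3_eq_cube)
  have t: "tor (\<lambda>p. a * F p + (b * G p + (d * H p + e * K p))) = a * tor F + (b * tor G + (d * tor H + e * tor K))"
    if "continuous_on S3 F" "continuous_on S3 G" "continuous_on S3 H" "continuous_on S3 K"
    for a b d e :: real and F G H K
    using that by (simp add: tor_add tor_cmult continuous_on_add continuous_on_mult)
  have c22: "tor (\<lambda>p. (p $ k)^2 * (p $ l)^2) = pi^2/8" if "k = 1 \<or> k = 2" "l = 3 \<or> l = 4" for k l :: 4
    using that
    by (elim disjE; simp add: tor_product[of "\<lambda>p. (p $ 1)^2 * (p $ 3)^2" "1/4" "\<lambda>t. cos t^2" "\<lambda>t. cos t^2"]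
      tor_product[of "\<lambda>p. (p $ 1)^2 * (p $ 4)^2" "1/4" "\<lambda>t. cos t^2" "\<lambda>t. sin t^2"]
      tor_product[of "\<lambda>p. (p $ 2)^2 * (p $ 3)^2" "1/4" "\<lambda>t. sin t^2" "\<lambda>t. cos t^2"]
      tor_product[of "\<lambda>p. (p $ 2)^2 * (p $ 4)^2" "1/4" "\<lambda>t. sin t^2" "\<lambda>t. sin t^2"]
      cos_sin_integrals power_divide) (simp_all add: power2_eq_square)
  have c2m: "tor (\<lambda>p. (p $ k)^2 * (p $ 3 * p $ 4)) = 0" if "k = 1 \<or> k = 2" for k :: 4
    using that
    by (elim disjE; simp add: tor_product[of "\<lambda>p. (p $ 1)^2 * (p $ 3 * p $ 4)" "1/4" "\<lambda>t. cos t^2" "\<lambda>t. cos t * sin t"]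
      tor_product[of "\<lambda>p. (p $ 2)^2 * (p $ 3 * p $ 4)" "1/4" "\<lambda>t. sin t^2" "\<lambda>t. cos t * sin t"]
      cos_sin_integrals power_divide)
  have c4: "tor (\<lambda>p. (p $ k)^4) = 3 * pi^2/16" if "k = 1 \<or> k = 2" for k :: 4
    using that
    by (elim disjE; simp add: tor_product[of "\<lambda>p. (p $ 1)^4" "1/4" "\<lambda>t. cos t^4" "\<lambda>t. 1"]
      tor_product[of "\<lambda>p. (p $ 2)^4" "1/4" "\<lambda>t. sin t^4" "\<lambda>t. 1"]
      cos_sin_integrals power_divide sq power2_eq_square)
  have c31: "tor (\<lambda>p. (p $ 1)^3 * p $ 2) = 0" "tor (\<lambda>p. p $ 1 * (p $ 2)^3) = 0"
    by (simp_all add: tor_product[of "\<lambda>p. (p $ 1)^3 * p $ 2" "1/4" "\<lambda>t. cos t^3 * sin t" "\<lambda>t. 1"]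
      tor_product[of "\<lambda>p. p $ 1 * (p $ 2)^3" "1/4" "\<lambda>t. cos t * sin t^3" "\<lambda>t. 1"]
      cos_sin_integrals power_divide sq)
  have X: "(skewB c *v p) $ 1 = c $ 1 * p $ 3 + c $ 2 * p $ 4" "(skewB c *v p) $ 2 = c $ 3 * p $ 3 + c $ 4 * p $ 4"
    "(skewB c *v p) $ 3 = - (c $ 1 * p $ 1) - c $ 3 * p $ 2" "(skewB c *v p) $ 4 = - (c $ 2 * p $ 1) - c $ 4 * p $ 2" for p
    by (simp_all add: matrix_vector_mult_def sum_4 skewB_def)
  have i1: "(\<lambda>p. dquartic 1 3 p (skewB c *v p)) = (\<lambda>p. (3 * c $ 1) * ((p $ 1)^2 * (p $ 3)^2) + ((3 * c $ 2) * ((p $ 1)^2 * (p $ 3 * p $ 4))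
     + ((- c $ 1) * (p $ 1)^4 + (- c $ 3) * ((p $ 1)^3 * p $ 2))))"
    unfolding dquartic_def X by (rule ext) algebra
  have i2: "(\<lambda>p. dquartic 1 4 p (skewB c *v p)) = (\<lambda>p. (3 * c $ 2) * ((p $ 1)^2 * (p $ 4)^2) + ((3 * c $ 1) * ((p $ 1)^2 * (p $ 3 * p $ 4))
     + ((- c $ 2) * (p $ 1)^4 + (- c $ 4) * ((p $ 1)^3 * p $ 2))))"
    unfolding dquartic_def X by (rule ext) algebra
  have i3: "(\<lambda>p. dquartic 2 3 p (skewB c *v p)) = (\<lambda>p. (3 * c $ 3) * ((p $ 2)^2 * (p $ 3)^2) + ((3 * c $ 4) * ((p $ 2)^2 * (p $ 3 * p $ 4))
     + ((- c $ 3) * (p $ 2)^4 + (- c $ 1) * (p $ 1 * (p $ 2)^3))))"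
    unfolding dquartic_def X by (rule ext) algebra
  have i4: "(\<lambda>p. dquartic 2 4 p (skewB c *v p)) = (\<lambda>p. (3 * c $ 4) * ((p $ 2)^2 * (p $ 4)^2) + ((3 * c $ 3) * ((p $ 2)^2 * (p $ 3 * p $ 4))
     + ((- c $ 4) * (p $ 2)^4 + (- c $ 2) * (p $ 1 * (p $ 2)^3))))"
    unfolding dquartic_def X by (rule ext) algebra
  note cs = c22 c2m c4 c31
  have "tor (\<lambda>p. dquartic 1 3 p (skewB c *v p)) = 3 * pi^2 / 16 * c $ 1"
    unfolding i1 by (subst t) (simp_all add: cs continuous_intros)
  moreover have "tor (\<lambda>p. dquartic 1 4 p (skewB c *v p)) = 3 * pi^2 / 16 * c $ 2"
    unfolding i2 by (subst t) (simp_all add: cs continuous_intros)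
  moreover have "tor (\<lambda>p. dquartic 2 3 p (skewB c *v p)) = 3 * pi^2 / 16 * c $ 3"
    unfolding i3 by (subst t) (simp_all add: cs continuous_intros)
  moreover have "tor (\<lambda>p. dquartic 2 4 p (skewB c *v p)) = 3 * pi^2 / 16 * c $ 4"
    unfolding i4 by (subst t) (simp_all add: cs continuous_intros)
  ultimately have "\<forall>i. tor (\<lambda>p. dquartic (row_of i) (col_of i) p (skewB c *v p)) = 3 * pi^2 / 16 * c $ i"
    unfolding forall_4 by (simp add: row_of_def col_of_def)
  then show ?thesis by blast
qed

text \<open>Composition with \<open>transpose M\<close> centres the quartic at the torus of
  \<open>M\<close>; the value 0 off the sphere is the convention of \<open>CinfS3\<close>.\<close>

definition testfun :: "real^4^4 \<Rightarrow> 4 \<Rightarrow> real^4 \<Rightarrow> real" where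
  "testfun M i x = (if x \<in> S3 then quartic (row_of i) (col_of i) (transpose M *v x) else 0)"

text \<open>Homogeneity of degree 4 turns the normalisation into division by the square of
  \<open>x \<bullet> x\<close>, with no square root, so the radial extension is rational. At 0 both
  sides are 0.\<close>

lemma radial_testfun:
  "radial (testfun M i) = (\<lambda>x. quartic (row_of i) (col_of i) (transpose M *v x) * (inverse (x \<bullet> x))^2)"
proof
  fix x :: "real^4"
  show "radial (testfun M i) x = quartic (row_of i) (col_of i) (transpose M *v x) * (inverse (x \<bullet> x))^2"
  proof (cases "x = 0")
    case True
    then show ?thesis by (simp add: radial_def testfun_def S3_def)
  next
    case False
    then have n: "norm x \<noteq> 0" by simp
    have "x \<bullet> x = norm x ^ 2" by (simp add: power2_norm_eq_inner)
    then show ?thesis using n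
      by (simp add: radial_def testfun_def S3_def quartic_def matrix_vector_mult_bilinear field_simps power2_eq_square power3_eq_cube del: transpose_matrix_vector)
  qed
qed

lemma testfun_CinfS3: "testfun M i \<in> CinfS3"
proof -
  have "(\<lambda>x. (transpose M *v x) $ k) \<in> rational_fns" for k
    unfolding matrix_vector_mul_component by (rule rational_linear)
  then have "(\<lambda>x. ((transpose M *v x) $ k * ((transpose M *v x) $ k * (transpose M *v x) $ k) * (transpose M *v x) $ l)
      * (inverse (x \<bullet> x) * inverse (x \<bullet> x))) \<in> rational_fns" for k l
    by (intro rational_fns.intros)
  then have "radial (testfun M i) \<in> rational_fns"
    unfolding radial_testfun quartic_def power3_eq_cube power2_eq_square by (simp add: mult.assoc)
  then show ?thesis by (simp add: CinfS3_def rational_fns_smooth testfun_def)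
qed

text \<open>A skew matrix moves \<open>p\<close> orthogonally to itself, so the squared norm along
  the line is \<open>1 + t^2 * (h \<bullet> h)\<close> with \<open>h = skewB c *v p\<close>. Its
  derivative at 0 vanishes, and the denominator of the radial extension contributes nothing.\<close>

lemma dw_testfun:
  assumes M: "orthogonal_matrix M" and p: "p \<in> S3"
  shows "dw (radial (testfun M i)) (M *v p) (M *v (skewB c *v p)) = dquartic (row_of i) (col_of i) p (skewB c *v p)"
proof -
  let ?h = "skewB c *v p" and ?k = "row_of i" and ?l = "col_of i"
  have pp: "p \<bullet> p = 1" using p by (simp add: S3_def norm_eq_1)
  have ph: "p \<bullet> ?h = 0" by (rule skew_dot) simp
  have "((\<lambda>t. radial (testfun M i) (M *v p + t *\<^sub>R (M *v ?h))) has_real_derivative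
      dw (radial (testfun M i)) (M *v p + 0 *\<^sub>R (M *v ?h)) (M *v ?h)) (at 0)"
    by (rule smooth_chain[OF CinfS3_smooth[OF testfun_CinfS3]])
       (use invertible_mult_nonzero[OF invertible_orthogonal[OF M] p] in \<open>auto intro!: derivative_eq_intros\<close>)
  moreover have "((\<lambda>t. radial (testfun M i) (M *v p + t *\<^sub>R (M *v ?h))) has_real_derivative dquartic ?k ?l p ?h) (at 0)"
  proof -
    have lin: "M *v p + t *\<^sub>R (M *v ?h) = M *v (p + t *\<^sub>R ?h)" for t by (simp add: matrix_vector_mult_bilinear)
    have MM: "transpose M *v (M *v y) = y" for y
      using M by (simp add: matrix_vector_mul_assoc orthogonal_matrix_def del: transpose_matrix_vector)
    have "(M *v y) \<bullet> (M *v y) = y \<bullet> y" for y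
      using M orthogonal_transformation_matrix[of "(*v) M"] by (simp add: orthogonal_transformation_def)
    then have norm: "(M *v (p + t *\<^sub>R ?h)) \<bullet> (M *v (p + t *\<^sub>R ?h)) = 1 + t^2 * (?h \<bullet> ?h)" for t
      by (simp add: inner_add_left inner_add_right pp ph inner_commute[of ?h p] power2_eq_square)
    have "((\<lambda>t. ((p $ ?k + t * ?h $ ?k)^3 * (p $ ?l + t * ?h $ ?l)) * (inverse (1 + t^2 * (?h \<bullet> ?h)))^2)
        has_real_derivative dquartic ?k ?l p ?h) (at 0)"
      by (rule derivative_eq_intros refl | simp)+ (simp add: dquartic_def mult_ac)
    then show ?thesis
      unfolding lin radial_testfun MM norm by (simp add: quartic_def)
  qed
  ultimately show ?thesis using DERIV_unique by fastforce
qed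

lemma I1_testfun:
  assumes M: "orthogonal_matrix M"
  shows "I1 (radial (testfun M i)) M (M ** skewB c) = 3 * pi^2 / 16 * c $ i"
  unfolding I1_def tor_dquartic[symmetric]
  by (rule tor_cong) (simp add: dw_testfun[OF M, symmetric] matrix_vector_mul_assoc)

subsection \<open>Density\<close>

text \<open>A product rule for a factor that is merely continuous: near \<open>x\<close> the vector
  \<open>G y\<close> is of first order in \<open>y - x\<close>, so its product with
  \<open>Q y - Q x\<close> is of smaller order.\<close>

lemma has_derivative_matrix_mult_zero:
  fixes Q :: "real^4 \<Rightarrow> real^4^4" and G :: "real^4 \<Rightarrow> real^4"
  assumes Q: "continuous (at x within S) Q" and G: "(G has_derivative D) (at x within S)" and G0: "G x = 0"
  shows "((\<lambda>y. Q y *v G y) has_derivative (\<lambda>h. Q x *v D h)) (at x within S)"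
proof -
  obtain K where K: "K > 0" "\<And>(A::real^4^4) (y::real^4). norm (A *v y) \<le> norm A * norm y * K"
    using bounded_bilinear.pos_bounded[OF bounded_bilinear_matrix_vector_mult] by blast
  have D: "bounded_linear D" using G by (rule has_derivative_bounded_linear)
  then obtain B where B: "B > 0" "\<And>h. norm (D h) \<le> norm h * B" using bounded_linear.pos_bounded by blast
  have "((\<lambda>y. (Q y - Q x) *v G y) has_derivative (\<lambda>h. 0)) (at x within S)"
    unfolding has_derivative_within_alt
  proof (intro conjI allI impI)
    fix e :: real assume e: "0 < e"
    obtain d1 where d1: "d1 > 0" "\<And>y. y \<in> S \<Longrightarrow> norm (y - x) < d1 \<Longrightarrow> norm (G y - G x - D (y - x)) \<le> 1 * norm (y - x)"
      using G unfolding has_derivative_within_alt by (metis zero_less_one)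
    \<comment> \<open>\<open>1 + B\<close> bounds \<open>norm (G y)\<close> relative to
      \<open>norm (y - x)\<close>, with the 1 coming from the remainder of \<open>G\<close>, and
      \<open>K\<close> bounds matrix-vector multiplication.\<close>
    define e' where "e' = e / ((1 + B) * K)"
    have "e' > 0" using e B K by (simp add: e'_def)
    then obtain d2 where d2: "d2 > 0" "\<And>y. y \<in> S \<Longrightarrow> dist y x < d2 \<Longrightarrow> dist (Q y) (Q x) < e'"
      using Q unfolding continuous_within_eps_delta by metis
    show "\<exists>d>0. \<forall>y\<in>S. norm (y - x) < d \<longrightarrow>
        norm ((Q y - Q x) *v G y - (Q x - Q x) *v G x - 0) \<le> e * norm (y - x)"
    proof (intro exI[of _ "min d1 d2"] conjI ballI impI)
      fix y assume y: "y \<in> S" "norm (y - x) < min d1 d2"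
      have "norm (G y) \<le> norm (G y - G x - D (y - x)) + norm (D (y - x))"
        using norm_triangle_ineq[of "G y - D (y - x)" "D (y - x)"] G0 by simp
      also have "\<dots> \<le> 1 * norm (y - x) + norm (y - x) * B"
        using d1(2)[OF y(1)] y(2) B(2)[of "y - x"] by (intro add_mono) auto
      finally have Gy: "norm (G y) \<le> (1 + B) * norm (y - x)" by (simp add: algebra_simps)
      have "norm ((Q y - Q x) *v G y) \<le> norm (Q y - Q x) * norm (G y) * K" by (rule K)
      also have "\<dots> \<le> e' * ((1 + B) * norm (y - x)) * K"
        using d2(2)[OF y(1)] y(2) Gy K B e e'_def \<open>e' > 0\<close>
        by (intro mult_right_mono mult_mono) (auto simp: dist_norm)
      also have "\<dots> = (e' * ((1 + B) * K)) * norm (y - x)" by (simp only: mult_ac)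
      also have "e' * ((1 + B) * K) = e" using B K by (simp add: e'_def)
      finally show "norm ((Q y - Q x) *v G y - (Q x - Q x) *v G x - 0) \<le> e * norm (y - x)" by simp
    qed (use d1 d2 in auto)
  qed simp
  moreover have "((\<lambda>y. Q x *v G y) has_derivative (\<lambda>h. Q x *v D h)) (at x within S)"
    by (rule bounded_linear.has_derivative[OF _ G]) simp
  ultimately have "((\<lambda>y. Q x *v G y + (Q y - Q x) *v G y) has_derivative (\<lambda>h. Q x *v D h + 0)) (at x within S)"
    by (rule has_derivative_add[rotated])
  then show ?thesis by (simp add: matrix_vector_mult_bilinear)
qed

text \<open>By \<open>cayB_res\<close> the chart velocity is \<open>cayB b\<close> times a skew
  matrix, so the derivative of the left-invariant gradient becomes a \<open>hess\<close> at the
  moved point itself.\<close>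

lemma I1_gradient_derivative:
  assumes w: "smooth w" and M: "orthogonal_matrix M"
  shows "((\<lambda>b. I1 w (M ** cayB b) (M ** cayB b ** X)) has_derivative
    (\<lambda>h. \<Sum>k\<in>UNIV. hess w (M ** cayB b) (2 *\<^sub>R (transpose (resB b) ** skewB (ax k) ** resB b)) X * h $ k)) (at b)"
proof (rule has_derivative_of_partials[where U = UNIV and
    D = "\<lambda>k b. hess w (M ** cayB b) (2 *\<^sub>R (transpose (resB b) ** skewB (ax k) ** resB b)) X"])
  have iN: "invertible (M ** cayB b)" for b
    using orthogonal_mult_cayB[OF M] invertible_orthogonal by blast
  fix k
  show "continuous_on UNIV (\<lambda>b. hess w (M ** cayB b) (2 *\<^sub>R (transpose (resB b) ** skewB (ax k) ** resB b)) X)"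
    by (intro continuous_on_hess w continuous_intros iN)
  fix b
  define Z where "Z t = 2 *\<^sub>R (resB (b + t *\<^sub>R ax k) ** skewB (ax k) ** resB (b + t *\<^sub>R ax k))" for t
  have CZ: "cayB b ** (2 *\<^sub>R (transpose (resB b) ** skewB (ax k) ** resB b)) = Z 0"
    by (simp add: Z_def matrix_mult_bilinear matrix_mul_assoc cayB_res)
  have "((\<lambda>t. I1 w (M ** cayB (b + t *\<^sub>R ax k)) (M ** cayB (b + t *\<^sub>R ax k) ** X)) has_real_derivative
    I2 w (M ** cayB (b + 0 *\<^sub>R ax k)) (M ** Z 0) (M ** cayB (b + 0 *\<^sub>R ax k) ** X)
     + I1 w (M ** cayB (b + 0 *\<^sub>R ax k)) (M ** Z 0 ** X)) (at 0)"
    unfolding Z_def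
    by (rule I1_derivative[OF w])
      (intro has_vector_derivative_matrix_mult_left has_vector_derivative_matrix_mult_right
        has_vector_derivative_cayB continuous_intros iN)+
  then show "((\<lambda>t. I1 w (M ** cayB (b + t *\<^sub>R ax k)) (M ** cayB (b + t *\<^sub>R ax k) ** X)) has_real_derivative
     hess w (M ** cayB b) (2 *\<^sub>R (transpose (resB b) ** skewB (ax k) ** resB b)) X) (at 0)"
    unfolding hess_def matrix_mul_assoc[symmetric] CZ by (simp add: CZ[symmetric] matrix_mul_assoc)
qed auto

lemma skew_conjugate: "transpose (2 *\<^sub>R (transpose R ** skewB c ** R)) = - (2 *\<^sub>R (transpose R ** skewB c ** R))"
  by (simp add: transpose_scalar matrix_transpose_mul matrix_mult_bilinear matrix_mul_assoc)

text \<open>\<open>transpose (resB b) ** skewB (ax k) ** resB b\<close> is skew but may have a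
  block-diagonal part. Criticality kills that part, and the tangent part vanishes by symmetry and
  degeneracy.\<close>

lemma hess_degenerate:
  assumes w: "smooth w" and M: "invertible M" and cr: "crit w M"
    and x: "\<And>c. hess w M (skewB x) (skewB c) = 0" and Z: "transpose Z = - Z"
  shows "hess w M Z (skewB x) = 0"
proof -
  obtain b a d where Zd: "Z = skewB b + blk a d" using skew_decompose[OF Z] by blast
  show ?thesis
    unfolding Zd linear_add[OF hess_linear_left[OF w M]] hess_blk_left[OF w M cr] hess_skewB_commute[OF w M, of b] x
    by simp
qed

lemma smooth_perturb:
  assumes "finite J" "smooth w" "\<And>j. smooth (f j)"
  shows "smooth (\<lambda>x. w x + (\<Sum>j\<in>J. l j * f j x))"
    "invertible M \<Longrightarrow> I1 (\<lambda>x. w x + (\<Sum>j\<in>J. l j * f j x)) M N = I1 w M N + (\<Sum>j\<in>J. l j * I1 (f j) M N)"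
proof -
  have "smooth (\<lambda>x. w x + (\<Sum>j\<in>J. l j * f j x)) \<and>
    (invertible M \<longrightarrow> I1 (\<lambda>x. w x + (\<Sum>j\<in>J. l j * f j x)) M N = I1 w M N + (\<Sum>j\<in>J. l j * I1 (f j) M N))"
    using assms(1)
  proof (induction J rule: finite_induct)
    case empty
    then show ?case using assms(2) by simp
  next
    case (insert j J)
    have eq: "(\<lambda>x. w x + (\<Sum>j\<in>insert j J. l j * f j x)) = (\<lambda>x. 1 * (w x + (\<Sum>j\<in>J. l j * f j x)) + l j * f j x)"
      using insert.hyps by (simp add: fun_eq_iff)
    show ?case
      unfolding eq using insert smooth_on_lincomb[OF open_punctured, of "\<lambda>x. w x + (\<Sum>j\<in>J. l j * f j x)" "f j" 1 "l j"]
        I1_lincomb_fun[of "\<lambda>x. w x + (\<Sum>j\<in>J. l j * f j x)" "f j" M 1 "l j" N] assms(3)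
      by simp
  qed
  then show "smooth (\<lambda>x. w x + (\<Sum>j\<in>J. l j * f j x))"
    "invertible M \<Longrightarrow> I1 (\<lambda>x. w x + (\<Sum>j\<in>J. l j * f j x)) M N = I1 w M N + (\<Sum>j\<in>J. l j * I1 (f j) M N)"
    by auto
qed

lemma CinfS3_perturb:
  assumes "finite J" "\<And>j. q j \<in> CinfS3"
  shows "(\<lambda>x. \<Sum>j\<in>J. l j * q j x) \<in> CinfS3 \<and>
    seminorm_k k (\<lambda>x. \<Sum>j\<in>J. l j * q j x) \<le> (\<Sum>j\<in>J. \<bar>l j\<bar> * seminorm_k k (q j))"
  using assms(1)
proof (induction J rule: finite_induct)
  case empty
  \<comment> \<open>The zero function arises as a combination with zero coefficients;
    \<open>q undefined\<close> merely names some member of the family.\<close>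
  show ?case
    using CinfS3_lincomb[OF assms(2) assms(2), of 0 undefined 0 undefined] seminorm_lincomb_le[OF assms(2) assms(2), of k 0 undefined 0 undefined] by simp
next
  case (insert j J)
  have eq: "(\<lambda>x. \<Sum>j\<in>insert j J. l j * q j x) = (\<lambda>x. l j * q j x + 1 * (\<Sum>j\<in>J. l j * q j x))"
    using insert.hyps by (simp add: fun_eq_iff)
  have "seminorm_k k (\<lambda>x. l j * q j x + 1 * (\<Sum>j\<in>J. l j * q j x)) \<le> \<bar>l j\<bar> * seminorm_k k (q j) + \<bar>1\<bar> * seminorm_k k (\<lambda>x. (\<Sum>j\<in>J. l j * q j x))"
    by (rule seminorm_lincomb_le) (use insert assms(2) in auto)
  then show ?case unfolding eq using insert CinfS3_lincomb[OF assms(2)[of j], of "\<lambda>x. \<Sum>j\<in>J. l j * q j x" "l j" 1] by simp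
qed

text \<open>The derivative of the gradient at \<open>b\<close> with respect to the parameters:
  column \<open>j\<close> is the gradient of the \<open>j\<close>-th test function. At
  \<open>b = 0\<close> it is a nonzero multiple of the identity, by
  \<open>I1_testfun\<close>.\<close>

definition testmat :: "real^4^4 \<Rightarrow> real^4 \<Rightarrow> real^4^4" where
  "testmat M b = (\<chi> i j. I1 (radial (testfun M j)) (M ** cayB b) (M ** cayB b ** skewB (ax i)))"

lemma continuous_on_testmat:
  assumes M: "orthogonal_matrix M"
  shows "continuous_on S (testmat M)"
  unfolding testmat_def
  by (intro continuous_on_vec_lambda continuous_on_I1 CinfS3_smooth testfun_CinfS3 continuous_intros
      invertible_orthogonal orthogonal_mult_cayB M)

lemma testmat_invertible_near_0:
  assumes M: "orthogonal_matrix M"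
  shows "\<exists>r>0. \<forall>b\<in>cball 0 r. invertible (testmat M b)"
proof -
  have "testmat M 0 = (3 * pi^2 / 16) *\<^sub>R mat 1"
  proof -
    have "testmat M 0 $ i $ j = 3 * pi^2 / 16 * ax i $ j" for i j
      by (simp add: testmat_def I1_testfun[OF M])
    then show ?thesis by (simp add: vec_eq_iff mat_def axis_def)
  qed
  then have "invertible (testmat M 0)"
    unfolding invertible_def
    by (intro exI[of _ "(16 / (3 * pi^2)) *\<^sub>R mat 1"]) (simp add: matrix_mult_bilinear)
  then have "det (testmat M 0) \<noteq> 0" by (simp add: invertible_det_nz)
  moreover have "continuous_on UNIV (\<lambda>b. det (testmat M b))"
    by (intro continuous_intros continuous_on_testmat M)
  ultimately have "open ((\<lambda>b. det (testmat M b)) -` (-{0}))" "0 \<in> (\<lambda>b. det (testmat M b)) -` (-{0})"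
    by (auto intro!: open_vimage)
  then obtain r where "r > 0" "cball 0 r \<subseteq> (\<lambda>b. det (testmat M b)) -` (-{0})"
    unfolding open_contains_cball by blast
  then show ?thesis by (auto simp: invertible_det_nz)
qed

text \<open>The bad parameters form the image of the singular points of the map \<open>L\<close>. With \<open>w\<close> the function
  perturbed by \<open>L b\<close>, \<open>L y - L b\<close> is \<open>- Q y\<close> applied to the gradient of \<open>w\<close> at \<open>y\<close>; as this gradient
  vanishes at \<open>b\<close>, only continuity of \<open>Q\<close> is needed to differentiate \<open>L\<close> at \<open>b\<close>.\<close>
lemma bad_parameters_negligible:
  assumes M: "orthogonal_matrix M" and u: "u \<in> CinfS3"
    and inv: "\<And>b. b \<in> cball 0 r \<Longrightarrow> invertible (testmat M b)"
  shows "negligible {l. \<exists>b\<in>cball 0 r.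
    crit (\<lambda>x. radial u x + (\<Sum>j\<in>UNIV. l $ j * radial (testfun M j) x)) (M ** cayB b) \<and>
    \<not> nondeg (\<lambda>x. radial u x + (\<Sum>j\<in>UNIV. l $ j * radial (testfun M j) x)) (M ** cayB b)}"
proof -
  define W where "W l = (\<lambda>x. radial u x + (\<Sum>j\<in>UNIV. l $ j * radial (testfun M j) x))" for l :: "real^4"
  define N where "N b = M ** cayB b" for b
  define grad where "grad w b = (\<chi> i. I1 w (N b) (N b ** skewB (ax i)))" for w b
  define Q where "Q b = matrix_inv (testmat M b)" for b
  define L where "L b = - (Q b *v grad (radial u) b)" for b
  define S where "S = {b \<in> cball 0 r. crit (W (L b)) (N b) \<and> \<not> nondeg (W (L b)) (N b)}"
  have iN: "invertible (N b)" for b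
    unfolding N_def using orthogonal_mult_cayB[OF M] invertible_orthogonal by blast
  have W: "smooth (W l)" for l
    unfolding W_def by (intro smooth_perturb CinfS3_smooth testfun_CinfS3 u) simp
  have gradW: "grad (W l) b = grad (radial u) b + testmat M b *v l" for l b
    unfolding W_def grad_def vec_eq_iff
    using smooth_perturb(2)[where J = UNIV and f = "\<lambda>j. radial (testfun M j)" and l = "($) l",
        OF _ CinfS3_smooth[OF u] CinfS3_smooth[OF testfun_CinfS3] iN]
    by (simp add: testmat_def N_def matrix_vector_mult_def mult.commute)
  have crit_grad: "grad w b = 0" if "crit w (N b)" for w b
    using that by (simp add: grad_def crit_def vec_eq_iff)
  \<comment> \<open>Valid for every \<open>l\<close>: it shows that \<open>l = L b\<close> whenever
    \<open>b\<close> is critical for \<open>W l\<close>, and with \<open>l\<close> frozen at the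
    value of \<open>L\<close> at a point it exhibits \<open>L\<close> near that point as a constant
    minus a matrix times a vanishing gradient.\<close>
  have L: "L b = l - Q b *v grad (W l) b" if "b \<in> cball 0 r" for b l
    using matrix_inv_invertible(2)[OF inv[OF that]]
    by (simp add: L_def gradW matrix_vector_mult_bilinear matrix_vector_mul_assoc Q_def)
  have "\<exists>L'. (L has_derivative L') (at b within S) \<and> rank (matrix L') < CARD(4)" if b: "b \<in> S" for b
  proof -
    let ?w = "W (L b)"
    have cr: "crit ?w (N b)" and b_ball: "b \<in> cball 0 r" using b by (auto simp: S_def)
    obtain x where x: "x \<noteq> 0" "\<And>c. hess ?w (N b) (skewB x) (skewB c) = 0"
      using b by (auto simp: S_def nondeg_def)
    \<comment> \<open>The Jacobian of the gradient at \<open>b\<close>. The row index sits in the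
      second argument of \<open>hess\<close>, the column index in the first.\<close>
    define A :: "real^4^4" where "A = (\<chi> i k. hess ?w (N b) (2 *\<^sub>R (transpose (resB b) ** skewB (ax k) ** resB b)) (skewB (ax i)))"
    have "((\<lambda>b. grad ?w b $ i) has_derivative (\<lambda>h. (A *v h) $ i)) (at b)" for i
      using I1_gradient_derivative[OF W M, of "L b" "skewB (ax i)" b]
      by (simp add: grad_def A_def matrix_vector_mult_def N_def)
    then have "(grad ?w has_derivative (*v) A) (at b)"
      unfolding has_derivative_componentwise_within[of "grad ?w"] Basis_vec_def
      by (auto simp: inner_axis)
    then have G: "(grad ?w has_derivative (*v) A) (at b within S)" by (rule has_derivative_at_withinI)
    have "continuous_on (cball 0 r) Q"
      unfolding Q_def by (intro continuous_intros continuous_on_testmat M inv)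
    then have "continuous_on S Q" by (rule continuous_on_subset) (auto simp: S_def)
    then have Q: "continuous (at b within S) Q" using b by (simp add: continuous_on_eq_continuous_within)
    have "((\<lambda>y. L b - Q y *v grad ?w y) has_derivative (\<lambda>h. 0 - Q b *v (A *v h))) (at b within S)"
      by (intro has_derivative_diff has_derivative_const has_derivative_matrix_mult_zero Q G crit_grad cr)
    \<comment> \<open>The formula for \<open>L\<close> holds on \<open>S\<close>, which lies in the
      ball where \<open>Q\<close> inverts \<open>testmat\<close>; a derivative within
      \<open>S\<close> is all that Sard's theorem takes.\<close>
    then have "(L has_derivative (\<lambda>h. 0 - Q b *v (A *v h))) (at b within S)"
      by (rule has_derivative_transform[OF b, rotated]) (use L in \<open>auto simp: S_def\<close>)
    moreover have "(\<lambda>h. 0 - Q b *v (A *v h)) = (*v) (- Q b ** A)"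
      by (simp add: fun_eq_iff matrix_vector_mult_bilinear matrix_mult_bilinear matrix_vector_mul_assoc)
    ultimately have der: "(L has_derivative (*v) (- Q b ** A)) (at b within S)" by simp
    \<comment> \<open>The kernel vector \<open>x\<close> combines the rows of \<open>A\<close>,
      which places it in the second argument of \<open>hess\<close>, where
      \<open>hess_degenerate\<close> applies to any skew first argument.\<close>
    have "transpose A *v x = 0"
    proof -
      have "(transpose A *v x) $ k = hess ?w (N b) (2 *\<^sub>R (transpose (resB b) ** skewB (ax k) ** resB b)) (skewB x)" for k
        unfolding linear_expand_axis[OF linear_hess_skewB(2)[OF W iN], of _ _ _ x]
        by (simp add: matrix_vector_mult_def transpose_def A_def mult.commute del: transpose_matrix_vector)
      then show ?thesis
        using hess_degenerate[OF W iN cr x(2) skew_conjugate] by (simp add: vec_eq_iff)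
    qed
    then have "\<not> invertible (transpose A)"
      using x(1) by (metis invertible_left_inverse matrix_left_invertible_ker)
    then have "det A = 0" by (simp add: invertible_det_nz)
    then have "det (- Q b ** A) = 0" by (simp add: det_mul)
    then have "rank (matrix ((*v) (- Q b ** A))) < CARD(4)"
      using det_eq_0_rank[of "- Q b ** A"] by (simp add: matrix_of_matrix_vector_mul)
    with der show ?thesis by blast
  qed
  then obtain L' where "\<And>b. b \<in> S \<Longrightarrow> (L has_derivative L' b) (at b within S)"
    "\<And>b. b \<in> S \<Longrightarrow> rank (matrix (L' b)) < CARD(4)" by metis
  then have "negligible (L ` S)" by (intro baby_Sard) auto
  moreover have "{l. \<exists>b\<in>cball 0 r. crit (W l) (N b) \<and> \<not> nondeg (W l) (N b)} \<subseteq> L ` S"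
  proof safe
    fix l b assume b: "b \<in> cball 0 r" "crit (W l) (N b)" "\<not> nondeg (W l) (N b)"
    have "L b = l" using L[OF b(1), of l] crit_grad[OF b(2)] by simp
    with b show "l \<in> L ` S" unfolding S_def by (intro image_eqI[of _ _ b]) auto
  qed
  ultimately show ?thesis unfolding W_def N_def by (rule negligible_subset)
qed

lemma dense_locally_morse:
  assumes M: "orthogonal_matrix M"
    and inv: "\<And>b. b \<in> cball 0 r \<Longrightarrow> invertible (testmat M b)"
  shows "denseC (locally_morse M r)"
  unfolding denseC_def
proof (intro ballI allI impI)
  fix u k and \<epsilon> :: real assume u: "u \<in> CinfS3" and e: "\<epsilon> > 0"
  define q where "q = testfun M"
  have q: "q j \<in> CinfS3" for j by (simp add: q_def testfun_CinfS3)
  define K where "K = (\<Sum>j\<in>UNIV. seminorm_k k (q j))"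
  have K: "K \<ge> 0" unfolding K_def by (intro sum_nonneg seminorm_nonneg q)
  define B where "B = {l::real^4. \<exists>b\<in>cball 0 r.
    crit (\<lambda>x. radial u x + (\<Sum>j\<in>UNIV. l $ j * radial (q j) x)) (M ** cayB b) \<and>
    \<not> nondeg (\<lambda>x. radial u x + (\<Sum>j\<in>UNIV. l $ j * radial (q j) x)) (M ** cayB b)}"
  have "negligible B" unfolding B_def q_def by (rule bad_parameters_negligible[OF M u inv])
  \<comment> \<open>Parameters in this ball change the function by at most \<open>norm l * K\<close>
    in the seminorm, hence by less than \<open>\<epsilon>\<close>; \<open>K + 1\<close> avoids
    division by zero. A ball is not negligible, so it contains a good parameter.\<close>
  moreover have "\<not> negligible (ball (0::real^4) (\<epsilon> / (K + 1)))"
    using divide_pos_pos[OF e, of "K + 1"] K by (intro open_not_negligible) auto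
  ultimately obtain l where l: "norm l < \<epsilon> / (K + 1)" "l \<notin> B"
    by (metis mem_ball_0 negligible_subset subsetI)
  define p where "p = (\<lambda>x. \<Sum>j\<in>UNIV. l $ j * q j x)"
  have p: "p \<in> CinfS3" "seminorm_k k p \<le> (\<Sum>j\<in>UNIV. \<bar>l $ j\<bar> * seminorm_k k (q j))"
    unfolding p_def using CinfS3_perturb[of UNIV q "($) l" k] q by simp_all
  define v where "v = (\<lambda>x. 1 * u x + 1 * p x)"
  have v: "v \<in> CinfS3" unfolding v_def by (rule CinfS3_lincomb[OF u p(1)])
  have "radial v = (\<lambda>x. radial u x + (\<Sum>j\<in>UNIV. l $ j * radial (q j) x))"
    by (simp add: radial_def v_def p_def fun_eq_iff)
  then have "v \<in> locally_morse M r"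
    using v l(2) unfolding locally_morse_def B_def by auto
  moreover have "v - u = p" by (simp add: v_def fun_eq_iff)
  moreover have "seminorm_k k p < \<epsilon>"
  proof -
    have "(\<Sum>j\<in>UNIV. \<bar>l $ j\<bar> * seminorm_k k (q j)) \<le> (\<Sum>j\<in>UNIV. norm l * seminorm_k k (q j))"
      by (intro sum_mono mult_right_mono component_le_norm_cart seminorm_nonneg q)
    also have "\<dots> = norm l * K" by (simp add: K_def sum_distrib_left)
    also have "\<dots> \<le> norm l * (K + 1)" by (simp add: mult_left_mono)
    also have "\<dots> < \<epsilon>" using l(1) K by (simp add: field_simps)
    finally show ?thesis using p(2) by linarith
  qed
  ultimately show "\<exists>v\<in>locally_morse M r. seminorm_k k (v - u) < \<epsilon>" by metis
qed

subsection \<open>Covering the orthogonal group by charts\<close>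

text \<open>\<open>(cos s, sin s)\<close> is the unit vector in the direction of
  \<open>(a, b)\<close>. It maximises the linear form, and the equation is the first-order
  condition.\<close>

lemma maximal_rotation: "\<exists>s. a \<le> a * cos s + b * sin s \<and> b * cos s = a * sin s" for a b :: real
proof (cases "a = 0 \<and> b = 0")
  case False
  define \<rho> where "\<rho> = sqrt (a^2 + b^2)"
  have pos: "a^2 + b^2 > 0" using False by (simp add: sum_power2_gt_zero_iff)
  then have \<rho>: "\<rho> > 0" "\<rho>^2 = a^2 + b^2" by (simp_all add: \<rho>_def)
  have "(a / \<rho>)^2 + (b / \<rho>)^2 = 1"
    using \<rho>(1) by (simp add: power_divide add_divide_distrib[symmetric] \<rho>(2)[symmetric])
  then obtain s where s: "a / \<rho> = cos s" "b / \<rho> = sin s" using sincos_total_2pi by metis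
  have "a * cos s + b * sin s = (a^2 + b^2) / \<rho>"
    unfolding s[symmetric] by (simp add: power2_eq_square add_divide_distrib)
  also have "\<dots> = \<rho>" unfolding \<rho>(2)[symmetric] using \<rho>(1) by (simp add: power2_eq_square)
  also have "\<rho> \<ge> a" unfolding \<rho>_def by (rule real_le_rsqrt) simp
  finally have "a \<le> a * cos s + b * sin s" .
  moreover have "b * cos s = a * sin s" unfolding s[symmetric] by simp
  ultimately show ?thesis by blast
qed auto

text \<open>Both \<open>Q\<close> and the identity have squared norm 4, so a larger trace means a
  smaller distance to the identity.\<close>

lemma norm_orthogonal_minus_one:
  fixes Q :: "real^4^4"
  assumes "orthogonal_matrix Q"
  shows "(norm (Q - mat 1))^2 = 8 - 2 * (Q $ 1 $ 1 + Q $ 2 $ 2 + Q $ 3 $ 3 + Q $ 4 $ 4)"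
proof -
  have "transpose Q ** Q = mat 1" using assms by (simp add: orthogonal_matrix)
  then have "(transpose Q ** Q) $ i $ i = 1" for i by (simp add: mat_def)
  from this[of 1] this[of 2] this[of 3] this[of 4]
  have "(\<Sum>i\<in>UNIV. \<Sum>j\<in>UNIV. (Q $ i $ j)^2) = 4"
    by (simp add: matrix_matrix_mult_def transpose_def sum_4 power2_eq_square)
  moreover have "(norm (Q - mat 1))^2 = (\<Sum>i\<in>UNIV. \<Sum>j\<in>UNIV. ((Q - mat 1) $ i $ j)^2)"
    unfolding power2_norm_eq_inner inner_vec_def by (simp add: power2_eq_square)
  ultimately show ?thesis
    by (simp add: sum_4 mat_def power2_eq_square algebra_simps)
qed

text \<open>Maximising the trace of \<open>N ** rot s t\<close> over \<open>s\<close> and \<open>t\<close> makes its diagonal blocks symmetric.\<close>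
lemma align_blocks:
  fixes N :: "real^4^4"
  assumes N: "orthogonal_matrix N"
  shows "\<exists>s t. norm (N ** rot s t - mat 1) \<le> norm (N - mat 1) \<and>
    (N ** rot s t) $ 1 $ 2 = (N ** rot s t) $ 2 $ 1 \<and> (N ** rot s t) $ 3 $ 4 = (N ** rot s t) $ 4 $ 3"
proof -
  \<comment> \<open>After rotation by \<open>s\<close> the upper block has trace
    \<open>a * cos s + b * sin s\<close> with these \<open>a\<close> and \<open>b\<close>, and the
    first-order condition is precisely its symmetry.\<close>
  obtain s where s: "N$1$1 + N$2$2 \<le> (N$1$1 + N$2$2) * cos s + (N$1$2 - N$2$1) * sin s"
    "(N$1$2 - N$2$1) * cos s = (N$1$1 + N$2$2) * sin s" using maximal_rotation by metis
  obtain t where t: "N$3$3 + N$4$4 \<le> (N$3$3 + N$4$4) * cos t + (N$3$4 - N$4$3) * sin t"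
    "(N$3$4 - N$4$3) * cos t = (N$3$3 + N$4$4) * sin t" using maximal_rotation by metis
  let ?Q = "N ** rot s t"
  have Q: "?Q $ i $ 1 = N$i$1 * cos s + N$i$2 * sin s" "?Q $ i $ 2 = - N$i$1 * sin s + N$i$2 * cos s"
    "?Q $ i $ 3 = N$i$3 * cos t + N$i$4 * sin t" "?Q $ i $ 4 = - N$i$3 * sin t + N$i$4 * cos t" for i
    by (simp_all add: matrix_matrix_mult_def sum_4 rot_def)
  have "?Q$1$1 + ?Q$2$2 + ?Q$3$3 + ?Q$4$4 \<ge> N$1$1 + N$2$2 + N$3$3 + N$4$4"
    using s(1) t(1) unfolding Q by (simp add: algebra_simps)
  then have "(norm (?Q - mat 1))^2 \<le> (norm (N - mat 1))^2"
    unfolding norm_orthogonal_minus_one[OF N] norm_orthogonal_minus_one[OF orthogonal_matrix_mul[OF N orthogonal_rot]]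
    by simp
  then have "norm (?Q - mat 1) \<le> norm (N - mat 1)" by (simp add: power2_le_iff_abs_le)
  moreover have "?Q $ 1 $ 2 = ?Q $ 2 $ 1" "?Q $ 3 $ 4 = ?Q $ 4 $ 3"
    using s(2) t(2) unfolding Q by (simp_all add: algebra_simps)
  ultimately show ?thesis by blast
qed

text \<open>The involution of the symmetric space: conjugation by it fixes block-diagonal matrices
  and negates every \<open>skewB b\<close>.\<close>

definition block_sign :: "real^4^4" where
  "block_sign = (\<chi> i j. if i = j then (if i = 1 \<or> i = 2 then 1 else -1) else 0)"

lemma block_sign_block_sign: "block_sign ** block_sign = mat 1"
  unfolding vec_eq_iff forall_4 by (simp add: matrix_matrix_mult_def sum_4 block_sign_def mat_def)

text \<open>\<open>Q ** block_sign\<close> is orthogonal, so it commutes with its antisymmetric part; that part anticommutes with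
  \<open>block_sign\<close>, which is close to \<open>Q ** block_sign\<close>, and hence vanishes.\<close>
lemma reflected_transpose:
  shows "\<exists>\<delta>>0. \<forall>Q. orthogonal_matrix Q \<longrightarrow> norm (Q - mat 1) < \<delta> \<longrightarrow> Q $ 1 $ 2 = Q $ 2 $ 1 \<longrightarrow>
    Q $ 3 $ 4 = Q $ 4 $ 3 \<longrightarrow> block_sign ** Q ** block_sign = transpose Q"
proof -
  obtain K where K: "K > 0" "\<And>(A::real^4^4) (B::real^4^4). norm (A ** B) \<le> norm A * norm B * K"
    using bounded_bilinear.pos_bounded[OF bounded_bilinear_matrix_mult] by blast
  define d where "d = norm block_sign"
  \<comment> \<open>Chosen so that the final estimate reads \<open>norm F \<le> norm F * q\<close>
    with \<open>q < 1\<close>: two factors \<open>d\<close> from \<open>block_sign\<close> and three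
    factors \<open>K\<close> from matrix products.\<close>
  define \<delta> where "\<delta> = inverse (d * K * (d * K * K) + 1)"
  have d: "d \<ge> 0" by (simp add: d_def)
  have den: "d * K * (d * K * K) + 1 > 0" using d K(1) by (intro add_nonneg_pos) auto
  show ?thesis
  proof (intro exI[of _ \<delta>] conjI allI impI)
    show "\<delta> > 0" using den by (simp add: \<delta>_def)
    fix Q :: "real^4^4" assume Q: "orthogonal_matrix Q" and near: "norm (Q - mat 1) < \<delta>"
      and sym: "Q $ 1 $ 2 = Q $ 2 $ 1" "Q $ 3 $ 4 = Q $ 4 $ 3"
    have QQ: "transpose Q ** Q = mat 1" "Q ** transpose Q = mat 1" using Q by (simp_all add: orthogonal_matrix_def)
    define F where "F = Q ** block_sign - block_sign ** transpose Q"
    define G where "G = (Q - mat 1) ** block_sign"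
    have 1: "Q ** block_sign ** block_sign ** transpose Q = mat 1"
      by (simp add: matrix_mul_assoc[symmetric] block_sign_block_sign) (simp add: matrix_mul_assoc block_sign_block_sign QQ)
    have 2: "block_sign ** transpose Q ** Q ** block_sign = mat 1"
      by (simp add: matrix_mul_assoc[of _ _ Q, symmetric] QQ block_sign_block_sign)
    have comm: "(Q ** block_sign) ** F = F ** (Q ** block_sign)"
      unfolding F_def matrix_mult_bilinear by (simp add: matrix_mul_assoc 1 2)
    \<comment> \<open>Symmetry of the diagonal blocks of \<open>Q\<close> makes the diagonal blocks
      of \<open>F\<close> vanish, and off-diagonal blocks anticommute with
      \<open>block_sign\<close>.\<close>
    have anti: "block_sign ** F = - (F ** block_sign)"
      unfolding vec_eq_iff forall_4 F_def using sym
      by (simp add: matrix_matrix_mult_def transpose_def sum_4 block_sign_def)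
    \<comment> \<open>\<open>F\<close> commutes with
      \<open>Q ** block_sign = block_sign + G\<close>, so its commutator with
      \<open>block_sign\<close> is controlled by \<open>G\<close>; anticommutation makes that
      commutator a multiple of \<open>block_sign ** F\<close>.\<close>
    have "2 *\<^sub>R (block_sign ** F) = F ** G - G ** F"
      using comm anti by (simp add: G_def matrix_mult_bilinear scaleR_2 algebra_simps)
    then have "2 *\<^sub>R F = block_sign ** (F ** G - G ** F)"
      by (metis bounded_bilinear.scaleR_right[OF bounded_bilinear_matrix_mult] matrix_mul_assoc matrix_mul_lid block_sign_block_sign)
    then have "2 * norm F = norm (block_sign ** (F ** G - G ** F))" by (metis abs_numeral norm_scaleR)
    also have "\<dots> \<le> d * norm (F ** G - G ** F) * K" unfolding d_def by (rule K)
    also have "\<dots> \<le> d * (norm F * norm G * K + norm G * norm F * K) * K"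
    proof -
      have "norm (F ** G - G ** F) \<le> norm F * norm G * K + norm G * norm F * K"
        using K(2)[of F G] K(2)[of G F] norm_triangle_ineq4[of "F ** G" "G ** F"] by linarith
      then show ?thesis using d K(1) by (intro mult_right_mono mult_left_mono) auto
    qed
    also have "\<dots> = 2 * (norm F * (d * K * (norm G * K)))" by (simp add: algebra_simps)
    also have "\<dots> \<le> 2 * (norm F * (d * K * ((\<delta> * d * K) * K)))"
    proof -
      have "norm G \<le> norm (Q - mat 1) * d * K" unfolding G_def d_def by (rule K)
      also have "\<dots> \<le> \<delta> * d * K" using near d K(1) by (intro mult_right_mono) auto
      finally show ?thesis using d K(1) by (intro mult_left_mono mult_right_mono) auto
    qed
    also have "\<dots> = 2 * (norm F * (\<delta> * (d * K * (d * K * K))))" by (simp add: algebra_simps)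
    finally have le: "norm F \<le> norm F * (\<delta> * (d * K * (d * K * K)))" by simp
    have "\<delta> * (d * K * (d * K * K)) < 1" using den by (simp add: \<delta>_def field_simps)
    then have "F = 0"
      using le by (smt (verit) mult_less_cancel_left2 norm_le_zero_iff)
    then have "Q ** block_sign = block_sign ** transpose Q" by (simp add: F_def)
    then show "block_sign ** Q ** block_sign = transpose Q"
      by (metis matrix_mul_assoc matrix_mul_lid block_sign_block_sign)
  qed
qed

section \<open>Inverting the Cayley transform near the identity\<close>

lemma skewB_of_anticommuting:
  assumes "transpose A = - A" "block_sign ** A ** block_sign = - A"
  shows "\<exists>b. A = skewB b"
proof
  have A: "A $ i $ j = - A $ j $ i" for i j
  proof -
    have "transpose A $ j $ i = (- A) $ j $ i" unfolding assms ..
    then show ?thesis by (simp add: transpose_def)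
  qed
  have D: "(block_sign ** A ** block_sign) $ i $ j = - A $ i $ j" for i j unfolding assms by simp
  show "A = skewB (vector [A $ 1 $ 3, A $ 1 $ 4, A $ 2 $ 3, A $ 2 $ 4])"
    unfolding vec_eq_iff forall_4
    using D[of 1 1] D[of 1 2] D[of 2 1] D[of 2 2] D[of 3 3] D[of 3 4] D[of 4 3] D[of 4 4]
      A[of 3 1] A[of 4 1] A[of 3 2] A[of 4 2]
    by (simp add: skewB_def vector_def matrix_matrix_mult_def sum_4 block_sign_def)
qed

text \<open>Orthogonality of \<open>Q\<close> makes the inverse Cayley transform skew, and the
  symmetry under \<open>block_sign\<close> places it among the \<open>skewB b\<close>. The second
  equation is kept because it bounds \<open>b\<close> by the distance of \<open>Q\<close> from the
  identity.\<close>

lemma inverse_cayley: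
  assumes Q: "orthogonal_matrix Q" and D: "block_sign ** Q ** block_sign = transpose Q" and inv: "invertible (Q + mat 1)"
  shows "\<exists>b. cayB b = Q \<and> 2 *\<^sub>R skewB b = (Q - mat 1) ** (mat 1 - skewB b)"
proof -
  define T where "T = matrix_inv (Q + mat 1)"
  have T: "(Q + mat 1) ** T = mat 1" "T ** (Q + mat 1) = mat 1"
    unfolding T_def by (simp_all add: matrix_inv_invertible inv)
  have QQ: "transpose Q ** Q = mat 1" using Q by (simp_all add: orthogonal_matrix_def)
  \<comment> \<open>With \<open>T\<close> the inverse of \<open>Q + mat 1\<close>, this is (Q - 1)(Q
    + 1)^-1.\<close>
  define A where "A = mat 1 - 2 *\<^sub>R T"
  have TT: "transpose T ** (transpose Q + mat 1) = mat 1" "(transpose Q + mat 1) ** transpose T = mat 1"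
    using arg_cong[OF T(1), of transpose] arg_cong[OF T(2), of transpose]
    by (simp_all add: matrix_transpose_mul transpose_linear)
  have uniq: "X = transpose T" if "X ** (transpose Q + mat 1) = mat 1" for X
    by (metis TT(2) matrix_mul_assoc matrix_mul_lid matrix_mul_rid that)
  have "T ** Q ** (transpose Q + mat 1) = T ** (Q + mat 1)"
    using Q by (simp add: matrix_mult_bilinear matrix_mul_assoc[symmetric] orthogonal_matrix_def add.commute)
  then have "T ** Q = transpose T" using T(2) by (intro uniq) simp
  then have "T + transpose T = mat 1" using T(2) by (simp add: matrix_mult_bilinear add.commute)
  then have tT: "transpose T = mat 1 - T" by (simp add: eq_diff_eq add.commute)
  then have skew: "transpose A = - A"
    unfolding A_def transpose_linear transpose_scalar transpose_mat tT scaleR_diff_right scaleR_2[of "mat 1"] by simp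
  have "block_sign ** T ** block_sign = transpose T"
  proof (rule uniq)
    have "transpose Q + mat 1 = block_sign ** (Q + mat 1) ** block_sign" by (simp add: D[symmetric] matrix_mult_bilinear block_sign_block_sign)
    then have "block_sign ** T ** block_sign ** (transpose Q + mat 1) = block_sign ** (T ** ((block_sign ** block_sign) ** (Q + mat 1))) ** block_sign"
      by (simp only: matrix_mul_assoc)
    also have "\<dots> = mat 1" by (simp add: block_sign_block_sign T)
    finally show "block_sign ** T ** block_sign ** (transpose Q + mat 1) = mat 1" .
  qed
  then have "block_sign ** A ** block_sign = transpose A"
    by (simp add: A_def matrix_mult_bilinear block_sign_block_sign transpose_linear transpose_scalar)
  then obtain b where b: "A = skewB b" using skewB_of_anticommuting[OF skew] skew by auto
  have "resB b = ((1/2) *\<^sub>R (Q + mat 1))"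
  proof -
    have "(mat 1 - skewB b) ** ((1/2) *\<^sub>R (Q + mat 1)) = mat 1"
    proof -
      have eq: "mat 1 - skewB b = 2 *\<^sub>R T" unfolding b[symmetric] A_def by simp
      show ?thesis unfolding eq matrix_mult_bilinear(7,8) T(2) by simp
    qed
    then have "resB b = resB b ** ((mat 1 - skewB b) ** ((1/2) *\<^sub>R (Q + mat 1)))" by simp
    also have "\<dots> = (1/2) *\<^sub>R (Q + mat 1)"
      unfolding matrix_mul_assoc resB_inv by simp
    finally show ?thesis .
  qed
  then have "cayB b = Q" by (simp add: cayB_alt)
  moreover have "2 *\<^sub>R skewB b = (Q - mat 1) ** (mat 1 - skewB b)"
  proof -
    have "(Q - mat 1) ** (2 *\<^sub>R T) = (Q + mat 1) ** (2 *\<^sub>R T) - (2 *\<^sub>R T + 2 *\<^sub>R T)"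
      by (simp add: matrix_mult_bilinear scaleR_diff_right scaleR_add_right)
    also have "(Q + mat 1) ** (2 *\<^sub>R T) = 2 *\<^sub>R mat 1" unfolding matrix_mult_bilinear(8) T(1) ..
    also have "2 *\<^sub>R mat 1 - (2 *\<^sub>R T + 2 *\<^sub>R T) = 2 *\<^sub>R A"
      unfolding A_def scaleR_diff_right scaleR_2[of "2 *\<^sub>R T"] ..
    also have "2 *\<^sub>R T = mat 1 - A" by (simp add: A_def)
    finally show ?thesis unfolding b by simp
  qed
  ultimately show ?thesis by blast
qed

lemma norm_le_skewB: "norm b \<le> norm (skewB b)"
proof -
  have "(norm b)^2 \<le> (norm (skewB b))^2"
    unfolding power2_norm_eq_inner inner_vec_def by (simp add: sum_4 skewB_def)
  then show ?thesis by (simp add: power2_le_iff_abs_le)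
qed

text \<open>The orthogonal group has dimension 6 and the chart only 4; multiplication by
  \<open>rot s t\<close> supplies the two stabiliser dimensions and brings \<open>N\<close> into the
  image of the chart.\<close>

lemma chart_covers_neighbourhood:
  assumes r: "r > 0"
  shows "\<exists>\<delta>>0. \<forall>N. orthogonal_matrix N \<longrightarrow> norm (N - mat 1) < \<delta> \<longrightarrow>
     (\<exists>s t. \<exists>b\<in>cball 0 r. N ** rot s t = cayB b)"
proof -
  obtain K where K: "K > 0" "\<And>(A::real^4^4) (B::real^4^4). norm (A ** B) \<le> norm A * norm B * K"
    using bounded_bilinear.pos_bounded[OF bounded_bilinear_matrix_mult] by blast
  obtain K1 where K1: "K1 > 0" "\<And>(A::real^4^4) (y::real^4). norm (A *v y) \<le> norm A * norm y * K1"
    using bounded_bilinear.pos_bounded[OF bounded_bilinear_matrix_vector_mult] by blast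
  obtain \<delta>0 where \<delta>0: "\<delta>0 > 0" "\<And>Q. orthogonal_matrix Q \<Longrightarrow> norm (Q - mat 1) < \<delta>0 \<Longrightarrow> Q $ 1 $ 2 = Q $ 2 $ 1 \<Longrightarrow>
    Q $ 3 $ 4 = Q $ 4 $ 3 \<Longrightarrow> block_sign ** Q ** block_sign = transpose Q" using reflected_transpose by blast
  define c where "c = norm (mat 1 :: real^4^4)"
  have c: "c \<ge> 0" by (simp add: c_def)
  \<comment> \<open>In turn: symmetry under \<open>block_sign\<close>, invertibility of
    \<open>Q + mat 1\<close>, and two bounds that keep \<open>b\<close> within radius
    \<open>r\<close>.\<close>
  define \<delta> where "\<delta> = min (min \<delta>0 (1 / K1)) (min (1 / K) (r / (K * (c + 1))))"
  show ?thesis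
  proof (rule exI[of _ \<delta>], intro conjI allI impI)
    show "\<delta> > 0" using \<delta>0 K K1 r c by (simp add: \<delta>_def)
    fix N :: "real^4^4" assume N: "orthogonal_matrix N" and near: "norm (N - mat 1) < \<delta>"
    obtain s t where st: "norm (N ** rot s t - mat 1) \<le> norm (N - mat 1)"
      "(N ** rot s t) $ 1 $ 2 = (N ** rot s t) $ 2 $ 1" "(N ** rot s t) $ 3 $ 4 = (N ** rot s t) $ 4 $ 3"
      using align_blocks[OF N] by blast
    define Q where "Q = N ** rot s t"
    have Q: "orthogonal_matrix Q" unfolding Q_def by (rule orthogonal_matrix_mul[OF N orthogonal_rot])
    have Q\<delta>: "norm (Q - mat 1) < \<delta>" using st(1) near by (simp add: Q_def)
    have D: "block_sign ** Q ** block_sign = transpose Q"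
      by (rule \<delta>0(2)[OF Q]) (use Q\<delta> st in \<open>auto simp: \<delta>_def Q_def\<close>)
    have inv: "invertible (Q + mat 1)"
    proof -
      have "x = 0" if x: "(Q + mat 1) *v x = 0" for x
      proof (rule ccontr)
        assume "x \<noteq> 0"
        have "(Q - mat 1) *v x = (Q + mat 1) *v x - 2 *\<^sub>R x" by (simp add: matrix_vector_mult_bilinear scaleR_2)
        then have "norm ((Q - mat 1) *v x) = 2 * norm x" using x by simp
        then have "2 * norm x \<le> norm (Q - mat 1) * norm x * K1" using K1(2)[of "Q - mat 1" x] by simp
        also have "\<dots> = norm x * (norm (Q - mat 1) * K1)" by (simp add: mult_ac)
        also have "\<dots> \<le> norm x * 1"
        proof (rule mult_left_mono)
          have "norm (Q - mat 1) \<le> 1 / K1" using Q\<delta> by (simp add: \<delta>_def)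
          then show "norm (Q - mat 1) * K1 \<le> 1" using K1(1) by (simp add: field_simps)
        qed simp
        finally show False using \<open>x \<noteq> 0\<close> by simp
      qed
      then show ?thesis by (metis invertible_left_inverse matrix_left_invertible_ker)
    qed
    obtain b where b: "cayB b = Q" "2 *\<^sub>R skewB b = (Q - mat 1) ** (mat 1 - skewB b)"
      using inverse_cayley[OF Q D inv] by blast
    let ?a = "norm (skewB b)" and ?q = "norm (Q - mat 1) * K"
    have "2 * ?a = norm ((Q - mat 1) ** (mat 1 - skewB b))" unfolding b(2)[symmetric] by simp
    also have "\<dots> \<le> norm (Q - mat 1) * norm (mat 1 - skewB b) * K" by (rule K)
    also have "\<dots> = ?q * norm (mat 1 - skewB b)" by (simp add: mult_ac)
    also have "\<dots> \<le> ?q * (c + ?a)"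
      unfolding c_def using K(1) by (intro mult_left_mono norm_triangle_ineq4) auto
    \<comment> \<open>With \<open>?q \<le> 1\<close> the last summand is absorbed on the left,
      leaving \<open>?a \<le> ?q * c\<close>, which is at most \<open>r\<close>.\<close>
    finally have le: "2 * ?a \<le> ?q * c + ?q * ?a" by (simp add: algebra_simps)
    have "norm (Q - mat 1) \<le> 1 / K" "norm (Q - mat 1) \<le> r / (K * (c + 1))"
      using Q\<delta> by (simp_all add: \<delta>_def)
    then have q1: "?q \<le> 1" and qr: "?q * (c + 1) \<le> r"
      using K(1) c by (simp_all add: pos_le_divide_eq mult_ac)
    have "?q * ?a \<le> 1 * ?a" by (rule mult_right_mono[OF q1]) simp
    moreover have "?q * c \<le> ?q * (c + 1)" using K(1) by (intro mult_left_mono) auto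
    ultimately have "?a \<le> r" using le qr by linarith
    then have "b \<in> cball 0 r" using norm_le_skewB[of b] by simp
    then show "\<exists>s t. \<exists>b\<in>cball 0 r. N ** rot s t = cayB b" using b(1) unfolding Q_def by metis
  qed
qed

section \<open>Invariance under the stabiliser rotations\<close>

lemma rot_inverse: "rot s t ** rot (- s) (- t) = mat 1" "rot (- s) (- t) ** rot s t = mat 1"
  unfolding vec_eq_iff forall_4
  by (simp_all add: matrix_matrix_mult_def sum_4 rot_def mat_def power2_eq_square[symmetric])

text \<open>The adjoint action of the stabiliser preserves the tangent directions: it rotates the
  off-diagonal 2x2 block from the left by \<open>s\<close> and from the right by
  \<open>- t\<close>.\<close>

lemma rot_conjugate_skewB: "\<exists>d. rot s t ** skewB c = skewB d ** rot s t"
proof -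
  have "\<exists>d. rot s t ** skewB c ** rot (- s) (- t) = skewB d"
  proof
    let ?S = "cos s" and ?s = "sin s" and ?T = "cos t" and ?t = "sin t"
    show "rot s t ** skewB c ** rot (- s) (- t) = skewB (vector
      [(?S * c$1 - ?s * c$3) * ?T - (?S * c$2 - ?s * c$4) * ?t, (?S * c$1 - ?s * c$3) * ?t + (?S * c$2 - ?s * c$4) * ?T,
       (?s * c$1 + ?S * c$3) * ?T - (?s * c$2 + ?S * c$4) * ?t, (?s * c$1 + ?S * c$3) * ?t + (?s * c$2 + ?S * c$4) * ?T])"
      unfolding vec_eq_iff forall_4
      by (simp add: matrix_matrix_mult_def sum_4 rot_def skewB_def vector_def algebra_simps)
  qed
  then show ?thesis by (metis matrix_mul_assoc matrix_mul_rid rot_inverse(2))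
qed

lemma crit_rot:
  assumes w: "smooth w" and M: "invertible M" and cr: "crit w M"
  shows "crit w (M ** rot s t)"
  unfolding crit_def
proof
  fix c
  obtain d where d: "rot s t ** skewB c = skewB d ** rot s t" using rot_conjugate_skewB by blast
  have "M ** rot s t ** skewB c = M ** skewB d ** rot s t" by (metis d matrix_mul_assoc)
  then show "I1 w (M ** rot s t) (M ** rot s t ** skewB c) = 0"
    using cr by (simp add: I1_rot[OF w M] crit_def)
qed

text \<open>The adjoint action carries \<open>hess\<close> at \<open>M ** rot s t\<close> to
  \<open>hess\<close> at \<open>M\<close>, and being invertible it preserves nonzero
  directions.\<close>

lemma nondeg_rot:
  assumes w: "smooth w" and M: "invertible M" and nd: "nondeg w (M ** rot s t)"
  shows "nondeg w M"
  unfolding nondeg_def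
proof (intro allI impI)
  fix d :: "real^4" assume "d \<noteq> 0"
  obtain c where "rot (-s) (-t) ** skewB d = skewB c ** rot (-s) (-t)" using rot_conjugate_skewB by blast
  then have c: "rot s t ** skewB c = skewB d ** rot s t"
    by (metis matrix_mul_assoc matrix_mul_lid matrix_mul_rid rot_inverse)
  have "c \<noteq> 0"
  proof
    assume "c = 0"
    then have "skewB d = 0" using c rot_inverse(1)
      by (metis bounded_bilinear.zero_left[OF bounded_bilinear_matrix_mult] bounded_bilinear.zero_right[OF bounded_bilinear_matrix_mult]
          matrix_mul_assoc matrix_mul_rid skewB_0)
    then show False using norm_le_skewB[of d] \<open>d \<noteq> 0\<close> by simp
  qed
  then obtain c2 where c2: "hess w (M ** rot s t) (skewB c) (skewB c2) \<noteq> 0" using nd by (auto simp: nondeg_def)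
  obtain d2 where d2: "rot s t ** skewB c2 = skewB d2 ** rot s t" using rot_conjugate_skewB by blast
  have 1: "M ** rot s t ** skewB c = M ** skewB d ** rot s t" "M ** rot s t ** skewB c2 = M ** skewB d2 ** rot s t"
    by (metis c matrix_mul_assoc, metis d2 matrix_mul_assoc)
  have 2: "M ** rot s t ** skewB c ** skewB c2 = M ** skewB d ** skewB d2 ** rot s t"
    unfolding 1 by (metis d2 matrix_mul_assoc)
  have "hess w (M ** rot s t) (skewB c) (skewB c2) = hess w M (skewB d) (skewB d2)"
    unfolding hess_def 2 unfolding 1 I1_rot[OF w M] I2_rot[OF w M] ..
  with c2 show "\<exists>c. hess w M (skewB d) (skewB c) \<noteq> 0" by auto
qed

theorem theorem3p1:
  shows "\<exists>U1. genericC U1 \<and> (\<forall>u\<in>U1. morse_type_I u)"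
proof -
  let ?O = "{M :: real^4^4. orthogonal_matrix M}"
  have "\<exists>r \<delta>. \<delta> > 0 \<and> (\<forall>b\<in>cball 0 r. invertible (testmat M b)) \<and>
      (\<forall>N. orthogonal_matrix N \<longrightarrow> norm (N - mat 1) < \<delta> \<longrightarrow> (\<exists>s t. \<exists>b\<in>cball 0 r. N ** rot s t = cayB b))"
    if "orthogonal_matrix M" for M
    using testmat_invertible_near_0[OF that] chart_covers_neighbourhood by metis
  then obtain r \<delta> where \<delta>: "\<And>M. orthogonal_matrix M \<Longrightarrow> \<delta> M > 0"
    and inv: "\<And>M b. orthogonal_matrix M \<Longrightarrow> b \<in> cball 0 (r M) \<Longrightarrow> invertible (testmat M b)"
    and cov: "\<And>M N. orthogonal_matrix M \<Longrightarrow> orthogonal_matrix N \<Longrightarrow> norm (N - mat 1) < \<delta> M \<Longrightarrow>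
        \<exists>s t. \<exists>b\<in>cball 0 (r M). N ** rot s t = cayB b"
    by metis
  \<comment> \<open>Left translates by \<open>M\<close> of the neighbourhoods of the identity
    covered by the charts. They are open, so countably many cover the orthogonal group by the
    Lindelof property.\<close>
  define V where "V M = {N :: real^4^4. norm (transpose M ** N - mat 1) < \<delta> M}" for M
  have open_V: "open (V M)" for M
    unfolding V_def by (intro open_Collect_less continuous_intros)
  obtain \<F> where \<F>: "\<F> \<subseteq> V ` ?O" "countable \<F>" "\<Union>\<F> = \<Union>(V ` ?O)"
    by (rule Lindelof[of "V ` ?O"]) (use open_V in auto)
  then obtain C where C: "countable C" "C \<subseteq> ?O" "\<F> = V ` C"
    by (meson countable_subset_image)
  have covers: "\<exists>M\<in>C. N \<in> V M" if "orthogonal_matrix N" for N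
  proof -
    have "N \<in> V N" using that \<delta>[OF that] by (simp add: V_def orthogonal_matrix)
    then show ?thesis using that \<F>(3) C(3) by auto
  qed
  \<comment> \<open>Genericity is phrased with a sequence of sets; \<open>from_nat_into\<close>
    enumerates \<open>C\<close>, possibly with repetitions, once it is nonempty.\<close>
  have "C \<noteq> {}" using covers[OF orthogonal_matrix_id] by auto
  define F where "F n = locally_morse (from_nat_into C n) (r (from_nat_into C n))" for n
  have oC: "orthogonal_matrix (from_nat_into C n)" for n
    using from_nat_into[OF \<open>C \<noteq> {}\<close>, of n] C(2) by auto
  have "openC (F n) \<and> denseC (F n)" for n
    unfolding F_def using open_locally_morse dense_locally_morse inv oC by blast
  moreover have "(\<Inter>n. F n) \<subseteq> CinfS3" by (auto simp: F_def locally_morse_def)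
  ultimately have "genericC (\<Inter>n. F n)" unfolding genericC_def by blast
  moreover have "morse_type_I u" if u: "u \<in> (\<Inter>n. F n)" for u
  proof (rule morse_type_I_criterion)
    show uC: "u \<in> CinfS3" using u by (auto simp: F_def locally_morse_def)
    fix N :: "real^4^4" assume N: "orthogonal_matrix N" and cr: "crit (radial u) N"
    obtain M where M: "M \<in> C" "N \<in> V M" using covers[OF N] by blast
    have oM: "orthogonal_matrix M" using M(1) C(2) by auto
    have "orthogonal_matrix (transpose M ** N)"
      using oM N by (simp add: orthogonal_matrix_mul orthogonal_matrix_transpose)
    then obtain s t b where b: "b \<in> cball 0 (r M)" "transpose M ** N ** rot s t = cayB b"
      using cov[OF oM] M(2) unfolding V_def by blast
    \<comment> \<open>The rotated matrix represents the same torus and lies in the chart ball at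
      \<open>M\<close>. Criticality is carried there from \<open>N\<close>, and nondegeneracy is
      carried back.\<close>
    have eq: "N ** rot s t = M ** cayB b"
    proof -
      have "M ** transpose M = mat 1" using oM by (simp add: orthogonal_matrix_def)
      then show ?thesis unfolding b(2)[symmetric] by (simp add: matrix_mul_assoc)
    qed
    obtain n where "from_nat_into C n = M" using from_nat_into_surj[OF C(1) M(1)] by blast
    then have "u \<in> locally_morse M (r M)" using u by (auto simp: F_def)
    moreover have w: "smooth (radial u)" and iN: "invertible N"
      using uC N by (simp_all add: CinfS3_smooth invertible_orthogonal)
    ultimately have "nondeg (radial u) (N ** rot s t)"
      using crit_rot[OF w iN cr, of s t] b(1) unfolding eq locally_morse_def by blast
    then show "nondeg (radial u) N" by (rule nondeg_rot[OF w iN])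
  qed
  ultimately show ?thesis by blast
qed

end
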